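(* For every partition $\lambda$, $s_\lambda(x\|a)=\sum_P\mathrm{wt}(P)$, where the sum is over all $\lambda$-halfplane pipedreams $P$.
   Context: Squares are indexed by matrix coordinates $(i,j)$ (row $i$ increasing downward, column $j$ increasing rightward). Tiles: empty; NW elbow (pipe joining north and west edges); SE elbow (joining south and east edges); horizontal line; vertical line; crossing. For a partition $\lambda$ (conjugate $\lambda'$), $w_\lambda$ is the permutation of $\mathbb{Z}$ with $w_\lambda(i)=i+\lambda_{1-i}$ for $i\le0$ and $w_\lambda(i)=i-\lambda'_i$ for $i>0$; put $I_+=\mathbb{Z}_{>0}\cap w_\lambda(\mathbb{Z}_{\le0})$ and $I_-=\mathbb{Z}_{\le0}\cap w_\lambda(\mathbb{Z}_{>0})$. A $\lambda$-halfplane pipedream is a tiling of the upper halfplane $H=\{(i,j)\mid i\le0,\ j\in\mathbb{Z}\}$ by these tiles, using no crossing tile, such that: (1) unlabeled pipes enter $H$ from its southern boundary exactly in the columns of a set $I\subset\mathbb{Z}$; (2) $I\cap\mathbb{Z}_{>0}=I_+$ and $\mathbb{Z}_{\le0}\setminus I=I_-$; (3) the $i$-th eastmost pipe entering from the south heads off to the east (to column $+\infty$) in row $1-i$, for each $i\ge1$. Its weight is $\mathrm{wt}(P)=\prod(x_i-a_j)$ over the empty tiles $(i,j)$ of $P$. $\Lambda(x\|a)$ is the $\mathbb{Q}[a_i\mid i\in\mathbb{Z}]$-algebra generated by $p_k(x\|a)=\sum_{i\le0}(x_i^k-a_i^k)$, inside formal power series. For a symmetric function $f$, $f(x/a)$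 is its image under $p_k\mapsto p_k(x\|a)$. Let $\gamma_a$ be the automorphism with $a_i\mapsto a_{i+1}$ and $p_k(x\|a)\mapsto p_k(x\|a)-a_1^k$; $h_r(x\|a)=\gamma_a^{r-1}(h_r(x/a))$, and the double Schur function is $s_\lambda(x\|a)=\det\big(\gamma_a^{1-j}(h_{\lambda_i-i+j}(x\|a))\big)$.
   Formalization: The sum is restricted to pipedreams in which all but finitely many pipes are hooks (enter in column N, go north to (N,N), then east); with conditions (1)–(3) alone the claim fails, e.g. for λ=(1), where a pipedream with no empty tiles adds an extra summand 1. *)

theory Defs
  imports
    "HOL-Library.Poly_Mapping"
    "HOL-Library.FuncSet"
    "Jordan_Normal_Form.Determinant"
begin

section \<open>Formal power series in arbitrarily many variables\<close>

text \<open>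
  A monomial in variables of type \<open>'v\<close> is a finitely supported exponent vector
  \<open>'v \<Rightarrow>\<^sub>0 nat\<close>; addition of exponent vectors is multiplication of monomials.  A formal power
  series assigns an arbitrary coefficient to every monomial.
\<close>

typedef ('v, 'c) mps = "UNIV :: (('v \<Rightarrow>\<^sub>0 nat) \<Rightarrow> 'c) set"
  morphisms mps_coeff Abs_mps ..

lemma mps_coeff_Abs [simp]: "mps_coeff (Abs_mps f) = f"
  by (simp add: Abs_mps_inverse)

lemma mps_eqI: "(\<And>m. mps_coeff f m = mps_coeff g m) \<Longrightarrow> f = g"
  by (simp add: mps_coeff_inject[symmetric] fun_eq_iff)

definition splits :: "('v \<Rightarrow>\<^sub>0 nat) \<Rightarrow> (('v \<Rightarrow>\<^sub>0 nat) \<times> ('v \<Rightarrow>\<^sub>0 nat)) set" where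
  "splits m = {(p, q). p + q = m}"

lemma finite_splits [simp]: "finite (splits m)"
proof -
  let ?B = "PiE (Poly_Mapping.keys m) (\<lambda>v. {..Poly_Mapping.lookup m v})"
  let ?F = "\<lambda>(p, q). restrict (Poly_Mapping.lookup p) (Poly_Mapping.keys m)"
  have le: "Poly_Mapping.lookup p v \<le> Poly_Mapping.lookup m v" if "p + q = m" for p q :: "'a \<Rightarrow>\<^sub>0 nat" and v
    using that by (auto simp: lookup_add)
  have "inj_on ?F (splits m)"
  proof (rule inj_onI)
    fix s t assume s: "s \<in> splits m" and t: "t \<in> splits m" and e: "?F s = ?F t"
    obtain p q where pq: "s = (p, q)" "p + q = m" using s by (auto simp: splits_def)
    obtain p' q' where pq': "t = (p', q')" "p' + q' = m" using t by (auto simp: splits_def)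
    have "p = p'"
    proof (rule poly_mapping_eqI)
      fix v
      show "Poly_Mapping.lookup p v = Poly_Mapping.lookup p' v"
      proof (cases "v \<in> Poly_Mapping.keys m")
        case True
        then show ?thesis using fun_cong[OF e, of v] pq pq' by simp
      next
        case False
        then show ?thesis using le[OF pq(2), of v] le[OF pq'(2), of v]
          by (simp add: in_keys_iff)
      qed
    qed
    then show "s = t" using pq pq' by auto
  qed
  moreover have "?F ` splits m \<subseteq> ?B"
    using le by (auto simp: splits_def)
  moreover have "finite ?B" by (intro finite_PiE) auto
  ultimately show ?thesis by (meson finite_imageD finite_subset)
qed

instantiation mps :: (type, comm_ring_1) comm_ring_1
begin

definition "0 = Abs_mps (\<lambda>_. 0)"
definition "1 = Abs_mps (\<lambda>m. if m = 0 then 1 else 0)"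
definition "f + g = Abs_mps (\<lambda>m. mps_coeff f m + mps_coeff g m)"
definition "f - g = Abs_mps (\<lambda>m. mps_coeff f m - mps_coeff g m)"
definition "- f = Abs_mps (\<lambda>m. - mps_coeff f m)"
definition "f * g = Abs_mps (\<lambda>m. \<Sum>(p, q)\<in>splits m. mps_coeff f p * mps_coeff g q)"

instance
proof
  fix a b c :: "('a, 'b) mps"
  show "a + b + c = a + (b + c)" by (simp add: plus_mps_def add.assoc)
  show "a + b = b + a" by (simp add: plus_mps_def add.commute)
  show "0 + a = a" by (simp add: plus_mps_def zero_mps_def mps_coeff_inverse)
  show "- a + a = 0" by (simp add: plus_mps_def zero_mps_def uminus_mps_def)
  show "a - b = a + - b" by (simp add: plus_mps_def minus_mps_def uminus_mps_def)
  show "a * b = b * a"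
    by (auto simp: times_mps_def splits_def mult.commute add.commute fun_eq_iff
        intro!: arg_cong[where f = Abs_mps]
          sum.reindex_bij_witness[where i = "\<lambda>(p, q). (q, p)" and j = "\<lambda>(p, q). (q, p)"])
  show "(a + b) * c = a * c + b * c"
    by (simp add: plus_mps_def times_mps_def distrib_right sum.distrib split_beta)
  show "1 * a = a"
  proof (rule mps_eqI)
    fix m
    have "mps_coeff (1 * a) m = (\<Sum>s\<in>splits m. if s = (0, m) then mps_coeff a m else 0)"
      unfolding times_mps_def one_mps_def mps_coeff_Abs
      by (rule sum.cong) (auto simp: splits_def split_beta)
    also have "\<dots> = mps_coeff a m"
    proof -
      have "(0, m) \<in> splits m" by (simp add: splits_def)
      then show ?thesis by (simp add: sum.delta)
    qed
    finally show "mps_coeff (1 * a) m = mps_coeff a m" .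
  qed
  show "(0 :: ('a, 'b) mps) \<noteq> 1"
    by (auto simp: zero_mps_def one_mps_def Abs_mps_inject fun_eq_iff)
  show "a * b * c = a * (b * c)"
  proof (rule mps_eqI)
    fix m
    have "mps_coeff (a * b * c) m =
      (\<Sum>(s, t)\<in>Sigma (splits m) (\<lambda>s. splits (fst s)).
        mps_coeff a (fst t) * mps_coeff b (snd t) * mps_coeff c (snd s))"
      by (simp add: times_mps_def split_beta sum_distrib_right sum.Sigma)
    also have "\<dots> = (\<Sum>(s, t)\<in>Sigma (splits m) (\<lambda>s. splits (snd s)).
        mps_coeff a (fst s) * (mps_coeff b (fst t) * mps_coeff c (snd t)))"
      by (rule sum.reindex_bij_witness[where
            i = "\<lambda>((p, q), (u, v)). ((p + u, v), (p, u))" and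
            j = "\<lambda>((p, q), (u, v)). ((u, v + q), (v, q))"])
         (auto simp: splits_def ac_simps)
    also have "\<dots> = mps_coeff (a * (b * c)) m"
      by (simp add: times_mps_def split_beta sum_distrib_left sum.Sigma)
    finally show "mps_coeff (a * b * c) m = mps_coeff (a * (b * c)) m" .
  qed
qed

end

definition mps_const :: "'c::comm_ring_1 \<Rightarrow> ('v, 'c) mps" where
  "mps_const c = Abs_mps (\<lambda>m. if m = 0 then c else 0)"

definition mps_var :: "'v \<Rightarrow> ('v, 'c::comm_ring_1) mps" where
  "mps_var v = Abs_mps (\<lambda>m. if m = Poly_Mapping.single v 1 then 1 else 0)"

text \<open>
  Infinite sums of formal power series: every monomial receives a nonzero coefficient from only
  finitely many summands, and coefficients are added up.
\<close>

definition mps_summable :: "('p \<Rightarrow> ('v, 'c::comm_ring_1) mps) \<Rightarrow> 'p set \<Rightarrow> bool" where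
  "mps_summable f S \<longleftrightarrow> (\<forall>m. finite {P \<in> S. mps_coeff (f P) m \<noteq> 0})"

definition mps_suminf :: "('p \<Rightarrow> ('v, 'c::comm_ring_1) mps) \<Rightarrow> 'p set \<Rightarrow> ('v, 'c) mps" where
  "mps_suminf f S = Abs_mps (\<lambda>m. \<Sum>P | P \<in> S \<and> mps_coeff (f P) m \<noteq> 0. mps_coeff (f P) m)"

definition mps_has_sum ::
  "('p \<Rightarrow> ('v, 'c::comm_ring_1) mps) \<Rightarrow> 'p set \<Rightarrow> ('v, 'c) mps \<Rightarrow> bool" where
  "mps_has_sum f S s \<longleftrightarrow> mps_summable f S \<and> mps_suminf f S = s"


section \<open>Subalgebras of power series over the rationals\<close>

inductive_set subalgebra :: "('v, rat) mps set \<Rightarrow> ('v, rat) mps set"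
  for G :: "('v, rat) mps set" where
  gen: "g \<in> G \<Longrightarrow> g \<in> subalgebra G"
| const: "mps_const c \<in> subalgebra G"
| add: "f \<in> subalgebra G \<Longrightarrow> g \<in> subalgebra G \<Longrightarrow> f + g \<in> subalgebra G"
| mult: "f \<in> subalgebra G \<Longrightarrow> g \<in> subalgebra G \<Longrightarrow> f * g \<in> subalgebra G"

text \<open>
  Homomorphisms of rational algebras defined on a subset \<open>S\<close>; the value outside \<open>S\<close> is pinned
  to \<open>undefined\<close>, so that a homomorphism is determined by its values on \<open>S\<close>.
\<close>

definition algebra_hom ::
  "('v, rat) mps set \<Rightarrow> ('v, rat) mps set \<Rightarrow> (('v, rat) mps \<Rightarrow> ('v, rat) mps) \<Rightarrow> bool" where
  "algebra_hom S T \<phi> \<longleftrightarrow> \<phi> \<in> S \<rightarrow>\<^sub>E T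
     \<and> (\<forall>c. \<phi> (mps_const c) = mps_const c)
     \<and> (\<forall>f\<in>S. \<forall>g\<in>S. \<phi> (f + g) = \<phi> f + \<phi> g)
     \<and> (\<forall>f\<in>S. \<forall>g\<in>S. \<phi> (f * g) = \<phi> f * \<phi> g)"


section \<open>Double symmetric functions\<close>

text \<open>Only the variables \<open>x\<^sub>i\<close> with \<open>i \<le> 0\<close> are used; the \<open>a\<^sub>j\<close> are indexed by all integers.\<close>

datatype var = XVar int | AVar int

type_synonym series = "(var, rat) mps"

abbreviation xvar :: "int \<Rightarrow> series" where "xvar i \<equiv> mps_var (XVar i)"
abbreviation avar :: "int \<Rightarrow> series" where "avar j \<equiv> mps_var (AVar j)"

text \<open>The power sum \<open>p\<^sub>k\<close> in the variables \<open>x\<^sub>i\<close>, \<open>i \<le> 0\<close>, and its double version \<open>p\<^sub>k(x||a)\<close>.\<close>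

definition psum :: "nat \<Rightarrow> series" where
  "psum k = mps_suminf (\<lambda>i. xvar i ^ k) {..0}"

definition psum_double :: "nat \<Rightarrow> series" where
  "psum_double k = mps_suminf (\<lambda>i. xvar i ^ k - avar i ^ k) {..0}"

text \<open>
  Symmetric functions with rational coefficients, in the variables \<open>x\<^sub>i\<close>, \<open>i \<le> 0\<close>: over the
  rationals, this is the algebra generated by the power sums.
\<close>

definition Sym :: "series set" where
  "Sym = subalgebra {psum k | k. k \<ge> 1}"

text \<open>
  The algebra \<open>\<Lambda>(x||a)\<close>.  It contains the \<open>a\<^sub>j\<close> because it is an algebra over the polynomial ring
  in the \<open>a\<^sub>j\<close>.
\<close>

definition Lam :: "series set" where
  "Lam = subalgebra (range avar \<union> {psum_double k | k. k \<ge> 1})"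

text \<open>The map \<open>f \<mapsto> f(x/a)\<close>.\<close>

definition superize :: "series \<Rightarrow> series" where
  "superize = (THE \<phi>. algebra_hom Sym Lam \<phi> \<and> (\<forall>k\<ge>1. \<phi> (psum k) = psum_double k))"

text \<open>
  The complete symmetric function \<open>h\<^sub>r\<close>: the sum of all monomials of degree \<open>r\<close> in the \<open>x\<^sub>i\<close>,
  \<open>i \<le> 0\<close>.
\<close>

definition hsym :: "nat \<Rightarrow> series" where
  "hsym r = Abs_mps (\<lambda>m. if Poly_Mapping.keys m \<subseteq> XVar ` {..0}
     \<and> (\<Sum>v\<in>Poly_Mapping.keys m. Poly_Mapping.lookup m v) = r then 1 else 0)"

text \<open>The automorphism \<open>\<gamma>\<^sub>a\<close> of \<open>\<Lambda>(x||a)\<close> and its integer powers.\<close>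

definition gamma :: "series \<Rightarrow> series" where
  "gamma = (THE \<phi>. algebra_hom Lam Lam \<phi> \<and> bij_betw \<phi> Lam Lam
     \<and> (\<forall>i. \<phi> (avar i) = avar (i + 1))
     \<and> (\<forall>k\<ge>1. \<phi> (psum_double k) = psum_double k - avar 1 ^ k))"

definition gamma_pow :: "int \<Rightarrow> series \<Rightarrow> series" where
  "gamma_pow n = (if n \<ge> 0 then gamma ^^ nat n else inv_into Lam gamma ^^ nat (- n))"

definition h_double :: "int \<Rightarrow> series" where
  "h_double r = (if r < 0 then 0 else gamma_pow (r - 1) (superize (hsym (nat r))))"


section \<open>Partitions and double Schur functions\<close>

text \<open>A partition is the weakly decreasing list of its positive parts.\<close>

definition is_partition :: "nat list \<Rightarrow> bool" where
  "is_partition lam \<longleftrightarrow> sorted_wrt (\<ge>) lam \<and> (\<forall>k\<in>set lam. k > 0)"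

text \<open>The parts \<open>\<lambda>\<^sub>i\<close>, \<open>i \<ge> 1\<close>, extended by zeros, and the parts of the conjugate partition.\<close>

definition part :: "nat list \<Rightarrow> nat \<Rightarrow> nat" where
  "part lam i = (if 1 \<le> i \<and> i \<le> length lam then lam ! (i - 1) else 0)"

definition conj_part :: "nat list \<Rightarrow> nat \<Rightarrow> nat" where
  "conj_part lam j = card {i. 1 \<le> i \<and> j \<le> part lam i}"

text \<open>Matrix entries are numbered from \<open>0\<close>: entry \<open>(i, j)\<close> is the one in row \<open>i + 1\<close>, column \<open>j + 1\<close>.\<close>

definition double_schur :: "nat list \<Rightarrow> series" where
  "double_schur lam = det (mat (length lam) (length lam) (\<lambda>(i, j).
     gamma_pow (1 - int (j + 1))
       (h_double (int (part lam (i + 1)) - int (i + 1) + int (j + 1)))))"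


section \<open>Halfplane pipedreams\<close>

definition w_perm :: "nat list \<Rightarrow> int \<Rightarrow> int" where
  "w_perm lam i = (if i \<le> 0 then i + int (part lam (nat (1 - i)))
                   else i - int (conj_part lam (nat i)))"

definition I_plus :: "nat list \<Rightarrow> int set" where
  "I_plus lam = {0<..} \<inter> w_perm lam ` {..0}"

definition I_minus :: "nat list \<Rightarrow> int set" where
  "I_minus lam = {..0} \<inter> w_perm lam ` {0<..}"

datatype tile = Empty | NW | SE | Horiz | Vert | Crossing

datatype side = North | East | South | West

fun edges :: "tile \<Rightarrow> side set" where
  "edges Empty = {}"
| "edges NW = {North, West}"
| "edges SE = {South, East}"
| "edges Horiz = {East, West}"
| "edges Vert = {North, South}"
| "edges Crossing = {North, East, South, West}"

definition halfplane :: "(int \<times> int) set" where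
  "halfplane = {(i, j). i \<le> 0}"

text \<open>
  In a tiling, the pipes match along every edge shared by two squares of the halfplane.  Tilings are
  \<open>undefined\<close> off the halfplane, so that each tiling is a single function.
\<close>

definition tiling :: "(int \<times> int \<Rightarrow> tile) \<Rightarrow> bool" where
  "tiling P \<longleftrightarrow> P \<in> halfplane \<rightarrow>\<^sub>E UNIV
     \<and> (\<forall>(i, j)\<in>halfplane. East \<in> edges (P (i, j)) \<longleftrightarrow> West \<in> edges (P (i, j + 1)))
     \<and> (\<forall>(i, j)\<in>halfplane. North \<in> edges (P (i, j)) \<longleftrightarrow> South \<in> edges (P (i - 1, j)))"

definition entry_columns :: "(int \<times> int \<Rightarrow> tile) \<Rightarrow> int set" where
  "entry_columns P = {j. South \<in> edges (P (0, j))}"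

text \<open>
  A pipe is followed square by square; \<open>(s, d)\<close> means that it enters square \<open>s\<close> through side \<open>d\<close>.
  In a tiling, a pipe that enters through the south or west side leaves through the north or east
  side.
\<close>

fun advance :: "(int \<times> int \<Rightarrow> tile) \<Rightarrow> (int \<times> int) \<times> side \<Rightarrow> (int \<times> int) \<times> side" where
  "advance P ((i, j), d) =
     (if (d = South \<and> P (i, j) \<in> {Vert, Crossing}) \<or> (d = West \<and> P (i, j) = NW)
      then ((i - 1, j), South) else ((i, j + 1), West))"

definition pipe :: "(int \<times> int \<Rightarrow> tile) \<Rightarrow> int \<Rightarrow> nat \<Rightarrow> (int \<times> int) \<times> side" where
  "pipe P c n = (advance P ^^ n) ((0, c), South)"

definition heads_east :: "(int \<times> int \<Rightarrow> tile) \<Rightarrow> int \<Rightarrow> int \<Rightarrow> bool" where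
  "heads_east P c r \<longleftrightarrow> (\<exists>n j. \<forall>m. pipe P c (n + m) = ((r, j + int m), West))"

text \<open>
  The hook with corner \<open>(N, N)\<close>: enter in column \<open>N\<close>, go north to row \<open>N\<close>, turn, go east.
\<close>

definition is_hook :: "(int \<times> int \<Rightarrow> tile) \<Rightarrow> int \<Rightarrow> bool" where
  "is_hook P N \<longleftrightarrow> P (N, N) = SE
     \<and> (\<forall>i. N < i \<and> i \<le> 0 \<longrightarrow> P (i, N) = Vert)
     \<and> (\<forall>j>N. P (N, j) = Horiz)"

text \<open>
  The final condition is the usual convention for bumpless pipedreams in an infinite region that
  all but finitely many pipes are hooks.  Without it there are configurations in which the
  deviation from the hooks escapes to infinity.  For example, for the partition \<open>(1)\<close>, let row
  \<open>n \<le> 0\<close> have an SE elbow in column \<open>n - 1\<close>, an NW elbow in column \<open>n\<close>, an SE elbow in column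
  \<open>n + 1\<close>, vertical lines west of these and horizontal lines east of these; this tiling satisfies
  all other conditions, but it has no empty tile and would contribute a spurious summand \<open>1\<close>.
\<close>

definition halfplane_pipedreams :: "nat list \<Rightarrow> (int \<times> int \<Rightarrow> tile) set" where
  "halfplane_pipedreams lam = {P. tiling P
     \<and> (\<forall>s\<in>halfplane. P s \<noteq> Crossing)
     \<and> entry_columns P \<inter> {0<..} = I_plus lam
     \<and> {..0} - entry_columns P = I_minus lam
     \<and> (\<forall>i\<ge>1. \<forall>c\<in>entry_columns P.
          card {c' \<in> entry_columns P. c' \<ge> c} = i \<longrightarrow> heads_east P c (1 - int i))
     \<and> (\<exists>N0\<le>0. \<forall>N\<le>N0. is_hook P N)}"

definition weight :: "(int \<times> int \<Rightarrow> tile) \<Rightarrow> series" where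
  "weight P = (\<Prod>(i, j) | (i, j) \<in> halfplane \<and> P (i, j) = Empty. xvar i - avar j)"

end

theory Submission
  imports Defs "HOL-Computational_Algebra.Formal_Power_Series"
begin

text \<open>
  Both sides satisfy the same recursion in the rows of the halfplane.  By Newton's identities,
  \<open>h\<^sub>r(x||a)\<close> and its shifts are coefficients of \<open>\<Prod>\<^sub>j\<^sub>\<le>\<^sub>z (1 - a\<^sub>j u) / \<Prod>\<^sub>i\<^sub>\<le>\<^sub>0 (1 - x\<^sub>i u)\<close>, where \<open>z\<close>
  depends only on the row of the Jacobi-Trudi matrix.  Removing the variable \<open>x\<^sub>0\<close> from the generating
  functions and combining adjacent rows expands the determinant over all ways to remove a horizontal
  strip from \<open>\<lambda>\<close>, each weighted by a product of factors \<open>x\<^sub>0 - a\<^sub>j\<close>.  These are exactly the possible bottom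
  rows of a pipedream, \<open>j\<close> running over its empty squares.  A given monomial involves
  finitely many variables, so it only sees the pipedreams that consist of hooks from some fixed row on, and
  after that many steps the remaining determinant contributes only for the empty partition.
\<close>

section \<open>Coefficients\<close>

text \<open>\<open>superize\<close> and \<open>gamma\<close> are definite descriptions, so nothing
  is known about them until such maps are shown to exist and to be unique. For \<open>gamma\<close>
  the map is the shift a_j -> a_(j+1), because p_k(x||a) - a_1^k is p_k(x) minus the sum of a_j^k
  over j <= 1. For \<open>superize\<close> the obstacle is that every polynomial relation among the
  p_k must survive among the p_k(x||a); a family of renamings of variables settles this without
  proving the p_k algebraically independent. Infinite products are avoided too: the generating
  functions are characterised by their logarithmic derivatives, that is, by power sums. The
  parameter z depends only on the row because the shift 1 - j of column j cancels the j in the shift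
  r - 1 with r = \<lambda>_i - i + j, which leaves \<lambda>_i - i. The number of rows before the
  hooks take over is not bounded over all pipedreams, so identities are compared after setting to 0
  a set of variables that misses the given monomial.\<close>

lemma coeff_zero [simp]: "mps_coeff 0 m = 0"
  and coeff_one: "mps_coeff 1 m = (if m = 0 then 1 else 0)"
  and coeff_add [simp]: "mps_coeff (f + g) m = mps_coeff f m + mps_coeff g m"
  and coeff_diff [simp]: "mps_coeff (f - g) m = mps_coeff f m - mps_coeff g m"
  and coeff_uminus [simp]: "mps_coeff (- f) m = - mps_coeff f m"
  by (simp_all add: zero_mps_def one_mps_def plus_mps_def minus_mps_def uminus_mps_def)

lemma coeff_mult: "mps_coeff (f * g) m = (\<Sum>(p, q)\<in>splits m. mps_coeff f p * mps_coeff g q)"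
  by (simp add: times_mps_def)

lemma coeff_sum [simp]: "mps_coeff (sum f A) m = (\<Sum>x\<in>A. mps_coeff (f x) m)"
  by (induction A rule: infinite_finite_induct) auto

lemma coeff_const: "mps_coeff (mps_const c) m = (if m = 0 then c else 0)"
  by (simp add: mps_const_def)

lemma coeff_const_mult [simp]: "mps_coeff (mps_const c * f) m = c * mps_coeff f m"
proof -
  have "mps_coeff (mps_const c * f) m = (\<Sum>s\<in>splits m. if s = (0, m) then c * mps_coeff f m else 0)"
    unfolding coeff_mult by (rule sum.cong) (auto simp: splits_def coeff_const split: if_splits)
  also have "\<dots> = c * mps_coeff f m"
    using finite_splits[of m] by (subst sum.delta) (auto simp: splits_def)
  finally show ?thesis .
qed

lemma mps_const_0 [simp]: "mps_const 0 = 0"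
  and mps_const_1 [simp]: "mps_const 1 = 1"
  and mps_const_add: "mps_const (c + d) = mps_const c + mps_const d"
  and mps_const_uminus: "mps_const (- c) = - mps_const c"
  by (rule mps_eqI; simp add: coeff_const coeff_one)+

lemma of_nat_mps: "of_nat n = mps_const (of_nat n)"
  by (induction n) (auto simp: mps_const_add)

lemma coeff_of_nat_mult [simp]: "mps_coeff (of_nat n * f) m = of_nat n * mps_coeff f m"
  by (simp add: of_nat_mps)

abbreviation monom_pow :: "'v \<Rightarrow> nat \<Rightarrow> ('v \<Rightarrow>\<^sub>0 nat)" where
  "monom_pow v k \<equiv> Poly_Mapping.single v k"

lemma monom_pow_add_diff:
  assumes "k \<le> Poly_Mapping.lookup m v"
  shows "monom_pow v k + (m - monom_pow v k) = m"
  using assms by (intro poly_mapping_eqI) (auto simp: lookup_add lookup_minus lookup_single when_def)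

lemma single_eq_single_iff:
  fixes a b :: nat
  assumes "a > 0"
  shows "Poly_Mapping.single v a = Poly_Mapping.single w b \<longleftrightarrow> v = w \<and> a = b"
proof
  assume e: "Poly_Mapping.single v a = Poly_Mapping.single w b"
  then have "a = Poly_Mapping.lookup (Poly_Mapping.single w b) v" by (metis lookup_single_eq)
  then show "v = w \<and> a = b" using assms by (auto simp: lookup_single when_def split: if_splits)
qed auto

text \<open>The hypothesis says that f is a scalar multiple of the monomial v^k, so at most one
  splitting of m survives in the convolution.\<close>

lemma coeff_mult_supported:
  fixes f g :: "('v, 'c::comm_ring_1) mps"
  assumes supp: "\<And>p. mps_coeff f p \<noteq> 0 \<Longrightarrow> p \<in> monom_pow v ` {k}"
  shows "mps_coeff (f * g) m = (if k \<le> Poly_Mapping.lookup m v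
    then mps_coeff f (monom_pow v k) * mps_coeff g (m - monom_pow v k) else 0)"
proof -
  let ?s = "(monom_pow v k, m - monom_pow v k)"
  have z: "fst s = monom_pow v k \<or> mps_coeff f (fst s) = 0" for s :: "('v \<Rightarrow>\<^sub>0 nat) \<times> ('v \<Rightarrow>\<^sub>0 nat)"
    using supp by auto
  have le: "k \<le> Poly_Mapping.lookup (monom_pow v k + q) v" for q
    by (simp add: lookup_add)
  have "mps_coeff (f * g) m = (\<Sum>s\<in>splits m. if s = ?s
      then mps_coeff f (monom_pow v k) * mps_coeff g (m - monom_pow v k) else 0)"
    unfolding coeff_mult
  proof (rule sum.cong)
    fix s assume s: "s \<in> splits m"
    then obtain p q where pq: "s = (p, q)" "p + q = m" by (auto simp: splits_def)
    then show "(case s of (p, q) \<Rightarrow> mps_coeff f p * mps_coeff g q) =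
        (if s = ?s then mps_coeff f (monom_pow v k) * mps_coeff g (m - monom_pow v k) else 0)"
      using z[of s] by auto
  qed simp
  also have "\<dots> = (if ?s \<in> splits m
      then mps_coeff f (monom_pow v k) * mps_coeff g (m - monom_pow v k) else 0)"
    by (subst sum.delta) auto
  also have "?s \<in> splits m \<longleftrightarrow> k \<le> Poly_Mapping.lookup m v"
    using monom_pow_add_diff[of k m v] le[of "m - monom_pow v k"] by (auto simp: splits_def)
  finally show ?thesis .
qed

lemma coeff_var_mult:
  "mps_coeff (mps_var v * f) m =
     (if 1 \<le> Poly_Mapping.lookup m v then mps_coeff f (m - monom_pow v 1) else 0)"
  by (subst coeff_mult_supported[where v = v and k = 1]) (auto simp: mps_var_def split: if_splits)

lemma coeff_var_power: "mps_coeff (mps_var v ^ k) m = (if m = monom_pow v k then 1 else 0)"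
proof (induction k arbitrary: m)
  case (Suc k)
  have "1 \<le> Poly_Mapping.lookup m v \<and> m - monom_pow v 1 = monom_pow v k \<longleftrightarrow> m = monom_pow v (Suc k)"
    (is "?L \<longleftrightarrow> ?R")
  proof
    assume ?L
    then show ?R using monom_pow_add_diff[of 1 m v] by (metis plus_1_eq_Suc single_add)
  next
    assume ?R
    then have "m = monom_pow v 1 + monom_pow v k" by (simp add: single_add[symmetric])
    then show ?L by (simp add: lookup_add)
  qed
  then show ?case by (auto simp: coeff_var_mult Suc)
qed (auto simp: coeff_one)

lemma coeff_var: "mps_coeff (mps_var v) m = (if m = monom_pow v 1 then 1 else 0)"
  using coeff_var_power[of v 1 m] by simp


section \<open>Power sums and complete symmetric functions\<close>

text \<open>Given by its coefficients, so that V may be infinite without any summability to check.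
  For k = 0 all powers collapse to the monomial 1, hence the assumptions k >= 1 below.\<close>

definition powsum :: "'v set \<Rightarrow> nat \<Rightarrow> ('v, 'c::comm_ring_1) mps" where
  "powsum V k = Abs_mps (\<lambda>m. if m \<in> (\<lambda>v. monom_pow v k) ` V then 1 else 0)"

definition mdeg :: "('v \<Rightarrow>\<^sub>0 nat) \<Rightarrow> nat" where
  "mdeg m = (\<Sum>v\<in>Poly_Mapping.keys m. Poly_Mapping.lookup m v)"

definition hcomp :: "'v set \<Rightarrow> nat \<Rightarrow> ('v, 'c::comm_ring_1) mps" where
  "hcomp V r = Abs_mps (\<lambda>m. if Poly_Mapping.keys m \<subseteq> V \<and> mdeg m = r then 1 else 0)"

lemma coeff_powsum: "mps_coeff (powsum V k) m = (if m \<in> (\<lambda>v. monom_pow v k) ` V then 1 else 0)"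
  by (simp add: powsum_def)

lemma coeff_hcomp: "mps_coeff (hcomp V r) m = (if Poly_Mapping.keys m \<subseteq> V \<and> mdeg m = r then 1 else 0)"
  by (simp add: hcomp_def)

lemma mdeg_superset:
  assumes "finite A" "Poly_Mapping.keys m \<subseteq> A"
  shows "mdeg m = (\<Sum>v\<in>A. Poly_Mapping.lookup m v)"
  unfolding mdeg_def using assms by (intro sum.mono_neutral_left) (auto simp: in_keys_iff)

lemma keys_add_nat: "Poly_Mapping.keys (p + q) = Poly_Mapping.keys p \<union> Poly_Mapping.keys (q :: 'v \<Rightarrow>\<^sub>0 nat)"
  by (auto simp: in_keys_iff lookup_add)

lemma mdeg_add: "mdeg (p + q) = mdeg p + mdeg q"
proof -
  let ?A = "Poly_Mapping.keys p \<union> Poly_Mapping.keys q"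
  have "mdeg (p + q) = (\<Sum>v\<in>?A. Poly_Mapping.lookup (p + q) v)"
    by (rule mdeg_superset) (auto simp: keys_add_nat)
  also have "\<dots> = mdeg p + mdeg q"
    by (subst (1 2) mdeg_superset[of ?A]) (auto simp: lookup_add sum.distrib)
  finally show ?thesis .
qed

lemma mdeg_single [simp]: "mdeg (monom_pow v k) = k"
  by (simp add: mdeg_def)

lemma mdeg_eq_0_iff [simp]: "mdeg m = 0 \<longleftrightarrow> m = 0"
  by (auto simp: mdeg_def in_keys_iff poly_mapping_eq_iff fun_eq_iff)

lemma hcomp_0 [simp]: "hcomp V 0 = 1"
  by (rule mps_eqI) (auto simp: coeff_hcomp coeff_one)

text \<open>Each variable of V with exponent at least k gives one splitting of m. Since k >= 1,
  distinct variables have distinct k-th powers, so these splittings differ.\<close>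

lemma coeff_powsum_mult:
  assumes "k \<ge> 1"
  shows "mps_coeff (powsum V k * f) m =
    (\<Sum>v | v \<in> V \<and> k \<le> Poly_Mapping.lookup m v. mps_coeff f (m - monom_pow v k))"
proof -
  let ?W = "{v \<in> V. k \<le> Poly_Mapping.lookup m v}"
  let ?s = "\<lambda>v. (monom_pow v k, m - monom_pow v k)"
  have inj: "inj_on ?s ?W"
    using assms by (auto intro!: inj_onI simp: single_eq_single_iff)
  have "mps_coeff (powsum V k * f) m = (\<Sum>(p, q)\<in>?s ` ?W. mps_coeff (powsum V k) p * mps_coeff f q)"
    unfolding coeff_mult
  proof (rule sum.mono_neutral_right)
    show "?s ` ?W \<subseteq> splits m" by (auto simp: splits_def monom_pow_add_diff)
    show "\<forall>s\<in>splits m - ?s ` ?W. (case s of (p, q) \<Rightarrow> mps_coeff (powsum V k) p * mps_coeff f q) = 0"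
    proof
      fix s assume s: "s \<in> splits m - ?s ` ?W"
      obtain p q where pq: "s = (p, q)" "p + q = m" using s by (auto simp: splits_def)
      have "p \<notin> (\<lambda>v. monom_pow v k) ` V"
      proof
        assume "p \<in> (\<lambda>v. monom_pow v k) ` V"
        then obtain v where v: "v \<in> V" "p = monom_pow v k" by auto
        then have "s = ?s v" "v \<in> ?W" using pq by (auto simp: lookup_add)
        then show False using s by blast
      qed
      then show "(case s of (p, q) \<Rightarrow> mps_coeff (powsum V k) p * mps_coeff f q) = 0"
        using pq by (simp add: coeff_powsum)
    qed
  qed simp
  also have "\<dots> = (\<Sum>v\<in>?W. mps_coeff f (m - monom_pow v k))"
    by (subst sum.reindex[OF inj]) (auto intro!: sum.cong simp: coeff_powsum)
  finally show ?thesis by simp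
qed

section \<open>Newton's identities\<close>

definition newton :: "(nat \<Rightarrow> 'a::comm_ring_1) \<Rightarrow> (nat \<Rightarrow> 'a) \<Rightarrow> bool" where
  "newton p h \<longleftrightarrow> h 0 = 1 \<and> (\<forall>r\<ge>1. of_nat r * h r = (\<Sum>k=1..r. p k * h (r - k)))"

text \<open>A monomial of degree r over V occurs in p_k h_(r-k) once for every variable with
  exponent at least k. Summing over k counts each variable as often as its exponent, which gives the
  degree r in total.\<close>

lemma newton_hcomp: "newton (powsum V) (hcomp V :: nat \<Rightarrow> ('v, 'c::comm_ring_1) mps)"
  unfolding newton_def
proof (intro conjI allI impI)
  fix r :: nat assume r: "r \<ge> 1"
  show "of_nat r * hcomp V r = (\<Sum>k=1..r. powsum V k * hcomp V (r - k) :: ('v, 'c) mps)"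
  proof (rule mps_eqI)
    fix m :: "'v \<Rightarrow>\<^sub>0 nat"
    let ?l = "Poly_Mapping.lookup m"
    let ?ok = "Poly_Mapping.keys m \<subseteq> V \<and> mdeg m = r"
    have c: "mps_coeff (powsum V k * hcomp V (r - k)) m =
        (of_nat (if ?ok then card {v \<in> Poly_Mapping.keys m. k \<le> ?l v} else 0) :: 'c)"
      if k: "k \<in> {1..r}" for k
    proof -
      have "mps_coeff (powsum V k * hcomp V (r - k)) m =
          (\<Sum>v | v \<in> V \<and> k \<le> ?l v. if ?ok then 1 else (0::'c))"
        unfolding coeff_powsum_mult[OF order.trans[OF _ conjunct1[OF k[unfolded atLeastAtMost_iff]]], OF order_refl]
      proof (rule sum.cong)
        fix v assume v: "v \<in> {v. v \<in> V \<and> k \<le> ?l v}"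
        then have e: "monom_pow v k + (m - monom_pow v k) = m"
          by (intro monom_pow_add_diff) auto
        have "Poly_Mapping.keys m = Poly_Mapping.keys (monom_pow v k) \<union> Poly_Mapping.keys (m - monom_pow v k)"
          by (subst e[symmetric]) (rule keys_add_nat)
        then have 1: "Poly_Mapping.keys (m - monom_pow v k) \<subseteq> V \<longleftrightarrow> Poly_Mapping.keys m \<subseteq> V"
          using v k by auto
        have "mdeg m = k + mdeg (m - monom_pow v k)"
          by (subst e[symmetric]) (simp only: mdeg_add mdeg_single)
        then have "mdeg (m - monom_pow v k) = r - k \<longleftrightarrow> mdeg m = r" using k by auto
        then show "mps_coeff (hcomp V (r - k)) (m - monom_pow v k) = (if ?ok then 1 else (0::'c))"
          by (simp add: coeff_hcomp 1)
      qed simp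
      also have "\<dots> = of_nat (if ?ok then card {v. v \<in> V \<and> k \<le> ?l v} else 0)" by simp
      also have "\<dots> = of_nat (if ?ok then card {v \<in> Poly_Mapping.keys m. k \<le> ?l v} else 0)"
      proof -
        have "{v. v \<in> V \<and> k \<le> ?l v} = {v \<in> Poly_Mapping.keys m. k \<le> ?l v}" if ?ok
          using that k by (auto simp: in_keys_iff)
        then show ?thesis by (cases ?ok) auto
      qed
      finally show ?thesis .
    qed
    have d: "(\<Sum>k=1..r. card {v \<in> Poly_Mapping.keys m. k \<le> ?l v}) = r" if "mdeg m = r"
    proof -
      have le: "?l v \<le> r" if "v \<in> Poly_Mapping.keys m" for v
        using that \<open>mdeg m = r\<close> unfolding mdeg_def by (metis finite_keys member_le_sum zero_le)
      have "(\<Sum>k=1..r. card {v \<in> Poly_Mapping.keys m. k \<le> ?l v}) =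
          (\<Sum>k=1..r. \<Sum>v\<in>Poly_Mapping.keys m. if k \<le> ?l v then 1 else 0)"
        by (intro sum.cong refl) (simp add: sum.If_cases Int_def)
      also have "\<dots> = (\<Sum>v\<in>Poly_Mapping.keys m. \<Sum>k=1..r. if k \<le> ?l v then 1 else 0)"
        by (rule sum.swap)
      also have "\<dots> = (\<Sum>v\<in>Poly_Mapping.keys m. ?l v)"
      proof (rule sum.cong)
        fix v assume v: "v \<in> Poly_Mapping.keys m"
        have "{1..r} \<inter> {k. k \<le> ?l v} = {1..?l v}" using le[OF v] by auto
        then show "(\<Sum>k=1..r. if k \<le> ?l v then 1 else 0) = ?l v"
          by (simp add: sum.If_cases)
      qed simp
      finally show ?thesis using that by (simp add: mdeg_def)
    qed
    have "mps_coeff (\<Sum>k=1..r. powsum V k * hcomp V (r - k)) m =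
        (of_nat (\<Sum>k=1..r. if ?ok then card {v \<in> Poly_Mapping.keys m. k \<le> ?l v} else 0) :: 'c)"
      unfolding coeff_sum of_nat_sum using c by (intro sum.cong) auto
    also have "\<dots> = of_nat (if ?ok then r else 0)"
    proof -
      have "(\<Sum>k=1..r. if ?ok then card {v \<in> Poly_Mapping.keys m. k \<le> ?l v} else 0) = (if ?ok then r else 0)"
      proof (cases ?ok)
        case True
        then show ?thesis using d by simp
      next
        case False
        then show ?thesis by (simp only: if_False sum.neutral_const)
      qed
      then show ?thesis by (simp only:)
    qed
    finally show "mps_coeff (of_nat r * hcomp V r) m =
        (mps_coeff (\<Sum>k=1..r. powsum V k * hcomp V (r - k)) m :: 'c)"
      by (simp add: coeff_hcomp)
  qed
qed simp

lemma mps_of_nat_cancel: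
  fixes f g :: "('v, rat) mps"
  assumes "of_nat r * f = of_nat r * g" "r \<ge> 1"
  shows "f = g"
proof (rule mps_eqI)
  fix m
  have "mps_coeff (of_nat r * f) m = mps_coeff (of_nat r * g) m" using assms by simp
  then show "mps_coeff f m = mps_coeff g m" using assms(2) by simp
qed

text \<open>The identities determine r h_r from the earlier terms, and r can be cancelled over the
  rationals. All later comparisons of complete functions go through this lemma: it suffices to
  compare power sums.\<close>

lemma newton_unique:
  fixes h h' :: "nat \<Rightarrow> ('v, rat) mps"
  assumes "newton p h" "newton p' h'" "\<And>k. k \<ge> 1 \<Longrightarrow> p k = p' k"
  shows "h r = h' r"
proof (induction r rule: less_induct)
  case (less r)
  show ?case
  proof (cases "r = 0")
    case True
    then show ?thesis using assms by (simp add: newton_def)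
  next
    case False
    have "of_nat r * h r = (\<Sum>k=1..r. p k * h (r - k))" using assms(1) False by (simp add: newton_def)
    also have "\<dots> = (\<Sum>k=1..r. p' k * h' (r - k))"
      using less False assms(3) by (intro sum.cong) auto
    also have "\<dots> = of_nat r * h' r" using assms(2) False by (simp add: newton_def)
    finally show ?thesis using False mps_of_nat_cancel[of r "h r" "h' r"] by simp
  qed
qed

text \<open>Compatibility is demanded only on the expressions that occur in the identities, so
  \<phi> need not be packaged as a ring homomorphism.\<close>

lemma newton_map:
  assumes "newton p h"
    and "\<phi> 1 = 1" "\<And>r. \<phi> (of_nat r * h r) = of_nat r * \<phi> (h r)"
    and "\<And>r. \<phi> (\<Sum>k=1..r. p k * h (r - k)) = (\<Sum>k=1..r. p' k * \<phi> (h (r - k)))"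
  shows "newton p' (\<lambda>r. \<phi> (h r))"
  unfolding newton_def
proof (intro conjI allI impI)
  fix r :: nat assume "r \<ge> 1"
  then have "of_nat r * h r = (\<Sum>k=1..r. p k * h (r - k))" using assms(1) by (simp add: newton_def)
  then have "\<phi> (of_nat r * h r) = \<phi> (\<Sum>k=1..r. p k * h (r - k))" by (rule arg_cong)
  then show "of_nat r * \<phi> (h r) = (\<Sum>k=1..r. p' k * \<phi> (h (r - k)))"
    by (simp only: assms(3,4))
qed (use assms(1,2) in \<open>auto simp: newton_def\<close>)

text \<open>In terms of generating functions, Newton's identities say that P is the logarithmic
  derivative u H'/H. In this form products and quotients of generating functions become sums and
  differences of power sums.\<close>

lemma newton_fps_iff:
  fixes H :: "'a::comm_ring_1 fps"
  shows "newton p (fps_nth H) \<longleftrightarrow> fps_nth H 0 = 1 \<and>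
    fps_X * fps_deriv H = Abs_fps (\<lambda>k. if k = 0 then 0 else p k) * H"
proof -
  let ?P = "Abs_fps (\<lambda>k. if k = 0 then 0 else p k)"
  have l: "fps_nth (fps_X * fps_deriv H) r = of_nat r * fps_nth H r" for r
    by (cases r) auto
  have r: "fps_nth (?P * H) r = (\<Sum>k=1..r. p k * fps_nth H (r - k))" for r
  proof -
    have "fps_nth (?P * H) r = (\<Sum>k=0..r. fps_nth ?P k * fps_nth H (r - k))" by (simp add: fps_mult_nth)
    also have "\<dots> = (\<Sum>k=1..r. p k * fps_nth H (r - k))"
      by (subst sum.atLeast_Suc_atMost) (auto intro!: sum.cong)
    finally show ?thesis .
  qed
  have "fps_X * fps_deriv H = ?P * H \<longleftrightarrow> (\<forall>r. of_nat r * fps_nth H r = (\<Sum>k=1..r. p k * fps_nth H (r - k)))"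
    unfolding fps_eq_iff l r ..
  also have "\<dots> \<longleftrightarrow> (\<forall>r\<ge>1. of_nat r * fps_nth H r = (\<Sum>k=1..r. p k * fps_nth H (r - k)))"
  proof (intro iffI allI impI)
    fix r
    assume "\<forall>r\<ge>1. of_nat r * fps_nth H r = (\<Sum>k=1..r. p k * fps_nth H (r - k))"
    then show "of_nat r * fps_nth H r = (\<Sum>k=1..r. p k * fps_nth H (r - k))"
      by (cases "r = 0") auto
  qed simp
  finally show ?thesis by (auto simp: newton_def)
qed

section \<open>Generating functions over a set of variables\<close>

definition hgen :: "'v set \<Rightarrow> ('v, 'c::comm_ring_1) mps fps" where
  "hgen V = Abs_fps (hcomp V)"

text \<open>This is the product of 1 - v u over v in V, obtained as an inverse because V may be
  infinite. The argument 1 is the inverse of the constant term of \<open>hgen V\<close>.\<close>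

definition egen :: "'v set \<Rightarrow> ('v, 'c::comm_ring_1) mps fps" where
  "egen V = fps_right_inverse (hgen V) 1"

lemma hgen_nth [simp]: "fps_nth (hgen V) r = hcomp V r"
  by (simp add: hgen_def)

lemma hgen_egen: "hgen V * egen V = 1"
  unfolding egen_def by (rule fps_right_inverse) simp

lemma egen_unique:
  assumes "hgen V * B = 1"
  shows "egen V = B"
proof -
  have "egen V = (hgen V * B) * egen V" by (simp add: assms)
  also have "\<dots> = (hgen V * egen V) * B" by (simp only: ac_simps)
  finally show ?thesis by (simp add: hgen_egen)
qed

lemma egen_0 [simp]: "fps_nth (egen V) 0 = 1"
proof -
  have "fps_nth (hgen V * egen V) 0 = 1" by (simp add: hgen_egen)
  then show ?thesis by simp
qed

text \<open>The monomials of degree r + 1 that contain v are v times the monomials of degree r;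
  deleting them leaves the monomials over V.\<close>

lemma hcomp_insert:
  assumes "v \<notin> V"
  shows "hcomp (insert v V) (Suc r) - mps_var v * hcomp (insert v V) r = hcomp V (Suc r)"
proof (rule mps_eqI)
  fix m :: "'a \<Rightarrow>\<^sub>0 nat"
  show "mps_coeff (hcomp (insert v V) (Suc r) - mps_var v * hcomp (insert v V) r) m
      = mps_coeff (hcomp V (Suc r)) m"
  proof (cases "v \<in> Poly_Mapping.keys m")
    case True
    then have l: "1 \<le> Poly_Mapping.lookup m v" by (simp add: in_keys_iff)
    then have e: "monom_pow v 1 + (m - monom_pow v 1) = m" by (rule monom_pow_add_diff)
    have "Poly_Mapping.keys m = Poly_Mapping.keys (monom_pow v 1) \<union> Poly_Mapping.keys (m - monom_pow v 1)"
      by (subst e[symmetric]) (rule keys_add_nat)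
    then have "Poly_Mapping.keys m = insert v (Poly_Mapping.keys (m - monom_pow v 1))" by simp
    moreover have "mdeg m = 1 + mdeg (m - monom_pow v 1)"
      by (subst e[symmetric]) (simp only: mdeg_add mdeg_single)
    ultimately show ?thesis using l assms by (auto simp: coeff_var_mult coeff_hcomp)
  next
    case False
    then have "Poly_Mapping.lookup m v = 0" by (simp add: in_keys_iff)
    then show ?thesis using False assms by (auto simp: coeff_var_mult coeff_hcomp)
  qed
qed

lemma hgen_insert:
  assumes "v \<notin> V"
  shows "(1 - fps_const (mps_var v) * fps_X) * hgen (insert v V) = hgen V"
proof (rule fps_ext)
  fix r
  show "fps_nth ((1 - fps_const (mps_var v) * fps_X) * hgen (insert v V)) r = fps_nth (hgen V) r"
    using hcomp_insert[OF assms] by (cases r) (auto simp: left_diff_distrib mult.assoc)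
qed

lemma egen_insert:
  assumes "v \<notin> V"
  shows "egen (insert v V) = (1 - fps_const (mps_var v) * fps_X) * egen V"
proof (rule egen_unique)
  have "hgen (insert v V) * ((1 - fps_const (mps_var v) * fps_X) * egen V) =
      ((1 - fps_const (mps_var v) * fps_X) * hgen (insert v V)) * egen V"
    by (simp only: ac_simps)
  then show "hgen (insert v V) * ((1 - fps_const (mps_var v) * fps_X) * egen V) = 1"
    by (simp only: hgen_insert[OF assms] hgen_egen)
qed

lemma hgen_deriv:
  fixes V :: "'v set"
  shows "fps_X * fps_deriv (hgen V :: ('v, 'c::comm_ring_1) mps fps) =
    Abs_fps (\<lambda>k. if k = 0 then 0 else powsum V k) * hgen V"
proof -
  have "fps_nth (hgen V :: ('v, 'c) mps fps) = hcomp V" by (rule ext) simp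
  then have "newton (powsum V) (fps_nth (hgen V :: ('v, 'c) mps fps))" by (simp add: newton_hcomp)
  then show ?thesis unfolding newton_fps_iff by simp
qed

text \<open>The quotient of the two generating functions has the difference of the logarithmic
  derivatives. With x-variables in V and a-variables in W this gives the complete functions
  belonging to p_k(x) - p_k(a).\<close>

lemma newton_hgen_egen:
  fixes V W :: "'v set"
  shows "newton (\<lambda>k. powsum V k - powsum W k)
    (fps_nth (hgen V * egen W :: ('v, 'c::comm_ring_1) mps fps))"
proof -
  let ?P = "\<lambda>V. Abs_fps (\<lambda>k. if k = 0 then 0 else powsum V k) :: ('v, 'c) mps fps"
  \<comment> \<open>Differentiating the relation that defines \<open>egen W\<close> and multiplying
    by \<open>egen W\<close> isolates the derivative of \<open>egen W\<close>: its logarithmic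
    derivative is the negative of that of \<open>hgen W\<close>.\<close>
  have "fps_deriv (hgen W * egen W :: ('v, 'c) mps fps) = 0" by (simp add: hgen_egen)
  then have "fps_deriv (hgen W :: ('v, 'c) mps fps) * egen W + hgen W * fps_deriv (egen W) = 0" by (simp add: algebra_simps)
  then have "(egen W :: ('v, 'c) mps fps) * fps_X * (fps_deriv (hgen W) * egen W + hgen W * fps_deriv (egen W)) = 0" by simp
  then have "(hgen W * egen W :: ('v, 'c) mps fps) * (fps_X * fps_deriv (egen W)) =
      - ((fps_X * fps_deriv (hgen W)) * egen W * egen W)"
    by (simp add: algebra_simps eq_neg_iff_add_eq_0)
  then have "fps_X * fps_deriv (egen W :: ('v, 'c) mps fps) = - (?P W * (hgen W * egen W) * egen W)"
    unfolding hgen_deriv by (simp add: hgen_egen mult.assoc)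
  then have e: "fps_X * fps_deriv (egen W :: ('v, 'c) mps fps) = - (?P W * egen W)" by (simp add: hgen_egen)
  have "fps_X * fps_deriv (hgen V * egen W :: ('v, 'c) mps fps) =
      (fps_X * fps_deriv (hgen V)) * egen W + hgen V * (fps_X * fps_deriv (egen W))"
    by (simp add: algebra_simps)
  also have "\<dots> = (?P V - ?P W) * (hgen V * egen W)"
    unfolding hgen_deriv e by (simp add: algebra_simps)
  also have "?P V - ?P W = Abs_fps (\<lambda>k. if k = 0 then 0 else powsum V k - powsum W k)"
    by (rule fps_ext) simp
  finally show ?thesis
    unfolding newton_fps_iff by simp
qed

section \<open>Substitutions\<close>

definition push :: "('v \<Rightarrow> 'w) \<Rightarrow> ('v \<Rightarrow>\<^sub>0 nat) \<Rightarrow> ('w \<Rightarrow>\<^sub>0 nat)" where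
  "push \<sigma> m = (\<Sum>v\<in>Poly_Mapping.keys m. monom_pow (\<sigma> v) (Poly_Mapping.lookup m v))"

text \<open>Under this condition only finitely many monomials are pushed to a given one. Otherwise
  the sum in \<open>ren\<close> could range over an infinite set and take the default value
  0.\<close>

definition finite_fibres :: "('v \<Rightarrow> 'w) \<Rightarrow> bool" where
  "finite_fibres \<sigma> \<longleftrightarrow> (\<forall>w. finite {v. \<sigma> v = w})"

definition ren :: "('v \<Rightarrow> 'w) \<Rightarrow> ('v, 'c::comm_ring_1) mps \<Rightarrow> ('w, 'c) mps" where
  "ren \<sigma> f = Abs_mps (\<lambda>m. \<Sum>m' | push \<sigma> m' = m. mps_coeff f m')"

lemma push_superset:
  assumes "finite A" "Poly_Mapping.keys m \<subseteq> A"
  shows "push \<sigma> m = (\<Sum>v\<in>A. monom_pow (\<sigma> v) (Poly_Mapping.lookup m v))"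
  unfolding push_def using assms by (intro sum.mono_neutral_left) (auto simp: in_keys_iff)

lemma push_add: "push \<sigma> (p + q) = push \<sigma> p + push \<sigma> q"
proof -
  let ?A = "Poly_Mapping.keys p \<union> Poly_Mapping.keys q"
  have "push \<sigma> (p + q) = (\<Sum>v\<in>?A. monom_pow (\<sigma> v) (Poly_Mapping.lookup (p + q) v))"
    by (rule push_superset) (auto simp: keys_add_nat)
  also have "\<dots> = push \<sigma> p + push \<sigma> q"
    by (subst (1 2) push_superset[of ?A]) (auto simp: lookup_add single_add sum.distrib)
  finally show ?thesis .
qed

lemma push_single [simp]: "push \<sigma> (monom_pow v k) = monom_pow (\<sigma> v) k"
  by (cases "k = 0") (auto simp: push_def)

lemma lookup_le_push: "Poly_Mapping.lookup m v \<le> Poly_Mapping.lookup (push \<sigma> m) (\<sigma> v)"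
proof (cases "v \<in> Poly_Mapping.keys m")
  case True
  have "Poly_Mapping.lookup m v = Poly_Mapping.lookup (monom_pow (\<sigma> v) (Poly_Mapping.lookup m v)) (\<sigma> v)"
    by simp
  also have "\<dots> \<le> (\<Sum>u\<in>Poly_Mapping.keys m. Poly_Mapping.lookup (monom_pow (\<sigma> u) (Poly_Mapping.lookup m u)) (\<sigma> v))"
    using True by (intro member_le_sum) auto
  finally show ?thesis by (simp add: push_def lookup_sum)
qed (simp add: in_keys_iff)

text \<open>All these monomials divide the product \<open>?T\<close> of the v^(B v) over v in V, and
  a monomial has finitely many divisors by \<open>finite_splits\<close>.\<close>

lemma finite_bounded_monomials:
  assumes "finite V"
  shows "finite {m :: 'v \<Rightarrow>\<^sub>0 nat. Poly_Mapping.keys m \<subseteq> V \<and> (\<forall>v. Poly_Mapping.lookup m v \<le> B v)}"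
proof -
  let ?T = "\<Sum>v\<in>V. monom_pow v (B v)"
  have T: "Poly_Mapping.lookup ?T v = (if v \<in> V then B v else 0)" for v
    using assms by (simp add: lookup_sum lookup_single when_def sum.delta)
  have "{m :: 'v \<Rightarrow>\<^sub>0 nat. Poly_Mapping.keys m \<subseteq> V \<and> (\<forall>v. Poly_Mapping.lookup m v \<le> B v)} \<subseteq> fst ` splits ?T"
  proof
    fix m :: "'v \<Rightarrow>\<^sub>0 nat"
    assume m: "m \<in> {m. Poly_Mapping.keys m \<subseteq> V \<and> (\<forall>v. Poly_Mapping.lookup m v \<le> B v)}"
    have "Poly_Mapping.lookup m v \<le> Poly_Mapping.lookup ?T v" for v
      using m T[of v] by (cases "v \<in> V") (auto simp: in_keys_iff)
    then have "m + (?T - m) = ?T"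
      by (intro poly_mapping_eqI) (simp add: lookup_add lookup_minus)
    then have "(m, ?T - m) \<in> splits ?T" by (simp add: splits_def)
    then show "m \<in> fst ` splits ?T" by (metis fst_conv image_eqI)
  qed
  then show ?thesis by (rule finite_subset) (intro finite_imageI finite_splits)
qed

lemma finite_push_fibre:
  assumes "finite_fibres \<sigma>"
  shows "finite {m'. push \<sigma> m' = m}"
proof -
  let ?V = "\<Union>w\<in>Poly_Mapping.keys m. {v. \<sigma> v = w}"
  have "{m'. push \<sigma> m' = m} \<subseteq>
      {m'. Poly_Mapping.keys m' \<subseteq> ?V \<and> (\<forall>v. Poly_Mapping.lookup m' v \<le> Poly_Mapping.lookup m (\<sigma> v))}"
    by (auto simp: in_keys_iff intro: lookup_le_push less_le_trans[OF _ lookup_le_push])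
  then show ?thesis
    by (rule finite_subset) (intro finite_bounded_monomials finite_UN_I,
        use assms in \<open>auto simp: finite_fibres_def\<close>)
qed

lemma coeff_ren: "mps_coeff (ren \<sigma> f) m = (\<Sum>m' | push \<sigma> m' = m. mps_coeff f m')"
  by (simp add: ren_def)

lemma push_eq_0_iff: "push \<sigma> m = 0 \<longleftrightarrow> m = 0"
proof
  assume "push \<sigma> m = 0"
  then have "Poly_Mapping.lookup m v = 0" for v using lookup_le_push[of m v \<sigma>] by simp
  then show "m = 0" by (intro poly_mapping_eqI) simp
qed (simp add: push_def)

lemma ren_const [simp]: "ren \<sigma> (mps_const c) = mps_const c"
proof (rule mps_eqI)
  fix m
  show "mps_coeff (ren \<sigma> (mps_const c)) m = mps_coeff (mps_const c) m"
  proof (cases "m = 0")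
    case True
    then show ?thesis by (simp add: coeff_ren push_eq_0_iff coeff_const)
  next
    case False
    then have "\<forall>m'\<in>{m'. push \<sigma> m' = m}. mps_coeff (mps_const c) m' = 0"
      by (auto simp: coeff_const push_eq_0_iff)
    then show ?thesis using False by (simp add: coeff_ren coeff_const)
  qed
qed

lemma ren_add: "ren \<sigma> (f + g) = ren \<sigma> f + ren \<sigma> g"
  by (rule mps_eqI) (simp add: coeff_ren sum.distrib)

lemma ren_diff: "ren \<sigma> (f - g) = ren \<sigma> f - ren \<sigma> g"
  by (rule mps_eqI) (simp add: coeff_ren sum_subtractf)

text \<open>To choose a preimage of m and a splitting of it is the same as to choose a splitting of
  m and a preimage of each factor.\<close>

lemma ren_mult:
  assumes "finite_fibres \<sigma>"
  shows "ren \<sigma> (f * g) = ren \<sigma> f * ren \<sigma> g"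
proof (rule mps_eqI)
  fix m
  note fin = finite_push_fibre[OF assms]
  have "mps_coeff (ren \<sigma> (f * g)) m =
      (\<Sum>(m', s)\<in>Sigma {m'. push \<sigma> m' = m} splits. mps_coeff f (fst s) * mps_coeff g (snd s))"
    using fin by (simp add: coeff_ren coeff_mult split_beta sum.Sigma)
  also have "\<dots> = (\<Sum>(s, t)\<in>Sigma (splits m) (\<lambda>s. {p. push \<sigma> p = fst s} \<times> {q. push \<sigma> q = snd s}).
      mps_coeff f (fst t) * mps_coeff g (snd t))"
    by (rule sum.reindex_bij_witness[where
          i = "\<lambda>(s, t). (fst t + snd t, t)" and
          j = "\<lambda>(m', s). ((push \<sigma> (fst s), push \<sigma> (snd s)), s)"])
       (auto simp: splits_def push_add)
  also have "\<dots> = (\<Sum>s\<in>splits m. \<Sum>t\<in>{p. push \<sigma> p = fst s} \<times> {q. push \<sigma> q = snd s}.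
      mps_coeff f (fst t) * mps_coeff g (snd t))"
    using fin by (subst sum.Sigma) auto
  also have "\<dots> = (\<Sum>s\<in>splits m. mps_coeff (ren \<sigma> f) (fst s) * mps_coeff (ren \<sigma> g) (snd s))"
    by (intro sum.cong refl) (simp add: coeff_ren sum_product sum.cartesian_product split_beta)
  finally show "mps_coeff (ren \<sigma> (f * g)) m = mps_coeff (ren \<sigma> f * ren \<sigma> g) m"
    by (simp add: coeff_mult split_beta)
qed

lemma push_id [simp]: "push (\<lambda>v. v) m = m"
proof (rule poly_mapping_eqI)
  fix v
  show "Poly_Mapping.lookup (push (\<lambda>v. v) m) v = Poly_Mapping.lookup m v"
    by (cases "v \<in> Poly_Mapping.keys m")
       (auto simp: push_def lookup_sum lookup_single when_def sum.delta' in_keys_iff)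
qed

lemma push_sum: "push \<sigma> (sum f A) = (\<Sum>a\<in>A. push \<sigma> (f a))"
  by (induction A rule: infinite_finite_induct) (auto simp: push_add push_def[of _ 0])

lemma push_push: "push \<tau> (push \<sigma> m) = push (\<lambda>v. \<tau> (\<sigma> v)) m"
proof -
  have "push \<tau> (push \<sigma> m) = (\<Sum>v\<in>Poly_Mapping.keys m. push \<tau> (monom_pow (\<sigma> v) (Poly_Mapping.lookup m v)))"
    unfolding push_def[of \<sigma>] by (rule push_sum)
  then show ?thesis by (simp add: push_def[of "\<lambda>v. \<tau> (\<sigma> v)"])
qed

lemma ren_inverse:
  assumes "\<And>v. \<tau> (\<sigma> v) = v" "\<And>w. \<sigma> (\<tau> w) = w"
  shows "mps_coeff (ren \<sigma> f) m = mps_coeff f (push \<tau> m)"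
proof -
  have "{m'. push \<sigma> m' = m} = {push \<tau> m}"
    using assms by (auto simp: push_push)
  then show ?thesis by (simp add: coeff_ren)
qed

text \<open>For a renaming that is not injective the coefficient is the size of a fibre inside V.
  This is how a natural number N can appear as a multiplicity.\<close>

lemma ren_powsum:
  assumes "finite_fibres \<sigma>" "k \<ge> 1"
  shows "mps_coeff (ren \<sigma> (powsum V k)) m = of_nat (card {v \<in> V. monom_pow (\<sigma> v) k = m})"
proof -
  have inj: "inj_on (\<lambda>v. monom_pow v k) {v \<in> V. monom_pow (\<sigma> v) k = m}"
    using assms(2) by (intro inj_onI) (simp add: single_eq_single_iff)
  have "mps_coeff (ren \<sigma> (powsum V k)) m =
      (\<Sum>m' | push \<sigma> m' = m. if m' \<in> (\<lambda>v. monom_pow v k) ` V then 1 else 0)"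
    by (simp add: coeff_ren coeff_powsum)
  also have "\<dots> = of_nat (card ({m'. push \<sigma> m' = m} \<inter> (\<lambda>v. monom_pow v k) ` V))"
    using finite_push_fibre[OF assms(1)] by (simp add: sum.If_cases Int_def)
  also have "{m'. push \<sigma> m' = m} \<inter> (\<lambda>v. monom_pow v k) ` V =
      (\<lambda>v. monom_pow v k) ` {v \<in> V. monom_pow (\<sigma> v) k = m}"
    by auto
  finally show ?thesis by (simp add: card_image[OF inj])
qed

lemma ren_powsum_bij:
  assumes "\<And>v. \<tau> (\<sigma> v) = v" "\<And>w. \<sigma> (\<tau> w) = w" "k \<ge> 1"
  shows "ren \<sigma> (powsum V k) = powsum (\<sigma> ` V) k"
proof (rule mps_eqI)
  fix m
  have "push \<tau> m \<in> (\<lambda>v. monom_pow v k) ` V \<longleftrightarrow> m \<in> (\<lambda>v. monom_pow v k) ` \<sigma> ` V"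
  proof
    assume "push \<tau> m \<in> (\<lambda>v. monom_pow v k) ` V"
    then obtain v where v: "v \<in> V" "push \<tau> m = monom_pow v k" by auto
    then have "push \<sigma> (push \<tau> m) = monom_pow (\<sigma> v) k" by simp
    then have "m = monom_pow (\<sigma> v) k" by (simp add: push_push assms)
    then show "m \<in> (\<lambda>v. monom_pow v k) ` \<sigma> ` V" using v(1) by blast
  next
    assume "m \<in> (\<lambda>v. monom_pow v k) ` \<sigma> ` V"
    then show "push \<tau> m \<in> (\<lambda>v. monom_pow v k) ` V" using assms by auto
  qed
  then show "mps_coeff (ren \<sigma> (powsum V k)) m = mps_coeff (powsum (\<sigma> ` V) k) m"
    by (simp add: ren_inverse[OF assms(1,2)] coeff_powsum)
qed

lemma powsum_singleton: "k \<ge> 1 \<Longrightarrow> powsum {v} k = mps_var v ^ k"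
  by (rule mps_eqI) (simp add: coeff_powsum coeff_var_power)

lemma powsum_Un:
  assumes "k \<ge> 1" "V \<inter> W = {}"
  shows "powsum (V \<union> W) k = powsum V k + powsum W k"
proof (rule mps_eqI)
  fix m
  have "\<not> (m \<in> (\<lambda>v. monom_pow v k) ` V \<and> m \<in> (\<lambda>v. monom_pow v k) ` W)"
    using assms by (auto simp: single_eq_single_iff[of k])
  then show "mps_coeff (powsum (V \<union> W) k) m = mps_coeff (powsum V k + powsum W k) m"
    by (auto simp: coeff_powsum image_Un)
qed

lemma ren_var_bij:
  assumes "\<And>v. \<tau> (\<sigma> v) = v" "\<And>w. \<sigma> (\<tau> w) = w"
  shows "ren \<sigma> (mps_var v) = mps_var (\<sigma> v)"
  using ren_powsum_bij[OF assms, of 1 "{v}"] by (simp add: powsum_singleton)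

text \<open>The homomorphism that sets the variables in K to 0. Coefficients of monomials without
  variables from K are unchanged, so an identity modulo K decides the coefficients of those
  monomials.\<close>

definition kill :: "'v set \<Rightarrow> ('v, 'c::comm_ring_1) mps \<Rightarrow> ('v, 'c) mps" where
  "kill K f = Abs_mps (\<lambda>m. if Poly_Mapping.keys m \<inter> K = {} then mps_coeff f m else 0)"

lemma coeff_kill:
  "mps_coeff (kill K f) m = (if Poly_Mapping.keys m \<inter> K = {} then mps_coeff f m else 0)"
  by (simp add: kill_def)

lemma kill_mult: "kill K (f * g) = kill K f * kill K g"
proof (rule mps_eqI)
  fix m
  show "mps_coeff (kill K (f * g)) m = mps_coeff (kill K f * kill K g) m"
  proof (cases "Poly_Mapping.keys m \<inter> K = {}")
    case True
    then have "Poly_Mapping.keys p \<inter> K = {} \<and> Poly_Mapping.keys q \<inter> K = {}" if "(p, q) \<in> splits m" for p q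
      using that by (auto simp: splits_def keys_add_nat)
    then show ?thesis using True by (auto simp: coeff_kill coeff_mult intro!: sum.cong)
  next
    case False
    then have "Poly_Mapping.keys p \<inter> K \<noteq> {} \<or> Poly_Mapping.keys q \<inter> K \<noteq> {}" if "(p, q) \<in> splits m" for p q
      using that by (auto simp: splits_def keys_add_nat)
    then have "\<forall>s\<in>splits m. mps_coeff (kill K f) (fst s) * mps_coeff (kill K g) (snd s) = 0"
      by (auto simp: coeff_kill)
    then show ?thesis using False by (simp add: coeff_kill coeff_mult split_beta)
  qed
qed

lemma comm_ring_hom_kill: "comm_ring_hom (kill K)"
  by unfold_locales (auto intro!: mps_eqI simp: coeff_kill kill_mult coeff_one)

interpretation kill: comm_ring_hom "kill K" for K
  by (rule comm_ring_hom_kill)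

section \<open>The maps defining double symmetric functions\<close>

abbreviation xset :: "int \<Rightarrow> var set" where "xset n \<equiv> XVar ` {..n}"
abbreviation aset :: "int \<Rightarrow> var set" where "aset n \<equiv> AVar ` {..n}"

lemma coeff_suminf: "mps_coeff (mps_suminf f S) m = (\<Sum>P | P \<in> S \<and> mps_coeff (f P) m \<noteq> 0. mps_coeff (f P) m)"
  by (simp add: mps_suminf_def)

lemma suminf_var_power:
  fixes f :: "'i \<Rightarrow> 'v"
  assumes "k \<ge> 1" "inj_on f S"
  shows "mps_suminf (\<lambda>i. mps_var (f i) ^ k) S = (powsum (f ` S) k :: ('v, 'c::comm_ring_1) mps)"
proof (rule mps_eqI)
  fix m
  let ?T = "{i \<in> S. mps_coeff (mps_var (f i) ^ k :: ('v, 'c) mps) m \<noteq> 0}"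
  have T: "?T = {i \<in> S. m = monom_pow (f i) k}" by (auto simp: coeff_var_power)
  show "mps_coeff (mps_suminf (\<lambda>i. mps_var (f i) ^ k) S) m = mps_coeff (powsum (f ` S) k :: ('v, 'c) mps) m"
  proof (cases "m \<in> (\<lambda>v. monom_pow v k) ` f ` S")
    case True
    then obtain i where i: "i \<in> S" "m = monom_pow (f i) k" by auto
    have "?T = {i}"
      unfolding T using i assms by (auto simp: single_eq_single_iff[of k] inj_on_eq_iff)
    then show ?thesis using True i by (simp add: coeff_suminf coeff_powsum coeff_var_power)
  next
    case False
    then have "?T = {}" unfolding T by auto
    then show ?thesis using False by (simp only: coeff_suminf coeff_powsum sum.empty if_False)
  qed
qed

lemma psum_eq: "k \<ge> 1 \<Longrightarrow> psum k = powsum (xset 0) k"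
  unfolding psum_def by (rule suminf_var_power) (auto simp: inj_on_def)

lemma psum_double_eq:
  assumes "k \<ge> 1"
  shows "psum_double k = powsum (xset 0) k - powsum (aset 0) k"
proof (rule mps_eqI)
  fix m
  let ?f = "\<lambda>i. xvar i ^ k - avar i ^ k"
  \<comment> \<open>At a fixed monomial both families have finite support. Over the union of the two
    supports the sum of differences may be split, which cannot be done over all i <= 0.\<close>
  let ?X = "{i \<in> {..0}. mps_coeff (xvar i ^ k) m \<noteq> 0}" and ?A = "{i \<in> {..0}. mps_coeff (avar i ^ k) m \<noteq> 0}"
  have x: "?X = {i \<in> {..0}. m = monom_pow (XVar i) k}" and a: "?A = {i \<in> {..0}. m = monom_pow (AVar i) k}"
    by (auto simp: coeff_var_power)
  have fin: "finite {i \<in> S. m = monom_pow (f i) k}" if "inj f" for f :: "int \<Rightarrow> var" and S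
  proof -
    have "{i \<in> S. m = monom_pow (f i) k} \<subseteq> f -` Poly_Mapping.keys m" using assms by auto
    then show ?thesis using finite_vimageI[OF _ that] by (meson finite_keys finite_subset)
  qed
  have finX: "finite ?X" and finA: "finite ?A"
    unfolding x a by (intro fin; simp add: inj_on_def)+
  have "mps_coeff (psum_double k) m = (\<Sum>i | i \<in> {..0} \<and> mps_coeff (?f i) m \<noteq> 0. mps_coeff (?f i) m)"
    unfolding psum_double_def coeff_suminf ..
  also have "\<dots> = (\<Sum>i\<in>?X \<union> ?A. mps_coeff (?f i) m)"
    using finX finA by (intro sum.mono_neutral_left) auto
  also have "\<dots> = (\<Sum>i\<in>?X \<union> ?A. mps_coeff (xvar i ^ k) m) - (\<Sum>i\<in>?X \<union> ?A. mps_coeff (avar i ^ k) m)"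
    by (simp add: sum_subtractf)
  also have "(\<Sum>i\<in>?X \<union> ?A. mps_coeff (xvar i ^ k) m) = (\<Sum>i\<in>?X. mps_coeff (xvar i ^ k) m)"
    using finX finA by (intro sum.mono_neutral_right) auto
  also have "(\<Sum>i\<in>?X \<union> ?A. mps_coeff (avar i ^ k) m) = (\<Sum>i\<in>?A. mps_coeff (avar i ^ k) m)"
    using finX finA by (intro sum.mono_neutral_right) auto
  also have "(\<Sum>i\<in>?X. mps_coeff (xvar i ^ k) m) - (\<Sum>i\<in>?A. mps_coeff (avar i ^ k) m) =
      mps_coeff (mps_suminf (\<lambda>i. xvar i ^ k) {..0} - mps_suminf (\<lambda>i. avar i ^ k) {..0}) m"
    by (simp add: coeff_suminf)
  also have "mps_suminf (\<lambda>i. xvar i ^ k) {..0} = powsum (xset 0) k"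
    using assms by (intro suminf_var_power) (auto simp: inj_on_def)
  also have "mps_suminf (\<lambda>i. avar i ^ k) {..0} = powsum (aset 0) k"
    using assms by (intro suminf_var_power) (auto simp: inj_on_def)
  finally show "mps_coeff (psum_double k) m = mps_coeff (powsum (xset 0) k - powsum (aset 0) k) m" .
qed

text \<open>Homomorphisms are \<open>undefined\<close> off their domain, so agreement on the
  generators gives equality as functions. This is the uniqueness half of the definite
  descriptions.\<close>

lemma algebra_hom_unique:
  assumes "algebra_hom (subalgebra G) T \<phi>" "algebra_hom (subalgebra G) T' \<psi>"
    and "\<And>g. g \<in> G \<Longrightarrow> \<phi> g = \<psi> g"
  shows "\<phi> = \<psi>"
proof
  fix f
  show "\<phi> f = \<psi> f"
  proof (cases "f \<in> subalgebra G")
    case True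
    then show ?thesis
      by (induction) (use assms in \<open>auto simp: algebra_hom_def\<close>)
  next
    case False
    then show ?thesis using assms(1,2) by (auto simp: algebra_hom_def PiE_def extensional_def)
  qed
qed

lemma subalgebra_uminus: "f \<in> subalgebra G \<Longrightarrow> - f \<in> subalgebra G"
  using subalgebra.mult[OF subalgebra.const[of "-1" G], of f] by (simp add: mps_const_uminus)

lemma subalgebra_diff: "f \<in> subalgebra G \<Longrightarrow> g \<in> subalgebra G \<Longrightarrow> f - g \<in> subalgebra G"
  using subalgebra.add[OF _ subalgebra_uminus, of f G g] by simp

lemma subalgebra_sum: "(\<And>x. x \<in> A \<Longrightarrow> f x \<in> subalgebra G) \<Longrightarrow> sum f A \<in> subalgebra G"
  using subalgebra.const[of 0 G]
  by (induction A rule: infinite_finite_induct) (auto intro: subalgebra.add)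

lemma subalgebra_power: "f \<in> subalgebra G \<Longrightarrow> f ^ k \<in> subalgebra G"
  using subalgebra.const[of 1 G] by (induction k) (auto intro: subalgebra.mult)

section \<open>Existence of the map f -> f(x/a)\<close>

text \<open>
  To see that \<open>p\<^sub>k \<mapsto> p\<^sub>k(x||a)\<close> respects all relations, rename the variables so that \<open>p\<^sub>k\<close>
  becomes \<open>p\<^sub>k(x) + N p\<^sub>k(a)\<close>.  A relation between the latter that holds for every natural number \<open>N\<close> is a
  polynomial identity in \<open>N\<close>, so it also holds for \<open>N = -1\<close>.
\<close>

fun spread :: "nat \<Rightarrow> var \<Rightarrow> var" where
  "spread N (XVar i) = (if i > 0 then XVar i
     else if (- i) mod (int N + 1) = 0 then XVar (- ((- i) div (int N + 1)))
     else AVar (- ((- i) div (int N + 1))))"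
| "spread N (AVar i) = AVar i"

lemma finite_fibres_spread: "finite_fibres (spread N)"
  unfolding finite_fibres_def
proof
  fix w
  let ?M = "int N + 1"
  have b: "{i. i \<le> 0 \<and> (- i) div ?M = q} \<subseteq> {- (?M * (q + 1))..0}" for q
  proof
    fix i assume i: "i \<in> {i. i \<le> 0 \<and> (- i) div ?M = q}"
    have "- i < ?M * (q + 1)"
      using i mult_div_mod_eq[of ?M "- i"] pos_mod_bound[of ?M "- i"] by (auto simp: distrib_left)
    then show "i \<in> {- (?M * (q + 1))..0}" using i by auto
  qed
  then have f: "finite {i. i \<le> 0 \<and> (- i) div ?M = q}" for q
    by (rule finite_subset) simp
  have "{v. spread N v = w} \<subseteq> {w} \<union> XVar ` (case w of XVar j \<Rightarrow> {i. i \<le> 0 \<and> (- i) div ?M = - j}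
      | AVar j \<Rightarrow> {i. i \<le> 0 \<and> (- i) div ?M = - j})"
  proof
    fix v assume v: "v \<in> {v. spread N v = w}"
    show "v \<in> {w} \<union> XVar ` (case w of XVar j \<Rightarrow> {i. i \<le> 0 \<and> (- i) div ?M = - j}
      | AVar j \<Rightarrow> {i. i \<le> 0 \<and> (- i) div ?M = - j})"
      using v by (cases v) (auto split: var.splits if_splits)
  qed
  then show "finite {v. spread N v = w}"
    by (rule finite_subset) (auto simp: f split: var.splits)
qed

text \<open>The indices i <= 0 fall into consecutive blocks of length N + 1, numbered by q = (-i)
  div (N + 1). In block q one variable becomes x_(-q) and the other N become a_(-q).\<close>

lemma ren_spread_powsum:
  assumes k: "k \<ge> 1"
  shows "ren (spread N) (powsum (xset 0) k) = powsum (xset 0) k + of_nat N * powsum (aset 0) k"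
proof (rule mps_eqI)
  fix m
  let ?M = "int N + 1"
  let ?C = "{v \<in> xset 0. monom_pow (spread N v) k = m}"
  have l: "mps_coeff (ren (spread N) (powsum (xset 0) k)) m = of_nat (card ?C)"
    using ren_powsum[OF finite_fibres_spread k] .
  have img: "spread N v \<in> xset 0 \<union> aset 0" if "v \<in> xset 0" for v
    using that by (auto simp: pos_imp_zdiv_nonneg_iff)
  have s: "monom_pow v k = monom_pow w k \<longleftrightarrow> v = w" for v w :: var
    using k by (simp add: single_eq_single_iff)
  consider (x) j where "j \<le> 0" "m = monom_pow (XVar j) k" | (a) j where "j \<le> 0" "m = monom_pow (AVar j) k"
    | (n) "m \<notin> (\<lambda>v. monom_pow v k) ` (xset 0 \<union> aset 0)" by auto
  then show "mps_coeff (ren (spread N) (powsum (xset 0) k)) m =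
      mps_coeff (powsum (xset 0) k + of_nat N * powsum (aset 0) k) m"
  proof cases
    case x
    \<comment> \<open>The only member of block -j with remainder 0.\<close>
    have "?C = {XVar (?M * j)}"
    proof
      show "?C \<subseteq> {XVar (?M * j)}"
      proof
        fix v assume "v \<in> ?C"
        then obtain i where i: "v = XVar i" "i \<le> 0" "spread N v = XVar j" using x by (auto simp: s)
        then have "(- i) mod ?M = 0" "(- i) div ?M = - j" by (auto split: if_splits)
        then have "- i = ?M * (- j)" using mult_div_mod_eq[of ?M "- i"] by simp
        then show "v \<in> {XVar (?M * j)}" using i by simp
      qed
      have "?M * j \<le> 0" using x by (simp add: mult_nonneg_nonpos)
      moreover have "(- (?M * j)) mod ?M = 0" "(- (?M * j)) div ?M = - j"
        using mod_mult_self1_is_0[of ?M "- j"] nonzero_mult_div_cancel_left[of ?M "- j"] by simp_all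
      ultimately show "{XVar (?M * j)} \<subseteq> ?C" using x by (simp add: s)
    qed
    then show ?thesis unfolding l using x by (auto simp: coeff_powsum s)
  next
    case a
    \<comment> \<open>The members of block -j with the nonzero remainders r = 1, ..., N.\<close>
    have "bij_betw (\<lambda>r. XVar (?M * j - r)) {1..int N} ?C"
    proof (rule bij_betw_imageI)
      show "inj_on (\<lambda>r. XVar (?M * j - r)) {1..int N}" by (auto simp: inj_on_def)
      show "(\<lambda>r. XVar (?M * j - r)) ` {1..int N} = ?C"
      proof
        show "(\<lambda>r. XVar (?M * j - r)) ` {1..int N} \<subseteq> ?C"
        proof
          fix v assume "v \<in> (\<lambda>r. XVar (?M * j - r)) ` {1..int N}"
          then obtain r where r: "1 \<le> r" "r \<le> int N" "v = XVar (?M * j - r)" by auto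
          have e: "- (?M * j - r) = r + ?M * (- j)" by simp
          have "?M * j \<le> 0" using a by (simp add: mult_nonneg_nonpos)
          moreover have "(- (?M * j - r)) mod ?M = r"
            unfolding e mod_mult_self2 using r by simp
          moreover have "(- (?M * j - r)) div ?M = - j"
            unfolding e by (subst div_mult_self2) (use r in auto)
          ultimately show "v \<in> ?C" using r a by (simp add: s)
        qed
        show "?C \<subseteq> (\<lambda>r. XVar (?M * j - r)) ` {1..int N}"
        proof
          fix v assume "v \<in> ?C"
          then obtain i where i: "v = XVar i" "i \<le> 0" "spread N v = AVar j" using a by (auto simp: s)
          let ?r = "(- i) mod ?M"
          have d: "?r \<noteq> 0" "(- i) div ?M = - j" using i by (auto split: if_splits)
          have "0 \<le> ?r" by (rule pos_mod_sign) simp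
          moreover have "?r < ?M" by (rule pos_mod_bound) simp
          ultimately have "?r \<in> {1..int N}" using d by (simp only: atLeastAtMost_iff) linarith
          moreover have "i = ?M * j - ?r" using mult_div_mod_eq[of ?M "- i"] d by simp
          ultimately show "v \<in> (\<lambda>r. XVar (?M * j - r)) ` {1..int N}" using i by blast
        qed
      qed
    qed
    then have "card {1..int N} = card ?C" by (rule bij_betw_same_card)
    then have "card ?C = N" by simp
    then show ?thesis unfolding l using a by (auto simp: coeff_powsum s)
  next
    case n
    then have C: "?C = {}" using img by blast
    show ?thesis unfolding l C using n by (auto simp: coeff_powsum)
  qed
qed

text \<open>The polynomial variable stands for N: F records how f is transformed by
  \<open>spread N\<close>, uniformly in N. It is a relation because f may be written in the
  generators in several ways; that all of them yield the same F is
  \<open>symrel_unique\<close>.\<close>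

inductive symrel :: "series \<Rightarrow> series poly \<Rightarrow> bool" where
  gen: "k \<ge> 1 \<Longrightarrow> symrel (psum k) [:powsum (xset 0) k, powsum (aset 0) k:]"
| const: "symrel (mps_const c) [:mps_const c:]"
| add: "symrel f F \<Longrightarrow> symrel g G \<Longrightarrow> symrel (f + g) (F + G)"
| mult: "symrel f F \<Longrightarrow> symrel g G \<Longrightarrow> symrel (f * g) (F * G)"

lemma symrel_ren: "symrel f F \<Longrightarrow> ren (spread N) f = poly F (of_nat N)"
  by (induction rule: symrel.induct)
     (auto simp: psum_eq ren_spread_powsum ren_add ren_mult[OF finite_fibres_spread])

lemma symrel_Lam: "symrel f F \<Longrightarrow> poly F (- 1) \<in> Lam"
proof (induction rule: symrel.induct)
  case (gen k)
  then have "psum_double k \<in> Lam" unfolding Lam_def by (intro subalgebra.gen) auto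
  then show ?case using gen by (simp add: psum_double_eq)
qed (auto simp: Lam_def intro: subalgebra.intros)

lemma Sym_symrel: "f \<in> Sym \<Longrightarrow> \<exists>F. symrel f F"
  unfolding Sym_def by (induction rule: subalgebra.induct) (blast intro: symrel.intros)+

text \<open>For each monomial the coefficients of the difference form a polynomial over the
  rationals with every natural number as a root. Passing to single monomials thus moves the root
  count to a field.\<close>

lemma poly_mps_eqI:
  fixes F G :: "('v, rat) mps poly"
  assumes "\<And>N. poly F (of_nat N) = poly G (of_nat N)"
  shows "F = G"
proof -
  have z: "H = 0" if H: "\<And>N. poly H (of_nat N) = 0" for H :: "('v, rat) mps poly"
  proof (rule poly_eqI)
    fix i
    show "coeff H i = coeff 0 i"
    proof (rule mps_eqI)
      fix m
      let ?Q = "map_poly (\<lambda>f. mps_coeff f m) H"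
      have "poly ?Q (of_nat N) = 0" for N
      proof -
        have d: "degree ?Q \<le> degree H" by (rule map_poly_degree_leq)
        have "poly ?Q (of_nat N) = (\<Sum>i\<le>degree H. coeff ?Q i * of_nat N ^ i)"
          unfolding poly_altdef using d
          by (intro sum.mono_neutral_left) (auto simp: coeff_eq_0)
        also have "\<dots> = mps_coeff (poly H (of_nat N)) m"
          unfolding poly_altdef coeff_sum
        proof (rule sum.cong)
          fix i
          have "mps_coeff (coeff H i * of_nat N ^ i) m = mps_coeff (of_nat (N ^ i) * coeff H i) m"
            by (simp add: mult.commute)
          then show "coeff ?Q i * of_nat N ^ i = mps_coeff (coeff H i * of_nat N ^ i) m"
            by (simp only: coeff_of_nat_mult) (simp add: coeff_map_poly)
        qed simp
        finally show ?thesis by (simp add: H)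
      qed
      then have "range of_nat \<subseteq> {x :: rat. poly ?Q x = 0}" by auto
      moreover have "infinite (range (of_nat :: nat \<Rightarrow> rat))"
        by (simp add: finite_image_iff inj_on_def)
      ultimately have "?Q = 0" using poly_roots_finite finite_subset by metis
      then have "coeff ?Q i = 0" by simp
      then show "mps_coeff (coeff H i) m = mps_coeff (coeff 0 i) m" by (simp add: coeff_map_poly)
    qed
  qed
  have "F - G = 0" by (rule z) (simp add: assms)
  then show ?thesis by simp
qed

lemma symrel_unique: "symrel f F \<Longrightarrow> symrel f G \<Longrightarrow> F = G"
  using symrel_ren by (intro poly_mps_eqI) metis

text \<open>At N = -1 the polynomial attached to p_k becomes p_k(x||a). Evaluation at -1 is well
  defined by \<open>symrel_unique\<close>, which gives existence; uniqueness holds because the p_k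
  generate \<open>Sym\<close>.\<close>

lemma superize_hom:
  "algebra_hom Sym Lam superize \<and> (\<forall>k\<ge>1. superize (psum k) = psum_double k)"
proof -
  define \<phi> where "\<phi> = (\<lambda>f. if f \<in> Sym then poly (SOME F. symrel f F) (- 1) else undefined)"
  have \<phi>: "\<phi> f = poly F (- 1)" if "f \<in> Sym" "symrel f F" for f F
    using that symrel_unique[OF _ that(2)] unfolding \<phi>_def by (metis (mono_tags, lifting) someI)
  have S: "psum k \<in> Sym" if "k \<ge> 1" for k
    using that unfolding Sym_def by (intro subalgebra.gen) auto
  have hom: "algebra_hom Sym Lam \<phi>"
    unfolding algebra_hom_def
  proof (intro conjI allI ballI)
    show "\<phi> \<in> Sym \<rightarrow>\<^sub>E Lam"
    proof (rule PiE_I)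
      fix f assume "f \<in> Sym"
      then show "\<phi> f \<in> Lam" using Sym_symrel \<phi> symrel_Lam by metis
    qed (simp add: \<phi>_def)
    show "\<phi> (mps_const c) = mps_const c" for c
      using \<phi>[OF _ symrel.const] by (simp add: Sym_def subalgebra.const)
    fix f g assume f: "f \<in> Sym" and g: "g \<in> Sym"
    obtain F G where FG: "symrel f F" "symrel g G" using f g Sym_symrel by blast
    show "\<phi> (f + g) = \<phi> f + \<phi> g"
      using \<phi>[OF _ symrel.add[OF FG]] \<phi>[OF f FG(1)] \<phi>[OF g FG(2)] f g
      by (simp add: Sym_def subalgebra.add)
    show "\<phi> (f * g) = \<phi> f * \<phi> g"
      using \<phi>[OF _ symrel.mult[OF FG]] \<phi>[OF f FG(1)] \<phi>[OF g FG(2)] f g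
      by (simp add: Sym_def subalgebra.mult)
  qed
  moreover have "\<forall>k\<ge>1. \<phi> (psum k) = psum_double k"
    using \<phi>[OF S symrel.gen] by (simp add: psum_double_eq)
  ultimately have \<phi>': "algebra_hom Sym Lam \<phi> \<and> (\<forall>k\<ge>1. \<phi> (psum k) = psum_double k)" by blast
  show ?thesis
    unfolding superize_def
  proof (rule theI[where P = "\<lambda>\<phi>. algebra_hom Sym Lam \<phi> \<and> (\<forall>k\<ge>1. \<phi> (psum k) = psum_double k)"])
    show "algebra_hom Sym Lam \<phi> \<and> (\<forall>k\<ge>1. \<phi> (psum k) = psum_double k)" by (rule \<phi>')
    fix \<psi>
    assume \<psi>: "algebra_hom Sym Lam \<psi> \<and> (\<forall>k\<ge>1. \<psi> (psum k) = psum_double k)"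
    show "\<psi> = \<phi>"
      by (rule algebra_hom_unique[of "{psum k | k. k \<ge> 1}" Lam \<psi> Lam \<phi>, folded Sym_def])
        (use \<psi> \<phi>' in auto)
  qed
qed

section \<open>The shift of the a-variables and the powers of \<open>gamma\<close>\<close>

definition shift :: "int \<Rightarrow> var \<Rightarrow> var" where
  "shift n v = (case v of XVar i \<Rightarrow> XVar i | AVar j \<Rightarrow> AVar (j + n))"

lemma shift_simps [simp]: "shift n (XVar i) = XVar i" "shift n (AVar j) = AVar (j + n)"
  by (simp_all add: shift_def)

lemma shift_shift: "shift n (shift k v) = shift (n + k) v"
  by (cases v) auto

lemma shift_0: "shift 0 v = v"
  by (cases v) auto

lemma shift_inverse: "shift (- n) (shift n v) = v" "shift n (shift (- n) v) = v"
  by (simp_all add: shift_shift shift_0)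

lemma finite_fibres_shift: "finite_fibres (shift n)"
  unfolding finite_fibres_def
proof
  fix w
  have "{v. shift n v = w} = {shift (- n) w}" by (auto simp: shift_inverse)
  then show "finite {v. shift n v = w}" by simp
qed

lemma coeff_ren_shift: "mps_coeff (ren (shift n) f) m = mps_coeff f (push (shift (- n)) m)"
  by (rule ren_inverse) (simp_all add: shift_inverse)

lemma ren_shift_ren: "ren (shift n) (ren (shift k) f) = ren (shift (n + k)) f"
  by (rule mps_eqI) (simp add: coeff_ren_shift push_push shift_shift add.commute)

lemma ren_shift_0 [simp]: "ren (shift 0) f = f"
proof -
  have "shift 0 = (\<lambda>v. v)" by (rule ext) (rule shift_0)
  then show ?thesis by (intro mps_eqI) (subst coeff_ren_shift, simp)
qed

lemma ren_shift_powsum_image: "k \<ge> 1 \<Longrightarrow> ren (shift n) (powsum V k) = powsum (shift n ` V) k"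
  by (rule ren_powsum_bij[of "shift (- n)" "shift n"]) (simp_all only: shift_inverse)

lemma ren_shift_avar: "ren (shift n) (avar j) = avar (j + n)"
  using ren_var_bij[of "shift (- n)" "shift n" "AVar j"] by (simp add: shift_inverse)

lemma ren_shift_powsum:
  assumes "k \<ge> 1"
  shows "ren (shift n) (powsum (xset i) k) = powsum (xset i) k"
    and "ren (shift n) (powsum (aset j) k) = powsum (aset (j + n)) k"
proof -
  have "shift n ` xset i = xset i" by (auto simp: image_image)
  then show "ren (shift n) (powsum (xset i) k) = powsum (xset i) k"
    by (simp add: ren_shift_powsum_image[OF assms])
  have "shift n ` aset j = aset (j + n)"
  proof
    show "aset (j + n) \<subseteq> shift n ` aset j"
    proof
      fix v assume "v \<in> aset (j + n)"
      then obtain l where "v = AVar l" "l \<le> j + n" by auto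
      then show "v \<in> shift n ` aset j" by (intro image_eqI[of _ _ "AVar (l - n)"]) auto
    qed
  qed auto
  then show "ren (shift n) (powsum (aset j) k) = powsum (aset (j + n)) k"
    by (simp add: ren_shift_powsum_image[OF assms])
qed

lemma aset_Suc: "aset (n + 1) = insert (AVar (n + 1)) (aset n)"
proof -
  have "{..n + 1} = insert (n + 1) {..n}" by auto
  then show ?thesis by simp
qed

lemma powsum_aset_Suc: "k \<ge> 1 \<Longrightarrow> powsum (aset (n + 1)) k = powsum (aset n) k + avar (n + 1) ^ k"
proof -
  assume k: "k \<ge> 1"
  have "AVar (n + 1) \<notin> aset n" by auto
  then show ?thesis using k powsum_Un[of k "aset n" "{AVar (n + 1)}"] by (simp add: aset_Suc powsum_singleton)
qed

lemma psum_double_Lam: "k \<ge> 1 \<Longrightarrow> psum_double k \<in> Lam"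
  and avar_Lam: "avar j \<in> Lam"
  unfolding Lam_def by (auto intro: subalgebra.gen)

text \<open>The range j <= 0 of the a-variables in p_k(x||a) grows to j <= 1, which accounts for the
  term - a_1^k.\<close>

lemma ren_shift_Lam1: "f \<in> Lam \<Longrightarrow> ren (shift 1) f \<in> Lam"
  unfolding Lam_def
proof (induction rule: subalgebra.induct)
  case (gen g)
  show ?case unfolding Lam_def[symmetric]
  proof (cases "g \<in> range avar")
    case True
    then show "ren (shift 1) g \<in> Lam" using avar_Lam by (auto simp: ren_shift_avar)
  next
    case False
    then obtain k where k: "g = psum_double k" "k \<ge> 1" using gen by auto
    then have "ren (shift 1) g = psum_double k - avar 1 ^ k"
      using powsum_aset_Suc[of k 0] by (simp add: psum_double_eq ren_diff ren_shift_powsum)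
    then show "ren (shift 1) g \<in> Lam"
      using psum_double_Lam[OF k(2)] avar_Lam[of 1] unfolding Lam_def
      by (auto intro: subalgebra_diff subalgebra_power)
  qed
qed (auto simp: ren_add ren_mult[OF finite_fibres_shift] intro: subalgebra.intros)

text \<open>Now the range shrinks to j <= -1, so a_0^k is added back. Hence the inverse shift also
  preserves \<open>Lam\<close>, which makes the shift bijective there.\<close>

lemma ren_shift_Lam_neg1: "f \<in> Lam \<Longrightarrow> ren (shift (- 1)) f \<in> Lam"
  unfolding Lam_def
proof (induction rule: subalgebra.induct)
  case (gen g)
  show ?case unfolding Lam_def[symmetric]
  proof (cases "g \<in> range avar")
    case True
    then show "ren (shift (- 1)) g \<in> Lam" using avar_Lam by (auto simp: ren_shift_avar)
  next
    case False
    then obtain k where k: "g = psum_double k" "k \<ge> 1" using gen by auto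
    then have "ren (shift (- 1)) g = powsum (xset 0) k - powsum (aset (- 1)) k"
      by (simp add: psum_double_eq ren_diff ren_shift_powsum)
    also have "\<dots> = psum_double k + avar 0 ^ k"
      using powsum_aset_Suc[of k "- 1"] k by (simp add: psum_double_eq)
    finally have "ren (shift (- 1)) g = psum_double k + avar 0 ^ k" .
    then show "ren (shift (- 1)) g \<in> Lam"
      using psum_double_Lam[OF k(2)] avar_Lam[of 0] unfolding Lam_def
      by (auto intro: subalgebra.add subalgebra_power)
  qed
qed (auto simp: ren_add ren_mult[OF finite_fibres_shift] intro: subalgebra.intros)

lemma gamma_eq: "gamma = restrict (ren (shift 1)) Lam"
  unfolding gamma_def
proof (rule the_equality)
  let ?g = "restrict (ren (shift 1)) Lam"
  have c: "mps_const c \<in> Lam" for c unfolding Lam_def by (rule subalgebra.const)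
  have hom: "algebra_hom Lam Lam ?g"
    unfolding algebra_hom_def
    by (auto simp: c ren_shift_Lam1 ren_add ren_mult[OF finite_fibres_shift])
       (auto simp: Lam_def intro: subalgebra.intros)
  have bij: "bij_betw ?g Lam Lam"
    by (rule bij_betw_byWitness[where f' = "ren (shift (- 1))"])
       (auto simp: ren_shift_ren ren_shift_Lam1 ren_shift_Lam_neg1)
  have a: "?g (avar i) = avar (i + 1)" for i by (simp add: avar_Lam ren_shift_avar)
  have p: "?g (psum_double k) = psum_double k - avar 1 ^ k" if "k \<ge> 1" for k
    using that powsum_aset_Suc[of k 0] psum_double_Lam[OF that]
    by (simp add: psum_double_eq ren_diff ren_shift_powsum)
  show "algebra_hom Lam Lam ?g \<and> bij_betw ?g Lam Lam \<and> (\<forall>i. ?g (avar i) = avar (i + 1)) \<and>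
      (\<forall>k\<ge>1. ?g (psum_double k) = psum_double k - avar 1 ^ k)"
    using hom bij a p by blast
  fix \<phi>
  assume "algebra_hom Lam Lam \<phi> \<and> bij_betw \<phi> Lam Lam \<and> (\<forall>i. \<phi> (avar i) = avar (i + 1)) \<and>
      (\<forall>k\<ge>1. \<phi> (psum_double k) = psum_double k - avar 1 ^ k)"
  then show "\<phi> = ?g"
    using hom a p
    by (intro algebra_hom_unique[of "range avar \<union> {psum_double k | k. k \<ge> 1}" Lam \<phi> Lam, folded Lam_def])
       (auto simp: psum_double_Lam avar_Lam)
qed

lemma gamma_Lam: "f \<in> Lam \<Longrightarrow> gamma f = ren (shift 1) f"
  by (simp add: gamma_eq)

lemma inv_gamma_eq:
  assumes "g \<in> Lam"
  shows "inv_into Lam gamma g = ren (shift (- 1)) g"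
proof (rule inv_into_f_eq)
  show "inj_on gamma Lam"
    by (rule inj_on_inverseI[where g = "ren (shift (- 1))"]) (simp add: gamma_eq ren_shift_ren)
qed (use assms in \<open>auto simp: gamma_eq ren_shift_Lam_neg1 ren_shift_ren\<close>)

text \<open>Membership in \<open>Lam\<close> is carried along in both inductions because
  \<open>gamma\<close> and its inverse are known to be shifts only on \<open>Lam\<close>.\<close>

lemma gamma_pow_eq:
  assumes "f \<in> Lam"
  shows "gamma_pow n f = ren (shift n) f" "gamma_pow n f \<in> Lam"
proof -
  have up: "(gamma ^^ k) f = ren (shift (int k)) f \<and> (gamma ^^ k) f \<in> Lam" for k
  proof (induction k)
    case (Suc k)
    have "(gamma ^^ Suc k) f = ren (shift 1) ((gamma ^^ k) f)"
      using gamma_Lam[OF Suc.IH[THEN conjunct2]] by simp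
    moreover have "ren (shift 1) ((gamma ^^ k) f) = ren (shift (int (Suc k))) f"
      using Suc by (simp add: ren_shift_ren)
    ultimately show ?case using Suc ren_shift_Lam1 by metis
  qed (use assms in simp)
  have down: "(inv_into Lam gamma ^^ k) f = ren (shift (- int k)) f \<and> (inv_into Lam gamma ^^ k) f \<in> Lam" for k
  proof (induction k)
    case (Suc k)
    have "(inv_into Lam gamma ^^ Suc k) f = ren (shift (- 1)) ((inv_into Lam gamma ^^ k) f)"
      using inv_gamma_eq[OF Suc.IH[THEN conjunct2]] by simp
    moreover have "ren (shift (- 1)) ((inv_into Lam gamma ^^ k) f) = ren (shift (- int (Suc k))) f"
      using Suc by (simp add: ren_shift_ren)
    ultimately show ?case using Suc ren_shift_Lam_neg1 by metis
  qed (use assms in simp)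
  show "gamma_pow n f = ren (shift n) f" "gamma_pow n f \<in> Lam"
    unfolding gamma_pow_def using up[of "nat n"] down[of "nat (- n)"] by (cases "n \<ge> 0"; simp)+
qed

section \<open>Complete functions under \<open>superize\<close> and the shift\<close>

lemma hom_sum:
  assumes "algebra_hom (subalgebra G) T \<phi>" "\<And>x. x \<in> A \<Longrightarrow> f x \<in> subalgebra G"
  shows "\<phi> (sum f A) = (\<Sum>x\<in>A. \<phi> (f x))"
  using assms(2)
proof (induction A rule: infinite_finite_induct)
  case (insert x A)
  then have "f x \<in> subalgebra G" "sum f A \<in> subalgebra G" by (auto intro: subalgebra_sum)
  then show ?case using insert assms(1) by (auto simp: algebra_hom_def)
next
  case empty
  then show ?case using assms(1) mps_const_0 unfolding algebra_hom_def by (metis sum.empty)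
next
  case (infinite A)
  then show ?case using assms(1) mps_const_0 unfolding algebra_hom_def by (metis sum.infinite)
qed

lemma hsym_eq: "hsym = hcomp (xset 0)"
  by (rule ext) (simp add: hsym_def hcomp_def mdeg_def)

lemma newton_hsym: "newton psum hsym"
proof -
  have "newton (powsum (xset 0)) hsym" unfolding hsym_eq by (rule newton_hcomp)
  then show ?thesis unfolding newton_def by (simp add: psum_eq)
qed

lemma psum_Sym: "k \<ge> 1 \<Longrightarrow> psum k \<in> Sym"
  unfolding Sym_def by (intro subalgebra.gen) auto

text \<open>Newton's identities divided by r express h_r through power sums and smaller h; the
  factor 1/r is available over the rationals.\<close>

lemma hsym_Sym: "hsym r \<in> Sym"
proof (induction r rule: less_induct)
  case (less r)
  show ?case
  proof (cases "r = 0")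
    case True
    then show ?thesis using newton_hsym subalgebra.const[of 1]
      by (simp add: newton_def Sym_def)
  next
    case False
    have "(\<Sum>k=1..r. psum k * hsym (r - k)) \<in> Sym"
      using less psum_Sym unfolding Sym_def by (intro subalgebra_sum subalgebra.mult) auto
    then have "mps_const (1 / of_nat r) * (of_nat r * hsym r) \<in> Sym"
      using newton_hsym False subalgebra.mult[OF subalgebra.const] unfolding newton_def Sym_def by simp
    also have "mps_const (1 / of_nat r) * (of_nat r * hsym r) = hsym r"
      using False by (intro mps_eqI) simp
    finally show ?thesis .
  qed
qed

text \<open>The product of 1 - a_j u over j <= z divided by the product of 1 - x_i u over i <= n.
  Passing to higher rows of the halfplane lowers n.\<close>

definition Hgen :: "int \<Rightarrow> int \<Rightarrow> series fps" where
  "Hgen n z = hgen (xset n) * egen (aset z)"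

lemma newton_Hgen: "newton (\<lambda>k. powsum (xset n) k - powsum (aset z) k) (fps_nth (Hgen n z))"
  unfolding Hgen_def by (rule newton_hgen_egen)

text \<open>Both sequences satisfy Newton's identities for the p_k(x||a), on the left because
  \<open>superize\<close> is a homomorphism on \<open>Sym\<close>.\<close>

lemma superize_hsym: "superize (hsym r) = fps_nth (Hgen 0 0) r"
proof (rule newton_unique[OF _ newton_Hgen])
  have hom: "algebra_hom (subalgebra {psum k | k. k \<ge> 1}) Lam superize"
    using superize_hom by (simp add: Sym_def)
  then have add: "superize (mps_const c) = mps_const c"
    and mult: "f \<in> Sym \<Longrightarrow> g \<in> Sym \<Longrightarrow> superize (f * g) = superize f * superize g" for c f g
    by (auto simp: algebra_hom_def Sym_def)
  have c: "mps_const c \<in> Sym" for c by (simp add: Sym_def subalgebra.const)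
  show "newton psum_double (\<lambda>r. superize (hsym r))"
    unfolding newton_def
  proof (intro conjI allI impI)
    have "hsym 0 = mps_const 1" using newton_hsym by (simp add: newton_def)
    then show "superize (hsym 0) = 1" using add[of 1] by simp
    fix r :: nat assume r: "r \<ge> 1"
    have "of_nat r * superize (hsym r) = superize (of_nat r * hsym r)"
      by (simp add: of_nat_mps mult[OF c hsym_Sym] add)
    also have "\<dots> = superize (\<Sum>k=1..r. psum k * hsym (r - k))"
      using newton_hsym r by (simp add: newton_def)
    also have "\<dots> = (\<Sum>k=1..r. superize (psum k * hsym (r - k)))"
    proof (rule hom_sum[OF hom, folded Sym_def])
      fix k assume "k \<in> {1..r}"
      then have "psum k \<in> Sym" by (simp add: psum_Sym)
      then show "psum k * hsym (r - k) \<in> Sym" using hsym_Sym unfolding Sym_def by (intro subalgebra.mult)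
    qed
    also have "\<dots> = (\<Sum>k=1..r. psum_double k * superize (hsym (r - k)))"
      by (intro sum.cong refl) (use superize_hom psum_Sym hsym_Sym mult in auto)
    finally show "of_nat r * superize (hsym r) = (\<Sum>k=1..r. psum_double k * superize (hsym (r - k)))" .
  qed
qed (simp add: psum_double_eq)

lemma ren_shift_Hgen: "ren (shift n) (fps_nth (Hgen 0 0) r) = fps_nth (Hgen 0 n) r"
proof (rule newton_unique[OF _ newton_Hgen])
  let ?p = "\<lambda>k. powsum (xset 0) k - powsum (aset 0) k"
  have s: "ren (shift n) (sum f A) = (\<Sum>a\<in>A. ren (shift n) (f a))" for f :: "nat \<Rightarrow> series" and A
    by (induction A rule: infinite_finite_induct)
       (use ren_const[of "shift n" "0::rat"] in \<open>auto simp: ren_add\<close>)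
  show "newton (\<lambda>k. ren (shift n) (?p k)) (\<lambda>r. ren (shift n) (fps_nth (Hgen 0 0) r))"
  proof (rule newton_map[OF newton_Hgen])
    show "ren (shift n) (1 :: series) = 1" using ren_const[of "shift n" "1::rat"] by simp
  qed (simp_all add: s ren_mult[OF finite_fibres_shift] of_nat_mps)
qed (simp add: ren_diff ren_shift_powsum)


section \<open>The determinant\<close>

definition fps_coeff :: "'a::comm_ring_1 fps \<Rightarrow> int \<Rightarrow> 'a" where
  "fps_coeff F z = (if z < 0 then 0 else fps_nth F (nat z))"

text \<open>Here m rows of the halfplane have been removed, leaving x_i with i <= -m, and c labels
  the matrix row. The summand m in the degree is chosen so that the label c = -k - m of an
  undisturbed row k gives degree j - k, which is 0 on the diagonal.\<close>

definition jt_entry :: "nat \<Rightarrow> int \<Rightarrow> nat \<Rightarrow> series" where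
  "jt_entry m c j = fps_coeff (Hgen (- int m) (c - 1)) (c + int j + int m)"

definition jt_det :: "nat \<Rightarrow> nat \<Rightarrow> (nat \<Rightarrow> int) \<Rightarrow> series" where
  "jt_det n m c = det (mat n n (\<lambda>(i, j). jt_entry m (c i) j))"

lemma superize_hsym_Lam: "superize (hsym r) \<in> Lam"
  using superize_hom hsym_Sym by (auto simp: algebra_hom_def)

text \<open>The shift 1 - (j + 1) of the column and the shift \<open>?r - 1\<close> inside
  \<open>h_double\<close> add up to \<open>int p - int i - 1\<close>. So all entries of a row are
  coefficients of one series, and j only selects the degree.\<close>

lemma double_schur_eq:
  "double_schur lam = jt_det (length lam) 0 (\<lambda>k. int (part lam (k + 1)) - int k)"
proof -
  have e: "gamma_pow (1 - int (j + 1)) (h_double (int p - int (i + 1) + int (j + 1))) =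
      jt_entry 0 (int p - int i) j" for p i j
  proof -
    let ?r = "int p - int (i + 1) + int (j + 1)"
    show ?thesis
    proof (cases "?r < 0")
      case True
      have "(0 :: series) \<in> Lam" using subalgebra.const[of 0] by (simp add: Lam_def)
      then have "gamma_pow (1 - int (j + 1)) 0 = ren (shift (1 - int (j + 1))) 0"
        by (rule gamma_pow_eq)
      also have "\<dots> = 0" using ren_const[of _ "0::rat"] by simp
      finally show ?thesis using True by (simp add: h_double_def jt_entry_def fps_coeff_def)
    next
      case False
      then have "h_double ?r = gamma_pow (?r - 1) (superize (hsym (nat ?r)))"
        by (simp only: h_double_def if_False)
      then have "gamma_pow (1 - int (j + 1)) (h_double ?r) =
          ren (shift (1 - int (j + 1))) (ren (shift (?r - 1)) (superize (hsym (nat ?r))))"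
        using gamma_pow_eq[OF superize_hsym_Lam] by (metis gamma_pow_eq(1))
      also have "\<dots> = ren (shift (int p - int i - 1)) (superize (hsym (nat ?r)))"
      proof -
        have "1 - int (j + 1) + (?r - 1) = int p - int i - 1" by simp
        then show ?thesis by (simp only: ren_shift_ren)
      qed
      also have "\<dots> = fps_nth (Hgen 0 (int p - int i - 1)) (nat ?r)"
        by (simp only: superize_hsym ren_shift_Hgen)
      also have "\<dots> = jt_entry 0 (int p - int i) j"
      proof -
        have r: "?r = int p - int i + int j" by simp
        show ?thesis using False unfolding jt_entry_def fps_coeff_def r by simp
      qed
      finally show ?thesis .
    qed
  qed
  show ?thesis
    unfolding double_schur_def jt_det_def e by (simp add: split_def)
qed

lemma fps_coeff_add: "fps_coeff (F + G) z = fps_coeff F z + fps_coeff G z"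
  by (simp add: fps_coeff_def)

lemma fps_coeff_const_X_mult: "fps_coeff (fps_const a * fps_X * F) z = a * fps_coeff F (z - 1)"
proof (cases "z \<ge> 1")
  case True
  then have "nat z = Suc (nat (z - 1))" by simp
  then show ?thesis using True by (simp add: fps_coeff_def mult.assoc)
next
  case False
  then have "z < 0 \<or> z = 0" by auto
  then show ?thesis by (auto simp: fps_coeff_def mult.assoc)
qed

lemma xset_insert: "xset n = insert (XVar n) (xset (n - 1))"
  and aset_insert: "aset n = insert (AVar n) (aset (n - 1))"
proof -
  have "{..n} = insert n {..n - 1}" by auto
  then show "xset n = insert (XVar n) (xset (n - 1))" "aset n = insert (AVar n) (aset (n - 1))"
    by simp_all
qed

text \<open>With G = \<open>Hgen n (z - 1)\<close> this reads (1 - a_z u) G = (1 - x_n u) G + (x_n -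
  a_z) u G.\<close>

lemma Hgen_step:
  "Hgen n z = Hgen (n - 1) (z - 1) + fps_const (xvar n - avar z) * fps_X * Hgen n (z - 1)"
proof -
  have x: "(1 - fps_const (xvar n) * fps_X) * hgen (xset n) = hgen (xset (n - 1))"
    unfolding xset_insert[of n] by (rule hgen_insert) auto
  have a: "egen (aset z) = (1 - fps_const (avar z) * fps_X) * egen (aset (z - 1))"
    unfolding aset_insert[of z] by (rule egen_insert) auto
  show ?thesis
    unfolding Hgen_def a x[symmetric] fps_const_sub[symmetric] by (simp only: algebra_simps)
qed

lemma jt_entry_step:
  "jt_entry m c j = jt_entry (Suc m) (c - 1) j
     + (xvar (- int m) - avar (c - 1)) * jt_entry m (c - 1) j"
proof -
  have i: "c - 1 + int j + int (Suc m) = c + int j + int m" "c - 1 + int j + int m = c + int j + int m - 1"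
    "- int (Suc m) = - int m - 1"
    by simp_all
  show ?thesis
    unfolding jt_entry_def i
    by (subst Hgen_step) (simp only: fps_coeff_add fps_coeff_const_X_mult)
qed

text \<open>The weight of the squares in row -m strictly between columns d and c. In a pipedream
  these will be the empty squares between the exit d k and the entry c k.\<close>

definition row_weight :: "nat \<Rightarrow> int \<Rightarrow> int \<Rightarrow> series" where
  "row_weight m d c = (\<Prod>l\<in>{d<..<c}. xvar (- int m) - avar l)"

text \<open>The one-step recursion is iterated until c has come down to e. The factor of the
  remaining term does not involve j, so if e labels the next matrix row, a row operation removes
  that term.\<close>

lemma jt_entry_expand:
  assumes "e \<le> c"
  shows "jt_entry m c j = (\<Sum>d\<in>{e..<c}. row_weight m d c * jt_entry (Suc m) d j)
     + (\<Prod>l\<in>{e..<c}. xvar (- int m) - avar l) * jt_entry m e j"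
  using assms
proof (induction c rule: int_ge_induct)
  case base
  then show ?case by simp
next
  case (step c)
  let ?t = "xvar (- int m) - avar c"
  have w: "row_weight m d (c + 1) = ?t * row_weight m d c" if "d < c" for d
  proof -
    have "{d<..<c + 1} = insert c {d<..<c}" using that by auto
    then show ?thesis by (simp add: row_weight_def)
  qed
  have "{c<..<c + 1} = {}" by auto
  then have w1: "row_weight m c (c + 1) = 1" by (simp add: row_weight_def)
  have i: "{e..<c + 1} = insert c {e..<c}" using step by auto
  have "jt_entry m (c + 1) j = jt_entry (Suc m) c j + ?t * jt_entry m c j"
    using jt_entry_step[of m "c + 1" j] by simp
  also have "?t * jt_entry m c j = (\<Sum>d\<in>{e..<c}. row_weight m d (c + 1) * jt_entry (Suc m) d j)
      + (\<Prod>l\<in>{e..<c + 1}. xvar (- int m) - avar l) * jt_entry m e j"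
    unfolding step.IH i by (simp add: distrib_left sum_distrib_left w mult.assoc)
  finally show ?case unfolding i by (simp add: w1 add.assoc)
qed

text \<open>Subtract from each row a multiple of the next one and expand multilinearly.\<close>

lemma jt_det_step:
  assumes dec: "\<And>i. i < n \<Longrightarrow> c (Suc i) < c i" and last: "c n = - int n - int m"
  shows "jt_det n m c = (\<Sum>d\<in>PiE {..<n} (\<lambda>i. {c (Suc i)..<c i}).
    (\<Prod>i<n. row_weight m (d i) (c i)) * jt_det n (Suc m) d)"
proof -
  let ?S = "\<lambda>i. {c (Suc i)..<c i}"
  define t where "t i = (\<Prod>l\<in>?S i. xvar (- int m) - avar l)" for i
  define M where "M = mat n n (\<lambda>(i, j). jt_entry m (c i) j)"
  define N where "N = mat n n (\<lambda>(i, j). \<Sum>d\<in>?S i. row_weight m d (c i) * jt_entry (Suc m) d j)"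
  \<comment> \<open>The simultaneous row operations as a unitriangular matrix, so the determinant
    does not change.\<close>
  define U where "U = mat n n (\<lambda>(i, j). if j = i then 1 else if j = Suc i then - t i else (0::series))"
  have MN: "M \<in> carrier_mat n n" "N \<in> carrier_mat n n" "U \<in> carrier_mat n n"
    by (simp_all add: M_def N_def U_def)
  \<comment> \<open>The last row has no successor to subtract. The label c n of a fictitious row n
    would give the negative degree j - n, so the remainder of the last row vanishes by
    itself.\<close>
  have z: "jt_entry m (c n) j = 0" if "j < n" for j
    using that by (simp add: jt_entry_def fps_coeff_def last)
  have row: "jt_entry m (c i) j - t i * jt_entry m (c (Suc i)) j =
      (\<Sum>d\<in>?S i. row_weight m d (c i) * jt_entry (Suc m) d j)" if "i < n" for i j
    using jt_entry_expand[OF less_imp_le[OF dec[OF that]], of m j] by (simp add: t_def)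
  have "U * M = N"
  proof (rule eq_matI)
    fix i j assume "i < dim_row N" "j < dim_col N"
    then have ij: "i < n" "j < n" by (simp_all add: N_def)
    have "(U * M) $$ (i, j) = (\<Sum>k = 0..<n. U $$ (i, k) * M $$ (k, j))"
      using ij MN by (simp add: scalar_prod_def)
    also have "\<dots> = (\<Sum>k = 0..<n. (if k = i then jt_entry m (c i) j else 0)
        - (if k = Suc i then t i * jt_entry m (c (Suc i)) j else 0))"
      using ij by (intro sum.cong refl) (auto simp: U_def M_def)
    also have "\<dots> = jt_entry m (c i) j - (if Suc i < n then t i * jt_entry m (c (Suc i)) j else 0)"
      using ij by (simp add: sum_subtractf sum.delta)
    also have "\<dots> = jt_entry m (c i) j - t i * jt_entry m (c (Suc i)) j"
    proof (cases "Suc i < n")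
      case False
      then have "Suc i = n" using ij by simp
      then show ?thesis using z ij by simp
    qed simp
    finally show "(U * M) $$ (i, j) = N $$ (i, j)" using row[OF ij(1)] ij by (simp add: N_def)
  qed (use MN in auto)
  moreover have "det U = 1"
  proof -
    have "det U = prod_list (diag_mat U)"
      using MN(3) by (intro det_upper_triangular) (auto simp: upper_triangular_def U_def)
    also have "diag_mat U = map (\<lambda>_. 1) [0..<n]" by (simp add: diag_mat_def U_def)
    also have "prod_list (map (\<lambda>_. 1) xs) = (1 :: series)" for xs :: "nat list"
      by (induction xs) auto
    finally show ?thesis .
  qed
  ultimately have "det M = det N" using det_mult[OF MN(3,1)] by simp
  also have "det N = (\<Sum>p | p permutes {0..<n}. signof p *
      (\<Prod>i=0..<n. \<Sum>d\<in>?S i. row_weight m d (c i) * jt_entry (Suc m) d (p i)))"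
    unfolding det_def'[OF MN(2)]
  proof (intro sum.cong refl arg_cong2[where f = "(*)"] prod.cong)
    fix p i assume "p \<in> {p. p permutes {0..<n}}" "i \<in> {0..<n}"
    then have "p i < n" "i < n" using permutes_in_image[of p "{0..<n}" i] by auto
    then show "N $$ (i, p i) = (\<Sum>d\<in>?S i. row_weight m d (c i) * jt_entry (Suc m) d (p i))"
      by (simp add: N_def)
  qed
  also have "\<dots> = (\<Sum>p | p permutes {0..<n}. signof p * (\<Sum>d\<in>PiE {0..<n} ?S.
      \<Prod>i=0..<n. row_weight m (d i) (c i) * jt_entry (Suc m) (d i) (p i)))"
    by (subst prod_sum_PiE) auto
  also have "\<dots> = (\<Sum>d\<in>PiE {0..<n} ?S. \<Sum>p | p permutes {0..<n}. signof p *
      (\<Prod>i=0..<n. row_weight m (d i) (c i) * jt_entry (Suc m) (d i) (p i)))"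
    unfolding sum_distrib_left by (rule sum.swap)
  also have "\<dots> = (\<Sum>d\<in>PiE {0..<n} ?S. (\<Prod>i=0..<n. row_weight m (d i) (c i)) * jt_det n (Suc m) d)"
  proof (rule sum.cong)
    fix d assume "d \<in> PiE {0..<n} ?S"
    let ?D = "mat n n (\<lambda>(i, j). jt_entry (Suc m) (d i) j)"
    have "jt_det n (Suc m) d = (\<Sum>p | p permutes {0..<n}. signof p * (\<Prod>i=0..<n. ?D $$ (i, p i)))"
      unfolding jt_det_def by (rule det_def') simp
    also have "\<dots> = (\<Sum>p | p permutes {0..<n}. signof p * (\<Prod>i=0..<n. jt_entry (Suc m) (d i) (p i)))"
    proof (intro sum.cong refl arg_cong2[where f = "(*)"] prod.cong)
      fix p i assume "p \<in> {p. p permutes {0..<n}}" "i \<in> {0..<n}"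
      then have "p i < n" "i < n" using permutes_in_image[of p "{0..<n}" i] by auto
      then show "?D $$ (i, p i) = jt_entry (Suc m) (d i) (p i)" by simp
    qed
    finally show "(\<Sum>p | p permutes {0..<n}. signof p *
      (\<Prod>i=0..<n. row_weight m (d i) (c i) * jt_entry (Suc m) (d i) (p i))) =
      (\<Prod>i=0..<n. row_weight m (d i) (c i)) * jt_det n (Suc m) d"
      by (simp add: prod.distrib sum_distrib_left ac_simps)
  qed simp
  finally show ?thesis by (simp add: jt_det_def M_def lessThan_atLeast0)
qed


section \<open>The determinant after setting variables to 0\<close>

lemma kill_const: "kill K (mps_const c) = mps_const c"
  by (rule mps_eqI) (simp add: coeff_kill coeff_const)

lemma kill_powsum:
  assumes "V \<subseteq> K" "k \<ge> 1"
  shows "kill K (powsum V k) = 0"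
proof (rule mps_eqI)
  fix m
  show "mps_coeff (kill K (powsum V k)) m = mps_coeff 0 m"
    using assms by (auto simp: coeff_kill coeff_powsum)
qed

text \<open>All power sums become 0, and the sequence 1, 0, 0, ... solves Newton's identities with
  zero power sums.\<close>

lemma kill_Hgen:
  assumes "xset n \<subseteq> K" "aset z \<subseteq> K"
  shows "kill K (fps_nth (Hgen n z) r) = (if r = 0 then 1 else 0)"
proof (rule newton_unique[where h = "\<lambda>r. kill K (fps_nth (Hgen n z) r)" and h' = "\<lambda>r. if r = 0 then 1 else 0"])
  show "newton (\<lambda>k. kill K (powsum (xset n) k - powsum (aset z) k)) (\<lambda>r. kill K (fps_nth (Hgen n z) r))"
    by (rule newton_map[OF newton_Hgen])
       (simp_all add: kill.hom_sum kill.hom_mult kill.hom_one of_nat_mps kill_const)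
  show "newton (\<lambda>k. 0 :: series) (\<lambda>r. if r = 0 then 1 else 0)"
    by (simp add: newton_def)
qed (simp add: kill.hom_minus kill_powsum assms)

lemma kill_jt_entry:
  assumes "xset (- int m) \<subseteq> K" "aset (c - 1) \<subseteq> K"
  shows "kill K (jt_entry m c j) = (if c + int j + int m = 0 then 1 else 0)"
  using kill_Hgen[OF assms] by (simp add: jt_entry_def fps_coeff_def)

text \<open>The entries become 0 or 1. In the undisturbed case the matrix is the identity; otherwise
  c 0 > -m, and then every entry of the first row has positive degree and vanishes.\<close>

lemma kill_jt_det:
  assumes K: "xset (- int m) \<subseteq> K" "\<And>i. i < n \<Longrightarrow> aset (c i - 1) \<subseteq> K"
    and c: "\<And>i. i < n \<Longrightarrow> - int i - int m \<le> c i" "\<And>i. i < n \<Longrightarrow> c i + int i \<le> c 0"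
  shows "kill K (jt_det n m c) = (if \<forall>i<n. c i = - int i - int m then 1 else 0)"
proof -
  let ?E = "mat n n (\<lambda>(i, j). if c i + int j + int m = 0 then 1 else (0 :: series))"
  have "kill K (jt_det n m c) = det (map_mat (kill K) (mat n n (\<lambda>(i, j). jt_entry m (c i) j)))"
    unfolding jt_det_def by (rule kill.hom_det[symmetric])
  also have "map_mat (kill K) (mat n n (\<lambda>(i, j). jt_entry m (c i) j)) = ?E"
    by (rule eq_matI) (simp_all add: kill_jt_entry K)
  also have "det ?E = (if \<forall>i<n. c i = - int i - int m then 1 else 0)"
  proof (cases "\<forall>i<n. c i = - int i - int m")
    case True
    then have "?E = 1\<^sub>m n" by (intro eq_matI) auto
    then show ?thesis using True by simp
  next
    case False
    then obtain i where i: "i < n" "c i \<noteq> - int i - int m" by blast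
    then have c0: "c 0 > - int m" "0 < n" using c[of i] by auto
    have "det ?E = (\<Sum>p | p permutes {0..<n}. signof p * (\<Prod>i=0..<n. ?E $$ (i, p i)))"
      by (rule det_def') simp
    also have "\<dots> = 0"
    proof (rule sum.neutral, rule)
      fix p assume "p \<in> {p. p permutes {0..<n}}"
      then have "p 0 < n" using c0 permutes_in_image[of p "{0..<n}" 0] by auto
      then have "?E $$ (0, p 0) = 0" using c0 by simp
      then have "(\<Prod>i=0..<n. ?E $$ (i, p i)) = 0" using c0 by (intro prod_zero) auto
      then show "signof p * (\<Prod>i=0..<n. ?E $$ (i, p i)) = 0" by simp
    qed
    finally show ?thesis using False by simp
  qed
  finally show ?thesis .
qed

section \<open>Chains of column sets\<close>

text \<open>
  The columns in which pipes enter row \<open>-m\<close> from the south are listed in decreasing order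
  \<open>c 0 > c 1 > \<dots>\<close>.  Since nothing crosses, the pipe entering in column \<open>c 0\<close> leaves to the east, and
  the pipe entering in column \<open>c (k + 1)\<close> leaves to the north in a column \<open>d k\<close> that is
  at least \<open>c (k + 1)\<close> and less than \<open>c k\<close>.
\<close>

definition interlace :: "(nat \<Rightarrow> int) \<Rightarrow> (nat \<Rightarrow> int) \<Rightarrow> bool" where
  "interlace c d \<longleftrightarrow> (\<forall>k. c (Suc k) \<le> d k \<and> d k < c k)"

text \<open>The entry columns of row -m when all pipes still present are hooks: the hook with corner
  (N, N) enters every row below N in column N.\<close>

definition ground :: "nat \<Rightarrow> nat \<Rightarrow> int" where
  "ground m k = - int k - int m"

definition state :: "nat \<Rightarrow> nat \<Rightarrow> (nat \<Rightarrow> int) \<Rightarrow> bool" where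
  "state n m c \<longleftrightarrow> (\<forall>k. c (Suc k) < c k) \<and> (\<forall>k\<ge>n. c k = ground m k)"

text \<open>\<gamma> i lists the entry columns of row -(m + i), and r bounds the number of rows that
  may deviate from the hooks. The sequences are infinite so that the sets for different r are
  nested.\<close>

definition chains :: "nat \<Rightarrow> nat \<Rightarrow> (nat \<Rightarrow> int) \<Rightarrow> (nat \<Rightarrow> nat \<Rightarrow> int) set" where
  "chains m r c = {\<gamma>. \<gamma> 0 = c \<and> (\<forall>i. interlace (\<gamma> i) (\<gamma> (Suc i))) \<and> (\<forall>i\<ge>r. \<gamma> i = ground (m + i))}"

definition chain_weight :: "nat \<Rightarrow> nat \<Rightarrow> nat \<Rightarrow> (nat \<Rightarrow> nat \<Rightarrow> int) \<Rightarrow> series" where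
  "chain_weight n m r \<gamma> = (\<Prod>i<r. \<Prod>k<n. row_weight (m + i) (\<gamma> (Suc i) k) (\<gamma> i k))"

lemma decreasing_gap:
  assumes "\<And>k. c (Suc k) < (c k :: int)"
  shows "c (k + l) + int l \<le> c k"
proof (induction l)
  case (Suc l)
  then show ?case using assms[of "k + l"] by simp
qed simp

lemma decreasing_le:
  assumes "\<And>k. c (Suc k) < (c k :: int)" "a \<le> b"
  shows "c b \<le> c a"
  using decreasing_gap[of c a "b - a", OF assms(1)] assms(2) by simp

lemma decreasing_less:
  assumes "\<And>k. c (Suc k) < (c k :: int)" "a < b"
  shows "c b < c a"
  using decreasing_gap[of c a "b - a", OF assms(1)] assms(2) by simp

lemma interlace_decreasing: "interlace c d \<Longrightarrow> c (Suc k) < c k" "interlace c d \<Longrightarrow> d (Suc k) < d k"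
  unfolding interlace_def by (meson order.strict_trans1 order.strict_trans2)+

text \<open>In the tail c k = c (k + 1) + 1, so the inequalities squeeze d k to c (k + 1).\<close>

lemma state_interlace:
  assumes "state n m c" "interlace c d"
  shows "state n (Suc m) d"
  unfolding state_def
proof (intro conjI allI impI)
  show "d (Suc k) < d k" for k using interlace_decreasing(2)[OF assms(2)] .
  fix k assume "n \<le> k"
  then have "c k = - int k - int m" "c (Suc k) = - int (Suc k) - int m"
    using assms(1) by (simp_all add: state_def ground_def)
  moreover have "c (Suc k) \<le> d k" "d k < c k" using assms(2) by (simp_all add: interlace_def)
  ultimately show "d k = ground (Suc m) k" by (simp add: ground_def)
qed

lemma interlace_ground: "interlace (ground m) (ground (Suc m))"
  by (simp add: interlace_def ground_def)

lemma state_lower: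
  assumes "state n m c"
  shows "ground m k \<le> c k"
proof -
  have "c (k + n) + int n \<le> c k" using assms by (intro decreasing_gap) (simp add: state_def)
  then show ?thesis using assms by (simp add: state_def ground_def)
qed

lemma chains_state:
  assumes "state n m c" "\<gamma> \<in> chains m r c"
  shows "state n (m + i) (\<gamma> i)"
proof (induction i)
  case 0
  then show ?case using assms by (simp add: chains_def)
next
  case (Suc i)
  then show ?case using assms state_interlace by (auto simp: chains_def)
qed

definition extend :: "nat \<Rightarrow> nat \<Rightarrow> (nat \<Rightarrow> int) \<Rightarrow> nat \<Rightarrow> int" where
  "extend n m d k = (if k < n then d k else ground m k)"

lemma interlace_extend:
  assumes "state n m c" "d \<in> PiE {..<n} (\<lambda>i. {c (Suc i)..<c i})"
  shows "interlace c (extend n (Suc m) d)"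
  unfolding interlace_def
proof
  fix k
  show "c (Suc k) \<le> extend n (Suc m) d k \<and> extend n (Suc m) d k < c k"
  proof (cases "k < n")
    case True
    then have "d k \<in> {c (Suc k)..<c k}" using PiE_mem[OF assms(2), of k] by simp
    then show ?thesis using True by (simp add: extend_def)
  next
    case False
    then show ?thesis using assms(1) by (simp add: extend_def state_def ground_def)
  qed
qed

text \<open>A chain splits into its first step and the rest. By \<open>state_interlace\<close> the
  first step is fixed by its first n columns, and \<open>extend\<close> restores its tail; the
  choices form exactly the index set of \<open>jt_det_step\<close>.\<close>

lemma chains_Suc_bij:
  assumes "state n m c"
  shows "bij_betw (\<lambda>\<gamma>. (restrict (\<gamma> 1) {..<n}, \<lambda>i. \<gamma> (Suc i))) (chains m (Suc r) c)
    (Sigma (PiE {..<n} (\<lambda>i. {c (Suc i)..<c i})) (\<lambda>d. chains (Suc m) r (extend n (Suc m) d)))"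
    (is "bij_betw ?f ?A ?B")
proof (rule bij_betw_byWitness[where f' = "\<lambda>(d, \<gamma>). case_nat c \<gamma>"])
  show "\<forall>\<gamma>\<in>?A. (\<lambda>(d, \<gamma>). case_nat c \<gamma>) (?f \<gamma>) = \<gamma>"
    by (auto simp: chains_def fun_eq_iff split: nat.splits)
  have r: "restrict (extend n k d) {..<n} = d" if "d \<in> PiE {..<n} S" for d k S
    using that by (auto simp: extend_def restrict_def PiE_def extensional_def)
  show "\<forall>p\<in>?B. ?f ((\<lambda>(d, \<gamma>). case_nat c \<gamma>) p) = p"
    by (auto simp: chains_def r)
  show "?f ` ?A \<subseteq> ?B"
  proof
    fix p assume "p \<in> ?f ` ?A"
    then obtain \<gamma> where \<gamma>: "\<gamma> \<in> ?A" "p = ?f \<gamma>" by blast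
    have i: "interlace c (\<gamma> 1)" using \<gamma> by (auto simp: chains_def)
    then have "state n (Suc m) (\<gamma> 1)" using assms state_interlace by blast
    then have "extend n (Suc m) (restrict (\<gamma> 1) {..<n}) = \<gamma> 1"
      by (auto simp: extend_def state_def)
    then show "p \<in> ?B" using \<gamma> i by (auto simp: chains_def interlace_def)
  qed
  show "(\<lambda>(d, \<gamma>). case_nat c \<gamma>) ` ?B \<subseteq> ?A"
  proof
    fix \<gamma> assume "\<gamma> \<in> (\<lambda>(d, \<gamma>). case_nat c \<gamma>) ` ?B"
    then obtain p where p: "p \<in> ?B" "\<gamma> = (\<lambda>(d, \<gamma>). case_nat c \<gamma>) p" by (rule imageE)
    obtain d \<delta> where "p = (d, \<delta>)" by (cases p)
    with p have d: "d \<in> PiE {..<n} (\<lambda>i. {c (Suc i)..<c i})"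
      and \<delta>: "\<delta> \<in> chains (Suc m) r (extend n (Suc m) d)" "\<gamma> = case_nat c \<delta>"
      by (simp_all only: mem_Sigma_iff prod.case)
    have "interlace (\<gamma> i) (\<gamma> (Suc i))" for i
      using interlace_extend[OF assms d] \<delta> by (cases i) (auto simp: chains_def)
    moreover have "\<gamma> i = ground (m + i)" if "i \<ge> Suc r" for i
      using that \<delta> by (cases i) (auto simp: chains_def)
    ultimately show "\<gamma> \<in> ?A" using \<delta> by (auto simp: chains_def)
  qed
qed

text \<open>L bounds the largest entry column of row 0. The bound drops by at least one per row, so
  this set contains all variables that can occur in the determinant left after M rows.\<close>

definition far :: "int \<Rightarrow> nat \<Rightarrow> var set" where
  "far L M = xset (- int M) \<union> aset (L - int M)"

lemma jt_det_cong: "(\<And>i. i < n \<Longrightarrow> c i = d i) \<Longrightarrow> jt_det n m c = jt_det n m d"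
  unfolding jt_det_def by (intro arg_cong[where f = det] eq_matI) auto

lemma chains_0:
  "chains m 0 c = (if c = ground m then {\<lambda>i. ground (m + i)} else {})"
  using interlace_ground by (auto simp: chains_def fun_eq_iff)

text \<open>One row is removed per induction step. For r = 0 all variables of the determinant are
  killed, and its value 1 or 0 records whether the empty chain has ended in the ground
  state.\<close>

lemma jt_det_chains:
  assumes "state n m c" "c 0 \<le> L - int m"
  shows "finite (chains m r c) \<and> kill (far L (m + r)) (jt_det n m c) =
    kill (far L (m + r)) (\<Sum>\<gamma>\<in>chains m r c. chain_weight n m r \<gamma>)"
  using assms
proof (induction r arbitrary: m c)
  case 0
  have dec: "c (Suc k) < c k" for k using 0 by (simp add: state_def)
  have "kill (far L m) (jt_det n m c) = (if \<forall>i<n. c i = - int i - int m then 1 else 0)"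
  proof (rule kill_jt_det)
    show "xset (- int m) \<subseteq> far L m" by (simp add: far_def)
    fix i assume "i < n"
    show "aset (c i - 1) \<subseteq> far L m"
      using decreasing_le[of c 0 i, OF dec] 0 by (auto simp: far_def)
    show "- int i - int m \<le> c i" using state_lower[OF 0(1), of i] by (simp add: ground_def)
    show "c i + int i \<le> c 0" using decreasing_gap[of c 0 i, OF dec] by simp
  qed
  also have "(\<forall>i<n. c i = - int i - int m) \<longleftrightarrow> c = ground m"
  proof
    assume l: "\<forall>i<n. c i = - int i - int m"
    show "c = ground m"
    proof
      fix k show "c k = ground m k"
        using l 0(1) by (cases "k < n") (auto simp: state_def ground_def)
    qed
  qed (simp add: ground_def)
  finally show ?case by (simp add: chains_0 chain_weight_def kill.hom_one kill.hom_zero)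
next
  case (Suc r)
  let ?K = "far L (m + Suc r)"
  let ?D = "PiE {..<n} (\<lambda>i. {c (Suc i)..<c i})"
  let ?e = "extend n (Suc m)"
  have dec: "c (Suc k) < c k" for k using Suc.prems by (simp add: state_def)
  have IH: "finite (chains (Suc m) r (?e d))"
    "kill ?K (jt_det n (Suc m) d) = kill ?K (\<Sum>\<gamma>\<in>chains (Suc m) r (?e d). chain_weight n (Suc m) r \<gamma>)"
    if d: "d \<in> ?D" for d
  proof -
    have i: "interlace c (?e d)" using interlace_extend[OF Suc.prems(1) d] .
    have "?e d 0 \<le> L - int (Suc m)"
      \<comment> \<open>Interlacing makes the largest column drop strictly, which keeps the bound
        \<open>L - int m\<close> valid for the next m.\<close>
      using i Suc.prems(2) unfolding interlace_def by (auto dest: spec[of _ 0])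
    note IH = Suc.IH[OF state_interlace[OF Suc.prems(1) i] this]
    have "jt_det n (Suc m) (?e d) = jt_det n (Suc m) d"
      by (rule jt_det_cong) (simp add: extend_def)
    then show "finite (chains (Suc m) r (?e d))"
      "kill ?K (jt_det n (Suc m) d) = kill ?K (\<Sum>\<gamma>\<in>chains (Suc m) r (?e d). chain_weight n (Suc m) r \<gamma>)"
      using IH by simp_all
  qed
  note bij = chains_Suc_bij[OF Suc.prems(1), of r]
  have finD: "finite ?D" by (rule finite_PiE) auto
  have fin: "finite (chains m (Suc r) c)"
    using bij_betw_finite[OF bij] finite_SigmaI[OF finD IH(1)] by simp
  have "kill ?K (jt_det n m c) = kill ?K (\<Sum>d\<in>?D. (\<Prod>i<n. row_weight m (d i) (c i)) * jt_det n (Suc m) d)"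
    using Suc.prems(1) by (subst jt_det_step[of n c m]) (auto simp: dec state_def ground_def)
  also have "\<dots> = (\<Sum>d\<in>?D. kill ?K (\<Prod>i<n. row_weight m (d i) (c i)) *
      kill ?K (\<Sum>\<gamma>\<in>chains (Suc m) r (?e d). chain_weight n (Suc m) r \<gamma>))"
    unfolding kill.hom_sum kill.hom_mult using IH(2) by (intro sum.cong refl) (simp add: kill.hom_sum)
  also have "\<dots> = kill ?K (\<Sum>d\<in>?D. \<Sum>\<gamma>\<in>chains (Suc m) r (?e d).
      (\<Prod>i<n. row_weight m (d i) (c i)) * chain_weight n (Suc m) r \<gamma>)"
    by (simp only: kill.hom_sum kill.hom_mult sum_distrib_left)
  also have "(\<Sum>d\<in>?D. \<Sum>\<gamma>\<in>chains (Suc m) r (?e d).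
      (\<Prod>i<n. row_weight m (d i) (c i)) * chain_weight n (Suc m) r \<gamma>) =
      (\<Sum>(d, \<gamma>)\<in>Sigma ?D (\<lambda>d. chains (Suc m) r (?e d)).
      (\<Prod>i<n. row_weight m (d i) (c i)) * chain_weight n (Suc m) r \<gamma>)"
    by (rule sum.Sigma) (use finD IH(1) in blast)+
  also have "\<dots> = (\<Sum>\<gamma>\<in>chains m (Suc r) c. chain_weight n m (Suc r) \<gamma>)"
  proof (subst sum.reindex_bij_betw[OF bij, symmetric], rule sum.cong[OF refl])
    fix \<gamma> assume "\<gamma> \<in> chains m (Suc r) c"
    then have "\<gamma> 0 = c" by (simp add: chains_def)
    then show "(case (restrict (\<gamma> 1) {..<n}, \<lambda>i. \<gamma> (Suc i)) of (d, \<gamma>) \<Rightarrow>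
        (\<Prod>i<n. row_weight m (d i) (c i)) * chain_weight n (Suc m) r \<gamma>) = chain_weight n m (Suc r) \<gamma>"
      unfolding chain_weight_def by (simp add: prod.lessThan_Suc_shift del: prod.lessThan_Suc)
  qed
  finally show ?case using fin by simp
qed

text \<open>The last row m that is not in the ground state satisfies m >= M. Some column \<gamma> m
  k there lies above \<open>ground m k\<close>, while the next row already has
  \<open>ground m k - 1\<close>. So column \<open>ground m k\<close> carries a factor in which both
  variables are killed.\<close>

lemma chain_weight_far:
  assumes "state n 0 c" "\<gamma> \<in> chains 0 r c" "\<gamma> \<notin> chains 0 M c" "L \<ge> 0"
  shows "kill (far L M) (chain_weight n 0 r \<gamma>) = 0"
proof -
  define s where "s = (LEAST s. \<forall>i\<ge>s. \<gamma> i = ground i)"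
  have ex: "\<forall>i\<ge>r. \<gamma> i = ground i" using assms(2) by (simp add: chains_def)
  have s: "\<forall>i\<ge>s. \<gamma> i = ground i" unfolding s_def by (rule LeastI[where P = "\<lambda>s. \<forall>i\<ge>s. \<gamma> i = ground i", OF ex])
  have sr: "s \<le> r" unfolding s_def by (rule Least_le[where P = "\<lambda>s. \<forall>i\<ge>s. \<gamma> i = ground i", OF ex])
  have "\<not> s \<le> M" using s assms(2,3) by (auto simp: chains_def)
  then obtain m where m: "s = Suc m" "M \<le> m" by (cases s) auto
  have "\<gamma> m \<noteq> ground m"
  proof
    assume "\<gamma> m = ground m"
    then have "\<forall>i\<ge>m. \<gamma> i = ground i" using s m(1) by (metis le_antisym not_less_eq_eq)
    then have "s \<le> m" unfolding s_def by (rule Least_le[where P = "\<lambda>s. \<forall>i\<ge>s. \<gamma> i = ground i"])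
    then show False using m(1) by simp
  qed
  then obtain k where k: "\<gamma> m k \<noteq> ground m k" by auto
  have st: "state n m (\<gamma> m)" using chains_state[OF assms(1,2), of m] by simp
  have kn: "k < n" using st k by (meson not_le_imp_less state_def)
  have gt: "\<gamma> m k > ground m k" using state_lower[OF st, of k] k by simp
  have d: "\<gamma> (Suc m) k = ground (Suc m) k" using s m(1) by simp
  let ?x = "xvar (- int m) - avar (ground m k)"
  have "kill (far L M) ?x = 0"
  proof (rule mps_eqI)
    fix t
    have "XVar (- int m) \<in> far L M" "AVar (ground m k) \<in> far L M"
      using m(2) assms(4) by (auto simp: far_def ground_def)
    then show "mps_coeff (kill (far L M) ?x) t = mps_coeff 0 t"
      by (auto simp: coeff_kill coeff_var)
  qed
  moreover have "ground m k \<in> {\<gamma> (Suc m) k<..<\<gamma> m k}" using gt d by (simp add: ground_def)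
  ultimately have "kill (far L M) (row_weight m (\<gamma> (Suc m) k) (\<gamma> m k)) = 0"
    unfolding row_weight_def kill.hom_prod by (intro prod_zero) auto
  then have "(\<Prod>k<n. kill (far L M) (row_weight m (\<gamma> (Suc m) k) (\<gamma> m k))) = 0"
    using kn by (intro prod_zero) auto
  then show ?thesis
    unfolding chain_weight_def kill.hom_prod using m(1) sr by (intro prod_zero) auto
qed

section \<open>Rows of a tiling\<close>

lemma decreasing_locate:
  assumes dec: "\<And>k. c (Suc k) < (c k :: int)"
  obtains "c 0 < j" | k where "j = c k" | k where "c (Suc k) < j" "j < c k"
proof (cases "c 0 < j")
  case False
  have "c (nat (c 0 - j)) \<le> j" using decreasing_gap[of c 0 "nat (c 0 - j)", OF dec] False by simp
  then have ex: "\<exists>k. c k \<le> j" by blast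
  define l where "l = (LEAST k. c k \<le> j)"
  have l: "c l \<le> j" unfolding l_def using ex by (rule LeastI_ex)
  show thesis
  proof (cases "c l = j")
    case True
    then show ?thesis using that(2) by metis
  next
    case neq: False
    have "l \<noteq> 0"
    proof
      assume "l = 0"
      then show False using l False neq by simp
    qed
    then obtain k where k: "l = Suc k" by (cases l) auto
    have "\<not> c k \<le> j" using not_less_Least[of k "\<lambda>k. c k \<le> j"] k by (simp add: l_def)
    then show ?thesis using that(3)[of k] l neq k by simp
  qed
qed (use that in blast)

text \<open>Write c k = d (f k); then f is strictly increasing, hence k <= f k.\<close>

lemma decreasing_range_le:
  assumes "\<And>k. c (Suc k) < (c k :: int)" "\<And>k. d (Suc k) < (d k :: int)" "range c \<subseteq> range d"
  shows "c k \<le> d k"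
proof -
  have "\<exists>l. c k = d l" for k using assms(3) by blast
  then obtain f where f: "\<And>k. c k = d (f k)" by metis
  have "f k < f (Suc k)" for k
    using assms(1)[of k] decreasing_le[of d "f (Suc k)" "f k", OF assms(2)] unfolding f by (cases "f (Suc k) \<le> f k") auto
  then have "k \<le> f k" by (meson strict_mono_Suc_iff strict_mono_imp_increasing)
  then show ?thesis unfolding f by (rule decreasing_le[of d, OF assms(2)])
qed

lemma decreasing_range_eq:
  assumes "\<And>k. c (Suc k) < (c k :: int)" "\<And>k. d (Suc k) < (d k :: int)" "range c = range d"
  shows "c = d"
  using decreasing_range_le[of c d, OF assms(1,2)] decreasing_range_le[of d c, OF assms(2,1)] assms(3)
  by (intro ext order_antisym) auto

lemma card_decreasing_ge:
  assumes "\<And>k. c (Suc k) < (c k :: int)"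
  shows "card {x \<in> range c. x \<ge> c k} = Suc k"
proof -
  have iff: "c a \<ge> c b \<longleftrightarrow> a \<le> b" for a b
    using decreasing_le[of c a b, OF assms] decreasing_less[of c b a, OF assms] by fastforce
  have inj: "inj c" by (rule injI) (metis iff order_antisym order_refl)
  have "{x \<in> range c. x \<ge> c k} = c ` {..k}" using iff by auto
  then show ?thesis by (simp add: card_image inj_on_subset[OF inj])
qed

text \<open>The arguments are the south, north and west edges. They determine a tile other than a
  crossing, the west edge deciding only when neither south nor north is met.\<close>

definition tile_of :: "bool \<Rightarrow> bool \<Rightarrow> bool \<Rightarrow> tile" where
  "tile_of s n w = (if s then (if n then Vert else SE) else if n then NW else if w then Horiz else Empty)"

lemma tile_of_edges:
  "t \<noteq> Crossing \<Longrightarrow> tile_of (South \<in> edges t) (North \<in> edges t) (West \<in> edges t) = t"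
  by (cases t) (auto simp: tile_of_def)

text \<open>A pipe crosses the west edge of column j if it is the first one on its way east, or the
  one that entered at c (k + 1) and has not yet gone beyond its exit d k.\<close>

definition west :: "(nat \<Rightarrow> int) \<Rightarrow> (nat \<Rightarrow> int) \<Rightarrow> int \<Rightarrow> bool" where
  "west c d j \<longleftrightarrow> c 0 < j \<or> (\<exists>k. c (Suc k) < j \<and> j \<le> d k)"

definition row_tile :: "(nat \<Rightarrow> int) \<Rightarrow> (nat \<Rightarrow> int) \<Rightarrow> int \<Rightarrow> tile" where
  "row_tile c d j = tile_of (j \<in> range c) (j \<in> range d) (west c d j)"

context
  fixes c d :: "nat \<Rightarrow> int"
  assumes il: "interlace c d"
begin

private lemma le: "c (Suc k) \<le> d k" and less: "d k < c k"
  using il by (auto simp: interlace_def)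

private lemma c_le: "a \<le> b \<Longrightarrow> c b \<le> c a" and d_le: "a \<le> b \<Longrightarrow> d b \<le> d a"
  using decreasing_le[of c] decreasing_le[of d] interlace_decreasing[OF il] by auto

private lemma c_less: "c a < c b \<Longrightarrow> b < a" and d_less: "d a < d b \<Longrightarrow> b < a"
  using c_le[of a b] d_le[of a b] by (auto simp: not_less[symmetric])

text \<open>No pipe arrives from the west where another one enters from the south, since d l < c l.
  This is what excludes crossings.\<close>

lemma west_south: "west c d (c k) \<Longrightarrow> False"
  unfolding west_def
proof (elim disjE exE conjE)
  assume "c 0 < c k"
  then show False using c_le[of 0 k] by simp
next
  fix l assume "c (Suc l) < c k" "c k \<le> d l"
  then have "k < Suc l" "c k < c l" using c_less less[of l] by auto
  then show False using c_less[of k l] by simp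
qed

lemma west_north: "west c d (d k + 1) \<Longrightarrow> False"
  unfolding west_def
proof (elim disjE exE conjE)
  assume "c 0 < d k + 1"
  then show False using c_le[of 0 k] less[of k] by simp
next
  fix l assume l: "c (Suc l) < d k + 1" "d k + 1 \<le> d l"
  then have "d k < d l" by simp
  then have "l < k" by (rule d_less)
  then have "c k \<le> c (Suc l)" by (intro c_le) simp
  then show False using l less[of k] by simp
qed

lemma row_tile_South: "South \<in> edges (row_tile c d j) \<longleftrightarrow> j \<in> range c"
  and row_tile_North: "North \<in> edges (row_tile c d j) \<longleftrightarrow> j \<in> range d"
  by (auto simp: row_tile_def tile_of_def)

lemma row_tile_West: "West \<in> edges (row_tile c d j) \<longleftrightarrow> west c d j"
proof (cases "j \<in> range c")
  case True
  then show ?thesis using west_south by (auto simp: row_tile_def tile_of_def)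
next
  case s: False
  show ?thesis
  proof (cases "j \<in> range d")
    case True
    then obtain k where k: "j = d k" by auto
    then have "c (Suc k) < j" using le[of k] s by (metis order_le_less rangeI)
    then have "west c d j" using k by (auto simp: west_def)
    then show ?thesis using True s by (simp add: row_tile_def tile_of_def)
  qed (use s in \<open>simp add: row_tile_def tile_of_def\<close>)
qed

lemma row_tile_East: "East \<in> edges (row_tile c d j) \<longleftrightarrow> west c d (j + 1)"
proof (cases "j \<in> range d")
  case True
  then have "\<not> west c d (j + 1)" using west_north by auto
  then show ?thesis using True by (simp add: row_tile_def tile_of_def)
next
  case n: False
  show ?thesis
  proof (cases "j \<in> range c")
    case True
    then obtain k where k: "j = c k" by auto
    have "west c d (j + 1)"
    proof (cases k)
      case 0
      then show ?thesis using k by (simp add: west_def)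
    next
      case (Suc l)
      then have "j < d l" using le[of l] k n by (metis order_le_less rangeI)
      then show ?thesis using k Suc by (auto simp: west_def intro!: exI[of _ l])
    qed
    then show ?thesis using n True by (simp add: row_tile_def tile_of_def)
  next
    case s: False
    have "west c d (j + 1) \<longleftrightarrow> west c d j"
    proof
      assume "west c d (j + 1)"
      then consider "c 0 < j + 1" | k where "c (Suc k) < j + 1" "j + 1 \<le> d k" by (auto simp: west_def)
      then show "west c d j"
      proof cases
        case 1
        then have "c 0 < j" using s by (metis order_le_less rangeI zless_add1_eq)
        then show ?thesis by (simp add: west_def)
      next
        case (2 k)
        then have "c (Suc k) < j" using s by (metis rangeI zless_add1_eq)
        then show ?thesis using 2 by (auto simp: west_def)
      qed
    next
      assume "west c d j"
      then consider "c 0 < j" | k where "c (Suc k) < j" "j \<le> d k" by (auto simp: west_def)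
      then show "west c d (j + 1)"
      proof cases
        case (2 k)
        then have "j < d k" using n by (metis order_le_less rangeI)
        then show ?thesis using 2 by (auto simp: west_def intro!: exI[of _ k])
      qed (simp add: west_def)
    qed
    then show ?thesis using n s by (simp add: row_tile_def tile_of_def)
  qed
qed

text \<open>Once the pipe from c (k + 1) has gone north at d k, nothing is in the row until the next
  entry c k. This is the source of \<open>row_weight\<close>.\<close>

lemma row_tile_Empty: "row_tile c d j = Empty \<longleftrightarrow> (\<exists>k. d k < j \<and> j < c k)"
proof
  assume "row_tile c d j = Empty"
  then have j: "j \<notin> range c" "\<not> west c d j" by (auto simp: row_tile_def tile_of_def split: if_splits)
  show "\<exists>k. d k < j \<and> j < c k"
    by (rule decreasing_locate[of c j])
       (use interlace_decreasing[OF il] j in \<open>auto simp: west_def not_le\<close>)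
next
  assume "\<exists>k. d k < j \<and> j < c k"
  then obtain k where k: "d k < j" "j < c k" by auto
  have "j \<noteq> c l" for l
  proof
    assume "j = c l"
    then have "k < l" using k c_less by simp
    then have "c l \<le> c (Suc k)" by (intro c_le) simp
    then show False using k le[of k] \<open>j = c l\<close> by simp
  qed
  moreover have z: "l < k \<Longrightarrow> j < d l" for l
    using c_le[of "Suc l" k] le[of l] k by simp
  moreover have "j \<noteq> d l" for l
  proof
    assume j: "j = d l"
    then have "l < k" using k d_less by simp
    then show False using z j by blast
  qed
  moreover have "\<not> west c d j"
    unfolding west_def
  proof (intro notI, elim disjE exE conjE)
    assume "c 0 < j"
    then show False using c_le[of 0 k] k by simp
  next
    fix l assume l: "c (Suc l) < j" "j \<le> d l"
    then have "l < k" using k d_less[of k l] by simp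
    then have "c k \<le> c (Suc l)" by (intro c_le) simp
    then show False using l k by simp
  qed
  ultimately show "row_tile c d j = Empty" by (auto simp: row_tile_def tile_of_def)
qed

lemma row_tile_not_Crossing: "row_tile c d j \<noteq> Crossing"
  by (simp add: row_tile_def tile_of_def)

lemma row_tile_run: "c (Suc k) < j \<Longrightarrow> j < d k \<Longrightarrow> row_tile c d j = Horiz"
proof -
  assume j: "c (Suc k) < j" "j < d k"
  have 1: "west c d j" using j by (auto simp: west_def)
  have 2: "west c d (j + 1)" using j by (auto simp: west_def intro!: exI[of _ k])
  have "j \<notin> range c" "j \<notin> range d" using west_south west_north 1 2 by auto
  then show ?thesis using 1 by (simp add: row_tile_def tile_of_def)
qed

lemma row_tile_turn: "c (Suc k) < d k \<Longrightarrow> row_tile c d (d k) = NW"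
proof -
  assume j: "c (Suc k) < d k"
  have 1: "west c d (d k)" using j by (auto simp: west_def)
  have "d k \<notin> range c" using west_south 1 by auto
  then show ?thesis by (simp add: row_tile_def tile_of_def)
qed

lemma row_tile_start: "row_tile c d (c (Suc k)) = (if c (Suc k) = d k then Vert else SE)"
proof (cases "c (Suc k) = d k")
  case True
  then have "c (Suc k) \<in> range d" by (metis rangeI)
  moreover have "c (Suc k) \<in> range c" by blast
  ultimately show ?thesis using True by (simp add: row_tile_def tile_of_def)
next
  case False
  then have "west c d (c (Suc k) + 1)" using le[of k] by (auto simp: west_def intro!: exI[of _ k])
  then have "c (Suc k) \<notin> range d" using west_north by auto
  then show ?thesis using False by (auto simp: row_tile_def tile_of_def)
qed

lemma row_tile_exit: "row_tile c d (c 0) = SE" "j > c 0 \<Longrightarrow> row_tile c d j = Horiz"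
proof -
  have n: "j \<notin> range d" if "j \<ge> c 0" for j
  proof
    assume "j \<in> range d"
    then obtain k where "j = d k" by auto
    then show False using that less[of k] c_le[of 0 k] by simp
  qed
  show "row_tile c d (c 0) = SE" using n[of "c 0"] by (auto simp: row_tile_def tile_of_def)
  assume j: "j > c 0"
  have "j \<notin> range c"
  proof
    assume "j \<in> range c"
    then obtain k where "j = c k" by auto
    then show False using j c_le[of 0 k] by simp
  qed
  then show "row_tile c d j = Horiz" using n[of j] j by (simp add: row_tile_def tile_of_def west_def)
qed

end


section \<open>The tiling of a chain\<close>

definition tiling_of :: "(nat \<Rightarrow> nat \<Rightarrow> int) \<Rightarrow> int \<times> int \<Rightarrow> tile" where
  "tiling_of \<gamma> = (\<lambda>(i, j). if i \<le> 0 then row_tile (\<gamma> (nat (- i))) (\<gamma> (Suc (nat (- i)))) j else undefined)"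

lemma tiling_of_row: "tiling_of \<gamma> (- int m, j) = row_tile (\<gamma> m) (\<gamma> (Suc m)) j"
  by (simp add: tiling_of_def)

lemma nonpos_row: "i \<le> 0 \<Longrightarrow> \<exists>m. i = - int m"
  by (intro exI[of _ "nat (- i)"]) simp

section \<open>Following the pipes of the tiling of a chain\<close>

definition reaches :: "(int \<times> int \<Rightarrow> tile) \<Rightarrow> (int \<times> int) \<times> side \<Rightarrow> (int \<times> int) \<times> side \<Rightarrow> bool" where
  "reaches P s t \<longleftrightarrow> (\<exists>n. (advance P ^^ n) s = t)"

lemma reaches_refl: "reaches P s s"
  unfolding reaches_def by (intro exI[of _ 0]) simp

lemma reaches_step: "reaches P (advance P s) t \<Longrightarrow> reaches P s t"
  unfolding reaches_def by (metis funpow_Suc_right o_apply)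

lemma reaches_trans: "reaches P s t \<Longrightarrow> reaches P t u \<Longrightarrow> reaches P s u"
  unfolding reaches_def by (metis funpow_add o_apply)

context
  fixes \<gamma> :: "nat \<Rightarrow> nat \<Rightarrow> int"
  assumes il: "\<And>i. interlace (\<gamma> i) (\<gamma> (Suc i))"
begin

private abbreviation "P \<equiv> tiling_of \<gamma>"

lemma tiling_tiling_of: "tiling P"
  unfolding tiling_def
proof (intro conjI)
  show "P \<in> halfplane \<rightarrow>\<^sub>E UNIV" by (auto simp: tiling_of_def halfplane_def split: if_splits)
  show "\<forall>(i, j)\<in>halfplane. East \<in> edges (P (i, j)) \<longleftrightarrow> West \<in> edges (P (i, j + 1))"
  proof safe
    fix i j assume "(i, j) \<in> halfplane"
    then obtain m where m: "i = - int m" using nonpos_row by (auto simp: halfplane_def)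
    show "East \<in> edges (P (i, j)) \<Longrightarrow> West \<in> edges (P (i, j + 1))"
      "West \<in> edges (P (i, j + 1)) \<Longrightarrow> East \<in> edges (P (i, j))"
      unfolding m tiling_of_row row_tile_East[OF il] row_tile_West[OF il] by auto
  qed
  show "\<forall>(i, j)\<in>halfplane. North \<in> edges (P (i, j)) \<longleftrightarrow> South \<in> edges (P (i - 1, j))"
  proof safe
    fix i j assume "(i, j) \<in> halfplane"
    then obtain m where m: "i = - int m" using nonpos_row by (auto simp: halfplane_def)
    have m1: "- int m - 1 = - int (Suc m)" by simp
    show "North \<in> edges (P (i, j)) \<Longrightarrow> South \<in> edges (P (i - 1, j))"
      "South \<in> edges (P (i - 1, j)) \<Longrightarrow> North \<in> edges (P (i, j))"
      unfolding m m1 tiling_of_row row_tile_North[OF il] row_tile_South[OF il] by auto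
  qed
qed

lemma tiling_of_not_Crossing: "s \<in> halfplane \<Longrightarrow> P s \<noteq> Crossing"
  by (cases s) (auto simp: tiling_of_def halfplane_def row_tile_not_Crossing[OF il])

lemma entry_columns_tiling_of: "entry_columns P = range (\<gamma> 0)"
  using row_tile_South[OF il[of 0]] tiling_of_row[of \<gamma> 0] by (auto simp: entry_columns_def)

lemma reaches_row_west:
  assumes "\<gamma> m (Suc k) < j" "j \<le> \<gamma> (Suc m) k"
  shows "reaches P ((- int m, j), West) ((- int (Suc m), \<gamma> (Suc m) k), South)"
  using assms
proof (induction "nat (\<gamma> (Suc m) k - j)" arbitrary: j)
  case 0
  then have "j = \<gamma> (Suc m) k" by simp
  then have "advance P ((- int m, j), West) = ((- int (Suc m), \<gamma> (Suc m) k), South)"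
    using row_tile_turn[OF il, of m k] 0 by (simp add: tiling_of_row)
  then show ?case using reaches_step reaches_refl by metis
next
  case (Suc l)
  then have "j < \<gamma> (Suc m) k" by simp
  then have "advance P ((- int m, j), West) = ((- int m, j + 1), West)"
    using row_tile_run[OF il, of m k j] Suc by (simp add: tiling_of_row)
  moreover have "reaches P ((- int m, j + 1), West) ((- int (Suc m), \<gamma> (Suc m) k), South)"
    by (rule Suc.hyps(1)) (use Suc in auto)
  ultimately show ?case using reaches_step by metis
qed

lemma reaches_row:
  "reaches P ((- int m, \<gamma> m (Suc k)), South) ((- int (Suc m), \<gamma> (Suc m) k), South)"
proof (cases "\<gamma> m (Suc k) = \<gamma> (Suc m) k")
  case True
  then have "advance P ((- int m, \<gamma> m (Suc k)), South) = ((- int (Suc m), \<gamma> (Suc m) k), South)"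
    using row_tile_start[OF il, of m k] by (simp add: tiling_of_row)
  then show ?thesis using reaches_step reaches_refl by metis
next
  case False
  then have adv: "advance P ((- int m, \<gamma> m (Suc k)), South) = ((- int m, \<gamma> m (Suc k) + 1), West)"
    using row_tile_start[OF il, of m k] by (simp add: tiling_of_row)
  have "\<gamma> m (Suc k) + 1 \<le> \<gamma> (Suc m) k"
    using False il[of m] unfolding interlace_def by (metis order_le_less zless_imp_add1_zle)
  then have "reaches P (advance P ((- int m, \<gamma> m (Suc k)), South)) ((- int (Suc m), \<gamma> (Suc m) k), South)"
    unfolding adv by (intro reaches_row_west) simp_all
  then show ?thesis by (rule reaches_step)
qed

lemma reaches_rows:
  "reaches P ((- int m, \<gamma> m k), South) ((- int (m + k), \<gamma> (m + k) 0), South)"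
proof (induction k arbitrary: m)
  case (Suc k)
  then show ?case using reaches_trans[OF reaches_row Suc[of "Suc m"]] by simp
qed (simp add: reaches_refl)

text \<open>In each row the first pipe leaves and every other pipe moves up one position. So pipe k
  is the first one in row -k, where the SE elbow at \<gamma> k 0 costs one step before the run
  east.\<close>

lemma heads_east_tiling_of: "heads_east P (\<gamma> 0 k) (- int k)"
proof -
  obtain n where n: "(advance P ^^ n) ((0, \<gamma> 0 k), South) = ((- int k, \<gamma> k 0), South)"
    using reaches_rows[of 0 k] by (auto simp: reaches_def)
  have "(advance P ^^ (Suc n + l)) ((0, \<gamma> 0 k), South) = ((- int k, \<gamma> k 0 + 1 + int l), West)" for l
  proof (induction l)
    case 0
    show ?case using n row_tile_exit(1)[OF il, of k] by (simp add: tiling_of_row)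
  next
    case (Suc l)
    then show ?case using row_tile_exit(2)[OF il, of k "\<gamma> k 0 + 1 + int l"] by (simp add: tiling_of_row)
  qed
  then show ?thesis unfolding heads_east_def pipe_def by blast
qed

lemma card_entry_columns:
  assumes "c \<in> entry_columns P" "card {c' \<in> entry_columns P. c' \<ge> c} = i"
  shows "c = \<gamma> 0 (i - 1) \<and> i \<ge> 1"
proof -
  have dec: "\<gamma> 0 (Suc k) < \<gamma> 0 k" for k using interlace_decreasing(1)[OF il[of 0]] .
  obtain k where k: "c = \<gamma> 0 k" using assms(1) by (auto simp: entry_columns_tiling_of)
  then have "i = Suc k"
    using assms(2) card_decreasing_ge[of "\<gamma> 0" k, OF dec] by (simp add: entry_columns_tiling_of)
  then show ?thesis using k by simp
qed

text \<open>With M = -N >= r + n, row N is in the ground state and yields corner and arm. On the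
  leg, rows with index at least r are ground; in a lower row l < r the pipe has position M - l >= n,
  which lies in the ground tail of the state.\<close>

lemma is_hook_tiling_of:
  assumes ground: "\<And>i. i \<ge> r \<Longrightarrow> \<gamma> i = ground i" and st: "\<And>i. state n i (\<gamma> i)"
    and N: "N \<le> - int (r + n)"
  shows "is_hook P N"
proof -
  have neg: "N \<le> 0" using N by simp
  define M where "M = nat (- N)"
  have M: "N = - int M" "r \<le> M" using N by (simp_all add: M_def)
  have row: "\<gamma> M = ground M" "\<gamma> (Suc M) = ground (Suc M)" using ground M by simp_all
  have g0: "ground M 0 = - int M" by (simp add: ground_def)
  have corner: "P (N, N) = SE"
    using row_tile_exit(1)[OF il, of M] row by (simp add: M(1) tiling_of_row g0)
  have arm: "P (N, j) = Horiz" if "j > N" for j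
    using row_tile_exit(2)[OF il, of M j] row that by (simp add: M(1) tiling_of_row g0)
  have leg: "P (i, N) = Vert" if i: "N < i" "i \<le> 0" for i
  proof -
    obtain m where m: "i = - int m" using nonpos_row i by blast
    have mM: "m < M" using i m M by simp
    have s: "\<gamma> m (M - m) = N" "\<gamma> (Suc m) (M - Suc m) = N"
    proof -
      have *: "\<gamma> l (M - l) = N" if "l \<le> M" for l
      proof (cases "r \<le> l")
        case True
        then show ?thesis using ground that M by (simp add: ground_def)
      next
        case False
        then have "n \<le> M - l" using N M by simp
        then show ?thesis using st[of l] that M by (simp add: state_def ground_def)
      qed
      show "\<gamma> m (M - m) = N" "\<gamma> (Suc m) (M - Suc m) = N" using * mM by simp_all
    qed
    then have "N \<in> range (\<gamma> m)" "N \<in> range (\<gamma> (Suc m))" by (metis rangeI)+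
    then show ?thesis by (simp add: m tiling_of_row row_tile_def tile_of_def)
  qed
  show ?thesis unfolding is_hook_def using corner arm leg by blast
qed

text \<open>Empty squares correspond to a row i, a position k and a column in the k-th gap. Gaps of
  one row are disjoint because c (k + 1) <= d k, and nonempty gaps occur only for i < r and k < n,
  so the finite product misses nothing.\<close>

lemma weight_tiling_of:
  assumes ground: "\<And>i. i \<ge> r \<Longrightarrow> \<gamma> i = ground i" and st: "\<And>i. state n i (\<gamma> i)"
  shows "weight P = chain_weight n 0 r \<gamma>"
proof -
  let ?R = "\<lambda>i k. {\<gamma> (Suc i) k<..<\<gamma> i k}"
  let ?S = "Sigma ({..<r} \<times> {..<n}) (\<lambda>(i, k). ?R i k)"
  let ?f = "\<lambda>((i, k), j). (- int i, j)"
  have dec: "\<gamma> i (Suc k) < \<gamma> i k" for i k using interlace_decreasing(1)[OF il[of i]] .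
  have small: "i < r \<and> k < n" if "\<gamma> (Suc i) k < j" "j < \<gamma> i k" for i k j
  proof (rule conjI; rule ccontr)
    assume "\<not> i < r"
    then show False using that ground by (simp add: ground_def)
  next
    assume "\<not> k < n"
    then show False using that st[of i] st[of "Suc i"] by (simp add: state_def ground_def)
  qed
  have inj: "inj_on ?f ?S"
  proof (rule inj_onI)
    fix p q assume pq: "p \<in> ?S" "q \<in> ?S" "?f p = ?f q"
    obtain i k j i' k' j' where p: "p = ((i, k), j)" "q = ((i', k'), j')" by (metis surj_pair)
    have a: "j \<in> ?R i k" "j' \<in> ?R i' k'" and ii: "i = i'" "j = j'"
      using pq by (auto simp: p)
    have "k = k'"
    proof (rule ccontr)
      have no: False if "a < b" "\<gamma> (Suc i) a < j" "j < \<gamma> i b" for a b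
      proof -
        have "\<gamma> i b \<le> \<gamma> i (Suc a)" using that(1) by (intro decreasing_le[of "\<gamma> i", OF dec]) simp
        also have "\<dots> \<le> \<gamma> (Suc i) a" using il[of i] by (simp add: interlace_def)
        finally show False using that by simp
      qed
      assume "k \<noteq> k'"
      then consider "k < k'" | "k' < k" by linarith
      then show False using no a ii by cases auto
    qed
    then show "p = q" using ii by (simp add: p)
  qed
  have img: "{(i, j). (i, j) \<in> halfplane \<and> P (i, j) = Empty} = ?f ` ?S"
  proof
    show "{(i, j). (i, j) \<in> halfplane \<and> P (i, j) = Empty} \<subseteq> ?f ` ?S"
    proof clarify
      fix i j assume ij: "(i, j) \<in> halfplane" "P (i, j) = Empty"
      then obtain m where m: "i = - int m" using nonpos_row by (auto simp: halfplane_def)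
      then obtain k where k: "\<gamma> (Suc m) k < j" "j < \<gamma> m k"
        using ij(2) row_tile_Empty[OF il, of m j] by (auto simp: tiling_of_row)
      show "(i, j) \<in> ?f ` ?S"
        by (rule image_eqI[of _ _ "((m, k), j)"]) (use small[OF k] k m in auto)
    qed
    show "?f ` ?S \<subseteq> {(i, j). (i, j) \<in> halfplane \<and> P (i, j) = Empty}"
      using row_tile_Empty[OF il] by (auto simp: halfplane_def tiling_of_row)
  qed
  have "weight P = (\<Prod>s\<in>?S. case ?f s of (i, j) \<Rightarrow> xvar i - avar j)"
    unfolding weight_def img by (rule prod.reindex[OF inj, unfolded o_def])
  also have "\<dots> = (\<Prod>p\<in>{..<r} \<times> {..<n}. \<Prod>j\<in>(case p of (i, k) \<Rightarrow> ?R i k).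
      case ?f (p, j) of (i, j) \<Rightarrow> xvar i - avar j)"
    by (subst prod.Sigma) (auto simp: split_def)
  also have "\<dots> = (\<Prod>(i, k)\<in>{..<r} \<times> {..<n}. row_weight i (\<gamma> (Suc i) k) (\<gamma> i k))"
    by (intro prod.cong refl) (auto simp: row_weight_def)
  also have "\<dots> = chain_weight n 0 r \<gamma>"
    by (simp add: chain_weight_def prod.cartesian_product)
  finally show ?thesis .
qed

end

lemma tiling_of_inj:
  assumes "\<And>i. interlace (\<gamma> i) (\<gamma> (Suc i))" "\<And>i. interlace (\<delta> i) (\<delta> (Suc i))"
    and "tiling_of \<gamma> = tiling_of \<delta>"
  shows "\<gamma> = \<delta>"
proof
  fix m
  have "row_tile (\<gamma> m) (\<gamma> (Suc m)) j = row_tile (\<delta> m) (\<delta> (Suc m)) j" for j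
    using assms(3) by (metis tiling_of_row)
  then have r: "range (\<gamma> m) = range (\<delta> m)"
    using row_tile_South[OF assms(1)[of m]] row_tile_South[OF assms(2)[of m]] by (metis subsetI subset_antisym)
  have dec: "\<gamma> m (Suc k) < \<gamma> m k" "\<delta> m (Suc k) < \<delta> m k" for k
    using interlace_decreasing(1)[OF assms(1)[of m]] interlace_decreasing(1)[OF assms(2)[of m]] .
  show "\<gamma> m = \<delta> m"
    by (rule decreasing_range_eq[of "\<gamma> m" "\<delta> m", OF dec r])
qed

section \<open>The chain of a tiling\<close>

lemma row_from_left:
  fixes t :: "int \<Rightarrow> tile"
  assumes nc: "\<And>j. t j \<noteq> Crossing"
    and match: "\<And>j. East \<in> edges (t j) \<longleftrightarrow> West \<in> edges (t (j + 1))"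
  shows "South \<in> edges (t j) \<Longrightarrow> West \<notin> edges (t j)"
    and "South \<in> edges (t j) \<or> West \<in> edges (t j) \<Longrightarrow> West \<in> edges (t (j + 1)) \<longleftrightarrow> North \<notin> edges (t j)"
    and "South \<notin> edges (t j) \<Longrightarrow> West \<notin> edges (t j) \<Longrightarrow> North \<notin> edges (t j) \<and> West \<notin> edges (t (j + 1))"
  using nc[of j] match[of j] by (cases "t j"; simp)+

text \<open>The pipe that enters at e cannot reach b from the west, since a tile with south and west
  edges would be a crossing. So it turns north at some d before b, and with no entry in between
  nothing else runs in the row up to b.\<close>

lemma row_gap:
  fixes t :: "int \<Rightarrow> tile"
  assumes nc: "\<And>j. t j \<noteq> Crossing"
    and match: "\<And>j. East \<in> edges (t j) \<longleftrightarrow> West \<in> edges (t (j + 1))"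
    and ends: "South \<in> edges (t e)" "South \<in> edges (t b)" "e < b"
    and gap: "\<And>j. e < j \<Longrightarrow> j < b \<Longrightarrow> South \<notin> edges (t j)"
  shows "\<exists>d\<ge>e. d < b \<and> (\<forall>j. e \<le> j \<and> j < b \<longrightarrow> (North \<in> edges (t j) \<longleftrightarrow> j = d))
    \<and> (\<forall>j. e < j \<and> j \<le> b \<longrightarrow> (West \<in> edges (t j) \<longleftrightarrow> j \<le> d))"
proof -
  note r = row_from_left[of t, OF nc match]
  have run: "West \<in> edges (t j)" if "\<And>i. e \<le> i \<Longrightarrow> i < j \<Longrightarrow> North \<notin> edges (t i)" "e + 1 \<le> j" "j \<le> b" for j
    using that(2,1,3)
  proof (induction j rule: int_ge_induct)
    case base
    then show ?case using r(2)[of e] ends by auto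
  next
    case (step j)
    then have "West \<in> edges (t j)" by auto
    then show ?case using r(2)[of j] step by auto
  qed
  have "\<exists>d. e \<le> d \<and> d < b \<and> North \<in> edges (t d)"
  proof (rule ccontr)
    assume "\<not> ?thesis"
    then have "West \<in> edges (t b)" using ends by (intro run) auto
    then show False using r(1)[of b] ends by blast
  qed
  then have ex: "\<exists>n. e + int n < b \<and> North \<in> edges (t (e + int n))"
    by (metis add.commute diff_add_cancel zle_iff_zadd)
  \<comment> \<open>The first square of the gap with a north edge; up to it the pipe runs
    horizontally.\<close>
  define n where "n = (LEAST n. e + int n < b \<and> North \<in> edges (t (e + int n)))"
  define d where "d = e + int n"
  have d: "e \<le> d" "d < b" "North \<in> edges (t d)"
    using LeastI_ex[OF ex] unfolding d_def n_def by auto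
  have before: "North \<notin> edges (t i)" if "e \<le> i" "i < d" for i
  proof -
    have "nat (i - e) < n" using that by (simp add: d_def)
    then have "\<not> (e + int (nat (i - e)) < b \<and> North \<in> edges (t (e + int (nat (i - e)))))"
      unfolding n_def by (rule not_less_Least)
    then show ?thesis using that d by simp
  qed
  have W: "West \<in> edges (t j)" if "e < j" "j \<le> d" for j
    using that before d by (intro run) auto
  have nW: "West \<notin> edges (t j)" if "d + 1 \<le> j" "j \<le> b" for j
    using that
  proof (induction j rule: int_ge_induct)
    case base
    have "South \<in> edges (t d) \<or> West \<in> edges (t d)"
      using W[of d] d ends by (cases "e = d") auto
    then show ?case using r(2)[of d] d by auto
  next
    case (step j)
    then have "West \<notin> edges (t j)" by auto
    then show ?case using r(3)[of j] gap[of j] step d by auto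
  qed
  have after: "North \<notin> edges (t j)" if "d < j" "j < b" for j
    using r(3)[of j] gap[of j] nW[of j] that d by auto
  have N: "North \<in> edges (t j) \<longleftrightarrow> j = d" if "e \<le> j" "j < b" for j
    using that before[of j] after[of j] d by (cases j d rule: linorder_cases) auto
  have W': "West \<in> edges (t j) \<longleftrightarrow> j \<le> d" if "e < j" "j \<le> b" for j
    using that W[of j] nW[of j] by (cases "j \<le> d") auto
  show ?thesis using d N W' by blast
qed

text \<open>Each gap between consecutive entries yields one exit. The assumption
  \<open>right\<close> decides what happens east of c 0: if a west edge were free there, all later
  ones would be free too, so the first pipe must leave to the east.\<close>

lemma row_tile_exists:
  fixes t :: "int \<Rightarrow> tile"
  assumes nc: "\<And>j. t j \<noteq> Crossing"
    and match: "\<And>j. East \<in> edges (t j) \<longleftrightarrow> West \<in> edges (t (j + 1))"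
    and dec: "\<And>k. c (Suc k) < c k"
    and south: "\<And>j. South \<in> edges (t j) \<longleftrightarrow> j \<in> range c"
    and right: "\<And>j. j \<ge> b \<Longrightarrow> West \<in> edges (t j)"
  shows "\<exists>d. interlace c d \<and> t = row_tile c d"
proof -
  note r = row_from_left[of t, OF nc match]
  have gap: "South \<notin> edges (t j)" if "c (Suc k) < j" "j < c k" for j k
  proof
    assume "South \<in> edges (t j)"
    then obtain l where "j = c l" using south by auto
    then have "l < Suc k" "k < l"
      using that decreasing_le[of c "Suc k" l, OF dec] decreasing_le[of c l k, OF dec] by fastforce+
    then show False by simp
  qed
  have "\<exists>d\<ge>c (Suc k). d < c k \<and> (\<forall>j. c (Suc k) \<le> j \<and> j < c k \<longrightarrow> (North \<in> edges (t j) \<longleftrightarrow> j = d))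
    \<and> (\<forall>j. c (Suc k) < j \<and> j \<le> c k \<longrightarrow> (West \<in> edges (t j) \<longleftrightarrow> j \<le> d))" for k
    by (rule row_gap[of t, OF nc match]) (use dec south gap in auto)
  then obtain d where d: "\<And>k. c (Suc k) \<le> d k" "\<And>k. d k < c k"
    and N: "\<And>k j. c (Suc k) \<le> j \<Longrightarrow> j < c k \<Longrightarrow> North \<in> edges (t j) \<longleftrightarrow> j = d k"
    and W: "\<And>k j. c (Suc k) < j \<Longrightarrow> j \<le> c k \<Longrightarrow> West \<in> edges (t j) \<longleftrightarrow> j \<le> d k"
    by metis
  have il: "interlace c d" using d by (simp add: interlace_def)
  have W0: "West \<in> edges (t j)" if j: "c 0 < j" for j
  proof (rule ccontr)
    assume nj: "West \<notin> edges (t j)"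
    have "West \<notin> edges (t i)" if "j \<le> i" for i
      using that
    proof (induction i rule: int_ge_induct)
      case (step i)
      have "i \<notin> range c"
      proof
        assume "i \<in> range c"
        then obtain k where "i = c k" by blast
        then show False using step j decreasing_le[of c 0 k, OF dec] by simp
      qed
      then show ?case using step r(3)[of i] south by blast
    qed (rule nj)
    then show False using right[of "max b j"] by simp
  qed
  have N0: "North \<notin> edges (t j)" if "c 0 \<le> j" for j
    using r(2)[of j] W0[of "j + 1"] W0[of j] south that by (cases "j = c 0") auto
  have eqN: "North \<in> edges (t j) \<longleftrightarrow> j \<in> range d" for j
  proof
    assume n: "North \<in> edges (t j)"
    show "j \<in> range d"
    proof (rule decreasing_locate[of c j, OF dec])
      fix k assume k: "j = c k"
      then obtain l where l: "k = Suc l" using n N0 by (cases k) auto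
      then show ?thesis using N[of l j] k n dec[of l] by auto
    next
      fix k assume "c (Suc k) < j" "j < c k"
      then show ?thesis using N[of k j] n by auto
    qed (use n N0[of j] in auto)
  next
    assume "j \<in> range d"
    then obtain k where "j = d k" by auto
    then show "North \<in> edges (t j)" using N[of k j] d by auto
  qed
  have eqW: "West \<in> edges (t j) \<longleftrightarrow> west c d j" for j
  proof (rule decreasing_locate[of c j, OF dec])
    assume "c 0 < j"
    then show ?thesis using W0 by (simp add: west_def)
  next
    fix k assume "j = c k"
    then show ?thesis using r(1)[of j] south west_south[OF il] by auto
  next
    fix k assume k: "c (Suc k) < j" "j < c k"
    have "west c d j \<longleftrightarrow> j \<le> d k"
    proof
      assume "west c d j"
      moreover have "\<not> c 0 < j" using k decreasing_le[of c 0 k, OF dec] by auto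
      ultimately obtain l where l: "c (Suc l) < j" "j \<le> d l" by (auto simp: west_def)
      have "k < Suc l" using l k decreasing_le[of c "Suc l" k, OF dec] by fastforce
      moreover have "l < Suc k" using l k d(2)[of l] decreasing_le[of c "Suc k" l, OF dec] by fastforce
      ultimately have "l = k" by simp
      then show "j \<le> d k" using l by simp
    qed (use k in \<open>auto simp: west_def\<close>)
    then show ?thesis using W[of k j] k by simp
  qed
  have "t j = row_tile c d j" for j
    using tile_of_edges[OF nc[of j]] by (simp add: row_tile_def south eqN eqW)
  then show ?thesis using il by blast
qed

text \<open>\<open>advance\<close> is total and moves east by default, so \<open>heads_east\<close>
  by itself says nothing about tiles. This invariant shows that a walk that starts on a pipe stays
  on it.\<close>

lemma pipe_enters:
  assumes "tiling P" "South \<in> edges (P (0, c))"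
  shows "fst (fst (pipe P c n)) \<le> 0 \<and> snd (pipe P c n) \<in> {South, West} \<and>
    snd (pipe P c n) \<in> edges (P (fst (pipe P c n)))"
proof (induction n)
  case 0
  then show ?case using assms by (simp add: pipe_def)
next
  case (Suc n)
  obtain i j s where q: "pipe P c n = ((i, j), s)" by (metis surj_pair)
  have h: "(i, j) \<in> halfplane" using Suc q by (simp add: halfplane_def)
  have e: "East \<in> edges (P (i, j)) \<longleftrightarrow> West \<in> edges (P (i, j + 1))"
    and n: "North \<in> edges (P (i, j)) \<longleftrightarrow> South \<in> edges (P (i - 1, j))"
    using assms(1) h by (auto simp: tiling_def)
  have "pipe P c (Suc n) = advance P ((i, j), s)" using q by (simp add: pipe_def)
  then show ?case using Suc q e n by (cases "P (i, j)") auto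
qed

text \<open>The rows are decoded one after another by dependent choice, the exits of a row being the
  entries of the next. The hooks then force the ground state from row -r on.\<close>

lemma tiling_of_surj:
  assumes P: "tiling P" "\<And>s. s \<in> halfplane \<Longrightarrow> P s \<noteq> Crossing"
    and entry: "entry_columns P = range c"
    and dec: "\<And>k. c (Suc k) < c k"
    and east: "\<And>m. heads_east P (c m) (- int m)"
    and hooks: "\<And>N. N \<le> - int r \<Longrightarrow> is_hook P N"
  shows "P \<in> tiling_of ` chains 0 r c"
proof -
  let ?Q = "\<lambda>m c'. (m = 0 \<longrightarrow> c' = c) \<and> (\<forall>k. c' (Suc k) < c' k)
    \<and> (\<forall>j. South \<in> edges (P (- int m, j)) \<longleftrightarrow> j \<in> range c')"
  let ?R = "\<lambda>m c' d. interlace c' d \<and> (\<forall>j. P (- int m, j) = row_tile c' d j)"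
  have h: "(- int m, j) \<in> halfplane" for m j by (simp add: halfplane_def)
  have "\<exists>\<gamma>. \<forall>m. ?Q m (\<gamma> m) \<and> ?R m (\<gamma> m) (\<gamma> (Suc m))"
  proof (rule dependent_nat_choice)
    show "\<exists>x. ?Q 0 x" using entry dec by (auto simp: entry_columns_def)
    fix c' m assume Q: "?Q m c'"
    \<comment> \<open>It is the m-th pipe counted from 0 at the southern boundary that leaves in row
      -m. Following it supplies the west edges that \<open>row_tile_exists\<close> demands far to
      the right.\<close>
    obtain n b where nb: "\<And>l. pipe P (c m) (n + l) = ((- int m, b + int l), West)"
      using east[of m] by (auto simp: heads_east_def)
    have "South \<in> edges (P (0, c m))" using entry by (auto simp: entry_columns_def)
    note enters = pipe_enters[OF P(1) this]
    have right: "West \<in> edges (P (- int m, j))" if "j \<ge> b" for j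
      using enters[of "n + nat (j - b)"] nb[of "nat (j - b)"] that by simp
    have "\<exists>d. interlace c' d \<and> (\<lambda>j. P (- int m, j)) = row_tile c' d"
    proof (rule row_tile_exists)
      show "East \<in> edges (P (- int m, j)) \<longleftrightarrow> West \<in> edges (P (- int m, j + 1))" for j
        using P(1) h[of m j] by (auto simp: tiling_def)
    qed (use Q right P(2) h in auto)
    then obtain d where d: "interlace c' d" "\<And>j. P (- int m, j) = row_tile c' d j"
      by (auto simp: fun_eq_iff)
    have "South \<in> edges (P (- int (Suc m), j)) \<longleftrightarrow> j \<in> range d" for j
    proof -
      have m1: "- int m - 1 = - int (Suc m)" by simp
      have "North \<in> edges (P (- int m, j)) \<longleftrightarrow> South \<in> edges (P (- int m - 1, j))"
        using P(1) h[of m j] by (auto simp: tiling_def)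
      then show ?thesis unfolding m1 d(2) by (simp only: row_tile_North[OF d(1)])
    qed
    then have "?Q (Suc m) d \<and> ?R m c' d"
      using interlace_decreasing(2)[OF d(1)] d by simp
    then show "\<exists>d. ?Q (Suc m) d \<and> ?R m c' d" by blast
  qed
  then obtain \<gamma> where g: "\<forall>m. ?Q m (\<gamma> m) \<and> ?R m (\<gamma> m) (\<gamma> (Suc m))" by (rule exE)
  have \<gamma>: "?Q m (\<gamma> m)" "?R m (\<gamma> m) (\<gamma> (Suc m))" for m
    by (rule conjunct1[OF spec[OF g, of m]], rule conjunct2[OF spec[OF g, of m]])
  have "\<gamma> m = ground m" if m: "m \<ge> r" for m
  proof (rule decreasing_range_eq)
    show "\<gamma> m (Suc k) < \<gamma> m k" for k using \<gamma>(1)[of m] by blast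
    show "ground m (Suc k) < ground m k" for k by (simp add: ground_def)
    \<comment> \<open>The square lies on the leg of hook j, or it is the corner of hook -m, or it
      lies on the arm of hook -m.\<close>
    have "South \<in> edges (P (- int m, j)) \<longleftrightarrow> j \<le> - int m" for j
    proof (cases j "- int m" rule: linorder_cases)
      case less
      then have "P (- int m, j) = Vert" using hooks[of j] m by (simp add: is_hook_def)
      then show ?thesis using less by simp
    next
      case equal
      then have "P (- int m, j) = SE" using hooks[of j] m by (simp add: is_hook_def)
      then show ?thesis using equal by simp
    next
      case greater
      then have "P (- int m, j) = Horiz" using hooks[of "- int m"] m by (simp add: is_hook_def)
      then show ?thesis using greater by simp
    qed
    then have "range (\<gamma> m) = {..- int m}" using \<gamma>(1)[of m] by blast
    also have "{..- int m} = range (ground m)"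
    proof
      show "{..- int m} \<subseteq> range (ground m)"
      proof
        fix j assume "j \<in> {..- int m}"
        then show "j \<in> range (ground m)"
          by (intro image_eqI[of _ _ "nat (- j - int m)"]) (auto simp: ground_def)
      qed
    qed (auto simp: ground_def)
    finally show "range (\<gamma> m) = range (ground m)" .
  qed
  then have "\<gamma> \<in> chains 0 r c" using \<gamma> by (simp add: chains_def)
  moreover have "P = tiling_of \<gamma>"
  proof
    fix s :: "int \<times> int"
    obtain i j where s: "s = (i, j)" by (cases s)
    show "P s = tiling_of \<gamma> s"
    proof (cases "i \<le> 0")
      case True
      then obtain m where "i = - int m" using nonpos_row by blast
      then show ?thesis using \<gamma>(2)[of m] by (simp add: s tiling_of_row)
    next
      case False
      then show ?thesis using P(1)
        by (auto simp: s tiling_of_def tiling_def halfplane_def PiE_def extensional_def)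
    qed
  qed
  ultimately show ?thesis by blast
qed


section \<open>The entry columns of a partition\<close>

text \<open>The values w_\<lambda>(-k) for k >= 0 in decreasing order, and also the row labels of
  the Jacobi-Trudi matrix for m = 0. That these two agree is what ties the determinant to the
  pipedreams.\<close>

definition columns :: "nat list \<Rightarrow> nat \<Rightarrow> int" where
  "columns lam k = int (part lam (Suc k)) - int k"

lemma part_antimono:
  assumes "is_partition lam" "1 \<le> i" "i \<le> j"
  shows "part lam j \<le> part lam i"
proof (cases "j \<le> length lam \<and> i < j")
  case True
  then have "lam ! (j - 1) \<le> lam ! (i - 1)"
    using assms sorted_wrt_nth_less[of "(\<ge>)" lam "i - 1" "j - 1"] by (auto simp: is_partition_def)
  then show ?thesis using True assms by (simp add: part_def)
next
  case False
  then show ?thesis using assms by (cases "i = j") (auto simp: part_def)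
qed

lemma state_columns:
  assumes "is_partition lam"
  shows "state (length lam) 0 (columns lam)"
  unfolding state_def
proof (intro conjI allI impI)
  fix k
  show "columns lam (Suc k) < columns lam k"
    using part_antimono[OF assms, of "Suc k" "Suc (Suc k)"] by (simp add: columns_def)
qed (simp add: columns_def part_def ground_def)

lemma w_perm_nonpos: "w_perm lam ` {..0} = range (columns lam)"
proof -
  have e: "w_perm lam (- int k) = columns lam k" for k
    by (simp add: w_perm_def columns_def nat_add_distrib[of 1 "int k", simplified] Suc_as_int)
  show ?thesis
  proof
    show "w_perm lam ` {..0} \<subseteq> range (columns lam)"
    proof
      fix z assume "z \<in> w_perm lam ` {..0}"
      then obtain i where "z = w_perm lam i" "i \<le> 0" by auto
      then show "z \<in> range (columns lam)" using nonpos_row[of i] e by auto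
    qed
    show "range (columns lam) \<subseteq> w_perm lam ` {..0}"
    proof
      fix z assume "z \<in> range (columns lam)"
      then obtain k where "z = columns lam k" by blast
      then show "z \<in> w_perm lam ` {..0}" using e[of k] by (intro image_eqI[of _ _ "- int k"]) auto
    qed
  qed
qed

text \<open>If j <= \<lambda>_(k+1), then \<lambda>'_j >= k + 1 and j - \<lambda>'_j lies below
  \<open>columns lam k\<close>; otherwise \<lambda>'_j <= k and it lies above. So the two sets of
  values are disjoint, and a nonpositive integer in a gap of \<open>columns lam\<close> is exhibited
  as some j - \<lambda>'_j.\<close>

lemma w_perm_pos:
  assumes lam: "is_partition lam"
  shows "{..0} \<inter> w_perm lam ` {0<..} = {..0} - range (columns lam)"
proof -
  have fin: "finite {i. 1 \<le> i \<and> j \<le> part lam i}" if "j > 0" for j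
    by (rule finite_subset[of _ "{..length lam}"]) (use that in \<open>auto simp: part_def split: if_splits\<close>)
  have "w_perm lam (int j) \<noteq> columns lam k" if j: "j > 0" for j k
  proof (cases "j \<le> part lam (Suc k)")
    case True
    have "{1..Suc k} \<subseteq> {i. 1 \<le> i \<and> j \<le> part lam i}"
    proof
      fix i assume "i \<in> {1..Suc k}"
      then show "i \<in> {i. 1 \<le> i \<and> j \<le> part lam i}"
        using True part_antimono[OF lam, of i "Suc k"] by auto
    qed
    then have "card {1..Suc k} \<le> conj_part lam j"
      unfolding conj_part_def by (rule card_mono[OF fin[OF j]])
    then have "Suc k \<le> conj_part lam j" by simp
    then show ?thesis using True j by (simp add: w_perm_def columns_def)
  next
    case False
    have "{i. 1 \<le> i \<and> j \<le> part lam i} \<subseteq> {1..k}"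
    proof
      fix i assume i: "i \<in> {i. 1 \<le> i \<and> j \<le> part lam i}"
      then have "\<not> Suc k \<le> i" using False part_antimono[OF lam, of "Suc k" i] by auto
      then show "i \<in> {1..k}" using i by auto
    qed
    then have "conj_part lam j \<le> card {1..k}"
      unfolding conj_part_def by (intro card_mono) auto
    then have "conj_part lam j \<le> k" by simp
    then show ?thesis using False j by (simp add: w_perm_def columns_def)
  qed
  then have disj: "w_perm lam i \<notin> range (columns lam)" if "i > 0" for i
    using that zero_less_imp_eq_int[of i] by auto
  have cover: "z \<in> w_perm lam ` {0<..}" if z: "z \<le> 0" "z \<notin> range (columns lam)" for z
  proof (rule decreasing_locate[of "columns lam" z])
    show "columns lam (Suc k) < columns lam k" for k
      using state_columns[OF lam] by (simp add: state_def)
    assume "columns lam 0 < z"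
    then show ?thesis using z by (simp add: columns_def)
  next
    fix k assume "z = columns lam k"
    then show ?thesis using z by blast
  next
    fix k assume k: "columns lam (Suc k) < z" "z < columns lam k"
    \<comment> \<open>Chosen so that j - (k + 1) = z; the position of z in the gap gives
      \<lambda>'_j = k + 1.\<close>
    define j where "j = nat (z + int k + 1)"
    have j: "int j = z + int k + 1" "j > 0" using k by (simp_all add: j_def columns_def)
    have 1: "part lam (Suc (Suc k)) < j" and 2: "j \<le> part lam (Suc k)"
      using k j by (simp_all add: columns_def)
    have "{i. 1 \<le> i \<and> j \<le> part lam i} = {1..Suc k}"
    proof
      show "{i. 1 \<le> i \<and> j \<le> part lam i} \<subseteq> {1..Suc k}"
      proof
        fix i assume i: "i \<in> {i. 1 \<le> i \<and> j \<le> part lam i}"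
        then have "\<not> Suc (Suc k) \<le> i" using 1 part_antimono[OF lam, of "Suc (Suc k)" i] by auto
        then show "i \<in> {1..Suc k}" using i by auto
      qed
      show "{1..Suc k} \<subseteq> {i. 1 \<le> i \<and> j \<le> part lam i}"
      proof
        fix i assume "i \<in> {1..Suc k}"
        then show "i \<in> {i. 1 \<le> i \<and> j \<le> part lam i}"
          using 2 part_antimono[OF lam, of i "Suc k"] by auto
      qed
    qed
    then have "conj_part lam j = Suc k" by (simp add: conj_part_def)
    then have "w_perm lam (int j) = int j - int (Suc k)" using j(2) by (simp add: w_perm_def)
    then have "w_perm lam (int j) = z" using j(1) by simp
    then show ?thesis using j(2) by (metis greaterThan_iff image_eqI of_nat_0_less_iff)
  qed
  show ?thesis using disj cover by auto
qed

lemma entry_columns_iff: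
  assumes "is_partition lam"
  shows "entry_columns P \<inter> {0<..} = I_plus lam \<and> {..0} - entry_columns P = I_minus lam
    \<longleftrightarrow> entry_columns P = range (columns lam)"
proof -
  have p: "I_plus lam = range (columns lam) \<inter> {0<..}"
    unfolding I_plus_def w_perm_nonpos by blast
  have m: "I_minus lam = {..0} - range (columns lam)"
    unfolding I_minus_def using w_perm_pos[OF assms] .
  show ?thesis
  proof
    assume h: "entry_columns P \<inter> {0<..} = I_plus lam \<and> {..0} - entry_columns P = I_minus lam"
    show "entry_columns P = range (columns lam)"
    proof (rule Set.set_eqI)
      fix j :: int
      show "j \<in> entry_columns P \<longleftrightarrow> j \<in> range (columns lam)"
        using h unfolding p m by (cases "j > 0") (auto simp: set_eq_iff not_less)
    qed
  qed (simp add: p m)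
qed

text \<open>The union over r reflects that each pipedream consists of hooks from some row on, but
  with no common bound on that row.\<close>

lemma halfplane_pipedreams_eq:
  assumes lam: "is_partition lam"
  shows "halfplane_pipedreams lam = tiling_of ` (\<Union>r. chains 0 r (columns lam))"
proof (intro equalityI subsetI)
  fix P assume P: "P \<in> halfplane_pipedreams lam"
  have dec: "columns lam (Suc k) < columns lam k" for k
    using state_columns[OF lam] by (simp add: state_def)
  have entry: "entry_columns P = range (columns lam)"
    unfolding entry_columns_iff[OF lam, symmetric] using P by (simp add: halfplane_pipedreams_def)
  obtain N0 where N0: "N0 \<le> 0" "\<And>N. N \<le> N0 \<Longrightarrow> is_hook P N"
    using P by (auto simp: halfplane_pipedreams_def)
  have "P \<in> tiling_of ` chains 0 (nat (- N0)) (columns lam)"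
  proof (rule tiling_of_surj)
    show "tiling P" "\<And>s. s \<in> halfplane \<Longrightarrow> P s \<noteq> Crossing"
      using P by (simp_all add: halfplane_pipedreams_def)
    show "heads_east P (columns lam m) (- int m)" for m
    proof -
      have e: "\<forall>i\<ge>1. \<forall>c\<in>entry_columns P. card {c' \<in> entry_columns P. c' \<ge> c} = i \<longrightarrow> heads_east P c (1 - int i)"
        using P by (simp add: halfplane_pipedreams_def)
      have "card {c' \<in> entry_columns P. c' \<ge> columns lam m} = Suc m"
        unfolding entry by (rule card_decreasing_ge[of "columns lam", OF dec])
      then have "heads_east P (columns lam m) (1 - int (Suc m))"
        using e[rule_format, of "Suc m" "columns lam m"] by (simp add: entry)
      then show ?thesis by simp
    qed
  qed (use entry dec N0 in auto)
  then show "P \<in> tiling_of ` (\<Union>r. chains 0 r (columns lam))" by blast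
next
  fix P assume "P \<in> tiling_of ` (\<Union>r. chains 0 r (columns lam))"
  then obtain r \<gamma> where P: "P = tiling_of \<gamma>" and \<gamma>: "\<gamma> \<in> chains 0 r (columns lam)" by blast
  have il: "interlace (\<gamma> i) (\<gamma> (Suc i))" for i using \<gamma> by (simp add: chains_def)
  have g: "\<gamma> i = ground i" if "i \<ge> r" for i using \<gamma> that by (simp add: chains_def)
  have st: "state (length lam) i (\<gamma> i)" for i
    using chains_state[OF state_columns[OF lam] \<gamma>, of i] by simp
  have entry: "entry_columns P = range (columns lam)"
    using entry_columns_tiling_of[of \<gamma>, OF il] \<gamma> by (simp add: P chains_def)
  have "heads_east P c (1 - int i)"
    if "i \<ge> 1" "c \<in> entry_columns P" "card {c' \<in> entry_columns P. c' \<ge> c} = i" for i c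
    using card_entry_columns[of \<gamma> c i, OF il] heads_east_tiling_of[of \<gamma> "i - 1", OF il] that
    by (simp add: P of_nat_diff)
  moreover have "\<exists>N0\<le>0. \<forall>N\<le>N0. is_hook P N"
    using is_hook_tiling_of[of \<gamma> r "length lam", OF il g st]
    by (intro exI[of _ "- int (r + length lam)"]) (auto simp: P)
  ultimately show "P \<in> halfplane_pipedreams lam"
    using tiling_tiling_of[of \<gamma>, OF il] tiling_of_not_Crossing[of \<gamma>, OF il]
      entry entry_columns_iff[OF lam, of P]
    unfolding halfplane_pipedreams_def by (simp add: P)
qed

section \<open>Comparison of coefficients, one monomial at a time\<close>

lemma exists_far:
  fixes t :: "var \<Rightarrow>\<^sub>0 nat"
  shows "\<exists>M. Poly_Mapping.keys t \<inter> far L M = {}"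
proof -
  let ?g = "\<lambda>v. case v of XVar i \<Rightarrow> nat (- i) | AVar j \<Rightarrow> nat (L - j)"
  \<comment> \<open>\<open>?g v\<close> is the largest M for which a variable v of nonpositive
    x-index or of a-index at most L lies in \<open>far L M\<close>; the sum bounds all of these at
    once.\<close>
  define M where "M = Suc (\<Sum>v\<in>Poly_Mapping.keys t. ?g v)"
  have "v \<notin> far L M" if v: "v \<in> Poly_Mapping.keys t" for v
  proof -
    have "?g v < M"
      unfolding M_def using member_le_sum[OF v, of ?g] by simp
    then show ?thesis by (cases v) (auto simp: far_def)
  qed
  then show ?thesis by blast
qed

theorem theorem5p6:
  fixes lam :: "nat list"
  assumes "is_partition lam"
  shows "mps_has_sum weight (halfplane_pipedreams lam) (double_schur lam)"
proof -
  let ?n = "length lam" and ?c = "columns lam"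
  let ?L = "?c 0" and ?C = "\<lambda>r. chains 0 r (columns lam)"
  note st = state_columns[OF assms]
  have L: "?L \<ge> 0" by (simp add: columns_def)
  have schur: "double_schur lam = jt_det ?n 0 ?c"
    unfolding double_schur_eq by (rule jt_det_cong) (simp add: columns_def)
  have il: "interlace (\<gamma> i) (\<gamma> (Suc i))" if "\<gamma> \<in> ?C r" for \<gamma> i r
    using that by (simp add: chains_def)
  \<comment> \<open>The left side does not mention r, so a chain has the same weight for every
    admissible bound.\<close>
  have weight: "weight (tiling_of \<gamma>) = chain_weight ?n 0 r \<gamma>" if g: "\<gamma> \<in> ?C r" for \<gamma> r
    using weight_tiling_of[of \<gamma> r ?n, OF il[OF g]] chains_state[OF st g] g by (simp add: chains_def)
  have inj: "inj_on tiling_of (?C M)" for M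
    using tiling_of_inj il by (intro inj_onI) blast
  have main: "finite {P \<in> halfplane_pipedreams lam. mps_coeff (weight P) t \<noteq> 0} \<and>
      (\<Sum>P | P \<in> halfplane_pipedreams lam \<and> mps_coeff (weight P) t \<noteq> 0. mps_coeff (weight P) t) =
      mps_coeff (double_schur lam) t" for t
  proof -
    obtain M where M: "Poly_Mapping.keys t \<inter> far ?L M = {}" using exists_far by blast
    then have k: "mps_coeff (kill (far ?L M) f) t = mps_coeff f t" for f :: series
      by (simp add: coeff_kill)
    have jt: "finite (?C M)" "kill (far ?L M) (jt_det ?n 0 ?c) =
        kill (far ?L M) (\<Sum>\<gamma>\<in>?C M. chain_weight ?n 0 M \<gamma>)"
      using jt_det_chains[OF st, of ?L M] by simp_all
    \<comment> \<open>A pipedream that deviates from the hooks at or above row -M has a weight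
      killed by \<open>far ?L M\<close>, so t does not occur in it. As \<open>?C M\<close> is
      finite, this also gives summability.\<close>
    have sub: "{P \<in> halfplane_pipedreams lam. mps_coeff (weight P) t \<noteq> 0} \<subseteq> tiling_of ` ?C M"
    proof
      fix P assume P: "P \<in> {P \<in> halfplane_pipedreams lam. mps_coeff (weight P) t \<noteq> 0}"
      then obtain r \<gamma> where \<gamma>: "P = tiling_of \<gamma>" "\<gamma> \<in> ?C r"
        by (auto simp: halfplane_pipedreams_eq[OF assms])
      have "\<gamma> \<in> ?C M"
      proof (rule ccontr)
        assume "\<gamma> \<notin> ?C M"
        then have "kill (far ?L M) (chain_weight ?n 0 r \<gamma>) = 0"
          using chain_weight_far[OF st \<gamma>(2) _ L] by blast
        then have "mps_coeff (weight P) t = 0" using k[of "weight P"] weight[OF \<gamma>(2)] \<gamma>(1) by simp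
        then show False using P by simp
      qed
      then show "P \<in> tiling_of ` ?C M" using \<gamma>(1) by blast
    qed
    have all: "tiling_of ` ?C M \<subseteq> halfplane_pipedreams lam"
      unfolding halfplane_pipedreams_eq[OF assms] by blast
    have "(\<Sum>P | P \<in> halfplane_pipedreams lam \<and> mps_coeff (weight P) t \<noteq> 0. mps_coeff (weight P) t) =
        (\<Sum>P\<in>tiling_of ` ?C M. mps_coeff (weight P) t)"
      using jt(1) sub all by (intro sum.mono_neutral_left) auto
    also have "\<dots> = (\<Sum>\<gamma>\<in>?C M. mps_coeff (chain_weight ?n 0 M \<gamma>) t)"
      by (subst sum.reindex[OF inj]) (simp add: weight)
    also have "\<dots> = mps_coeff (jt_det ?n 0 ?c) t"
      using arg_cong[OF jt(2), of "\<lambda>f. mps_coeff f t"] unfolding k by simp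
    finally show ?thesis using finite_subset[OF sub] jt(1) schur by simp
  qed
  show ?thesis
    unfolding mps_has_sum_def mps_summable_def
  proof (intro conjI allI)
    show "mps_suminf weight (halfplane_pipedreams lam) = double_schur lam"
      by (rule mps_eqI) (simp add: coeff_suminf main)
  qed (use main in blast)
qed

end
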